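(* Let the domain $\Omega$, boundary parts, coefficients $\rho,\alpha,c_0,\boldsymbol C,\boldsymbol K$, finite element spaces $\boldsymbol V_h$, $Q_h$ (with $r\ge 2$ and either the continuous or the discontinuous choice of $Q_h$), forms $A_\gamma, C, B_\gamma$, functionals $F_\gamma, G_\gamma$, time mesh and quadrature $Q_n$ be as defined in the context, and let $k\in\mathbb N_0$. Assume that the stabilization parameters ($\gamma_a,\gamma_b$ for the continuous choice of $Q_h$; $\gamma_a,\gamma$ for the discontinuous choice) are chosen sufficiently large. Then for every $n\in\{1,\dots,N\}$ and all given $\boldsymbol u_h^{n-1}\in \boldsymbol V_h$, $\boldsymbol v_h^{n-1}\in\boldsymbol V_h$, $p_h^{n-1}\in Q_h$, there exists exactly one triple $$(\boldsymbol u_{\tau,h},\boldsymbol v_{\tau,h},p_{\tau,h})\in \mathbb P_k(I_n;\boldsymbol V_h)\times \mathbb P_k(I_n;\boldsymbol V_h)\times\mathbb P_k(I_n;Q_h)$$ such that $$Q_n\big(\langle \partial_t \boldsymbol u_{\tau,h},\boldsymbol\phi_{\tau,h}\rangle-\langle \boldsymbol v_{\tau,h},\boldsymbol\phi_{\tau,h}\rangle\big)+\langle \boldsymbol u_{\tau,h}^+(t_{n-1}),\boldsymbol\phi_{\tau,h}^+(t_{n-1})\rangle=\langle \boldsymbol u_h^{n-1},\boldsymbol\phi_{\tau,h}^+(t_{n-1})\rangle,$$ $$Q_n\big(\langle\rho\,\partial_t\boldsymbol v_{\tau,h},\boldsymbol\chi_{\tau,h}\rangle+A_\gamma(\boldsymbol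 u_{\tau,h},\boldsymbol\chi_{\tau,h})+C(\boldsymbol\chi_{\tau,h},p_{\tau,h})\big)+\langle\rho\,\boldsymbol v_{\tau,h}^+(t_{n-1}),\boldsymbol\chi_{\tau,h}^+(t_{n-1})\rangle=Q_n\big(F_\gamma(\boldsymbol\chi_{\tau,h})\big)+\langle\rho\,\boldsymbol v_h^{n-1},\boldsymbol\chi_{\tau,h}^+(t_{n-1})\rangle,$$ $$\begin{aligned}&Q_n\big(\langle c_0\partial_t p_{\tau,h},\psi_{\tau,h}\rangle-C(\partial_t\boldsymbol u_{\tau,h},\psi_{\tau,h})+B_\gamma(p_{\tau,h},\psi_{\tau,h})\big)\\&\quad+\langle c_0p_{\tau,h}^+(t_{n-1})+\alpha\nabla\cdot\boldsymbol u_{\tau,h}^+(t_{n-1}),\psi_{\tau,h}^+(t_{n-1})\rangle-\alpha\langle\boldsymbol u_{\tau,h}^+(t_{n-1})\cdot\boldsymbol n,\psi_{\tau,h}^+(t_{n-1})\rangle_{\Gamma^D_{\boldsymbol u}}\\&=Q_n\big(G_\gamma(\psi_{\tau,h})\big)+\langle c_0p_h^{n-1}+\alpha\nabla\cdot\boldsymbol u_h^{n-1},\psi_{\tau,h}^+(t_{n-1})\rangle-\alpha\langle\boldsymbol u_D(t_{n-1})\cdot\boldsymbol n,\psi_{\tau,h}^+(t_{n-1})\rangle_{\Gamma^D_{\boldsymbol u}}\end{aligned}$$ for all $(\boldsymbol\phi_{\tau,h},\boldsymbol\chi_{\tau,h},\psi_{\tau,h})\in\mathbb P_k(I_n;\boldsymbol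 V_h)\times\mathbb P_k(I_n;\boldsymbol V_h)\times\mathbb P_k(I_n;Q_h)$.
   Context: **Domain and coefficients.** $\Omega\subset\mathbb R^d$, $d\in\{2,3\}$, is an open bounded Lipschitz domain with outer unit normal $\boldsymbol n$; $\partial\Omega=\Gamma^D_{\boldsymbol u}\cup\Gamma^N_{\boldsymbol u}=\Gamma^D_p\cup\Gamma^N_p$ with closed portions $\Gamma^D_{\boldsymbol u},\Gamma^D_p$ of non-zero measure. $\rho,\alpha,c_0>0$ are constants. $\boldsymbol C=(C_{ijkl})$ is a constant symmetric fourth order elasticity tensor and $\boldsymbol K\in\mathbb R^{d,d}$ a constant symmetric matrix such that for some $k_0,k_1>0$: $\sum_{i,j,k,l}\xi_{ij}C_{ijkl}\xi_{kl}\ge k_0\sum_{j,k}|\xi_{jk}|^2$ for all symmetric $\boldsymbol\xi\in\mathbb R^{d,d}$, and $\sum_{i,j}\xi_iK_{ij}\xi_j\ge k_1\sum_i|\xi_i|^2$ for all $\boldsymbol\xi\in\mathbb R^d$. $\boldsymbol\varepsilon(\boldsymbol u)=(\nabla\boldsymbol u+(\nabla\boldsymbol u)^\top)/2$. $\langle\cdot,\cdot\rangle_S$ is the $L^2(S)$ inner product (duality pairing where needed), $\langle\cdot,\cdot\rangle=\langle\cdot,\cdot\rangle_\Omega$. **Time.** $0=t_0<t_1<\dots<t_N=T$, $I_n=(t_{n-1},t_n]$, $\tau_n=t_n-t_{n-1}$. For a Banach space $B$, $\mathbb P_k(I_n;B)$ is the space of polynomials in $t\in I_n$ of degree at most $k$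 with coefficients in $B$. $w^+(t_{n-1})=\lim_{t\to t_{n-1}+0}w(t)$. $Q_n(w)=\frac{\tau_n}{2}\sum_{\mu=1}^{k+1}\hat\omega_\mu\,w(t_{n,\mu})$ is the right-sided $(k+1)$-point Gauss–Radau quadrature formula on $I_n$ (so $t_{n,k+1}=t_n$; it is exact for polynomials of degree at most $2k$). **Space.** $\mathcal T_h$ is a mesh of $\Omega$ consisting of open quadrilaterals ($d=2$) or hexahedra ($d=3$), a member of a quasi-uniform family; boundary faces are compatible with the splittings of $\partial\Omega$. Let $r\ge2$. $\boldsymbol V_h$ is the space of $\boldsymbol v_h\in H^1(\Omega)^d\cap C(\overline\Omega)^d$ with $\boldsymbol v_h|_K$ in the mapped space $\mathbb Q_r^d$ for all $K\in\mathcal T_h$. $Q_h$ is one of: the continuous choice, $\{q_h\in C(\overline\Omega): q_h|_K\in \mathbb Q_{r-1}\text{ (mapped) for all }K\}$; or the discontinuous choice, $\{q_h\in L^2(\Omega): q_h|_K\in\mathbb P_{r-1}\text{ (mapped) for all }K\}$. $\mathcal F_h$ is the set of all (interior and boundary) faces; $\mathcal F_h^{D,\boldsymbol u},\mathcal F_h^{D,p},\mathcal F_h^{N,p}\subset\mathcal F_h$ are the faces on $\Gamma^D_{\boldsymbol u},\Gamma_p^D,\Gamma_p^N$. On an interior face $F=\partial K^+\cap\partial K^-$: $\{\!\{w\}\!\}=\frac12(w^++w^-)$, $[\![w]\!]=w^+-w^-$ (with $\boldsymbol n$ a unit normal of $F$ oriented consistently, from $K^+$ to $K^-$), $h_F=\frac12(|K^+|_d+|K^-|_d)$;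 on boundary faces $F\subset\partial K\cap\partial\Omega$: $\{\!\{w\}\!\}=[\![w]\!]=w|_K$, $h_F=|K|_d$. Here $|\cdot|_d$ is Hausdorff measure. A factor $1/h_F$ in front of an integral over a boundary part is understood facewise. **Forms.** For $\boldsymbol w_h,\boldsymbol\chi_h\in\boldsymbol V_h$, $q_h,\psi_h\in Q_h$, and boundary functions $\boldsymbol w,q$: - $a_\gamma(\boldsymbol w,\boldsymbol\chi_h)=-\langle\boldsymbol w,\boldsymbol C\boldsymbol\varepsilon(\boldsymbol\chi_h)\boldsymbol n\rangle_{\Gamma^D_{\boldsymbol u}}+\frac{\gamma_a}{h_F}\langle\boldsymbol w,\boldsymbol\chi_h\rangle_{\Gamma^D_{\boldsymbol u}}$, - $b_\gamma(q,\psi_h)=-\langle q,\boldsymbol K\nabla\psi_h\cdot\boldsymbol n\rangle_{\Gamma^D_p}+\frac{\gamma_b}{h_F}\langle q,\psi_h\rangle_{\Gamma^D_p}$, - $A_\gamma(\boldsymbol w_h,\boldsymbol\chi_h)=\langle\boldsymbol C\boldsymbol\varepsilon(\boldsymbol w_h),\boldsymbol\varepsilon(\boldsymbol\chi_h)\rangle-\langle\boldsymbol C\boldsymbol\varepsilon(\boldsymbol w_h)\boldsymbol n,\boldsymbol\chi_h\rangle_{\Gamma^D_{\boldsymbol u}}+a_\gamma(\boldsymbol w_h,\boldsymbol\chi_h)$, - $C(\boldsymbol\chi_h,q_h)=-\alpha\langle\nabla\cdot\boldsymbol\chi_h,q_h\rangle+\alpha\langle\boldsymbol\chi_h\cdot\boldsymbol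 n,q_h\rangle_{\Gamma^D_{\boldsymbol u}}$, - continuous choice of $Q_h$: $B_\gamma(q_h,\psi_h)=\langle\boldsymbol K\nabla q_h,\nabla\psi_h\rangle-\langle\boldsymbol K\nabla q_h\cdot\boldsymbol n,\psi_h\rangle_{\Gamma^D_p}+b_\gamma(q_h,\psi_h)$, - discontinuous choice of $Q_h$: $B_\gamma(q_h,\psi_h)=\sum_{K\in\mathcal T_h}\langle\boldsymbol K\nabla q_h,\nabla\psi_h\rangle_K-\sum_{F\in\mathcal F_h}\big(\langle\{\!\{\boldsymbol K\nabla q_h\}\!\}\cdot\boldsymbol n,[\![\psi_h]\!]\rangle_F+\langle[\![q_h]\!],\{\!\{\boldsymbol K\nabla\psi_h\}\!\}\cdot\boldsymbol n\rangle_F\big)+\sum_{F\in\mathcal F_h}\frac{\gamma}{h_F}\langle[\![q_h]\!],[\![\psi_h]\!]\rangle_F$. "Sufficiently large" means: there are thresholds, independent of $n$, the time mesh and the data, such that the assertion holds whenever the parameters exceed them. **Data.** $\boldsymbol f,\boldsymbol u_D,\boldsymbol t_N,g,p_D,p_N$ are given time-dependent data, $\boldsymbol v_D=\partial_t\boldsymbol u_D$, such that at each quadrature node the following are well-defined linear functionals on $\boldsymbol V_h$ and $Q_h$, and $\boldsymbol u_D(t_{n-1})$ is well-defined (e.g. $\boldsymbol f\in\boldsymbol H^{-1}$, $\boldsymbol u_D\in\boldsymbol H^{1/2}(\Gamma^D_{\boldsymbol u})$, $\boldsymbol t_N\in\boldsymbol H^{-1/2}(\Gamma^N_{\boldsymbol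 u})$, $g\in H^{-1}$, $p_D\in H^{1/2}(\Gamma^D_p)$, $p_N\in H^{-1/2}(\Gamma^N_p)$ in the continuous case, suitably adapted in the discontinuous case): - $F_\gamma(\boldsymbol\chi_h)=\langle\boldsymbol f,\boldsymbol\chi_h\rangle-\langle\boldsymbol t_N,\boldsymbol\chi_h\rangle_{\Gamma^N_{\boldsymbol u}}+a_\gamma(\boldsymbol u_D,\boldsymbol\chi_h)$, - continuous choice: $G_\gamma(\psi_h)=\langle g,\psi_h\rangle-\alpha\langle\boldsymbol v_D\cdot\boldsymbol n,\psi_h\rangle_{\Gamma^D_{\boldsymbol u}}-\langle p_N,\psi_h\rangle_{\Gamma^N_p}+b_\gamma(p_D,\psi_h)$, - discontinuous choice: $G_\gamma(\psi_h)=\langle g,\psi_h\rangle-\sum_{F\in\mathcal F_h^{D,\boldsymbol u}}\alpha\langle\boldsymbol v_D\cdot\boldsymbol n,\psi_h\rangle_F-\sum_{F\in\mathcal F_h^{D,p}}\langle p_D,\{\!\{\boldsymbol K\nabla\psi_h\}\!\}\cdot\boldsymbol n\rangle_F+\sum_{F\in\mathcal F_h^{D,p}}\frac{\gamma}{h_F}\langle p_D,[\![\psi_h]\!]\rangle_F-\sum_{F\in\mathcal F_h^{N,p}}\langle p_N,[\![\psi_h]\!]\rangle_F$. *)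

theory Defs
  imports "HOL-Analysis.Analysis" "HOL-Computational_Algebra.Polynomial"
begin

section \<open>Hausdorff measure\<close>

definition hausdorff_pre :: "nat \<Rightarrow> real \<Rightarrow> 'a::metric_space set \<Rightarrow> ennreal" where
  "hausdorff_pre m \<delta> A =
     (INF C \<in> {C :: nat \<Rightarrow> 'a set. A \<subseteq> (\<Union>i. C i) \<and> (\<forall>i. bounded (C i) \<and> diameter (C i) \<le> \<delta>)}.
        \<Sum>i. ennreal (unit_ball_vol (real m) * (diameter (C i) / 2) ^ m))"

definition hausdorff_outer :: "nat \<Rightarrow> 'a::metric_space set \<Rightarrow> ennreal" where
  "hausdorff_outer m A = (SUP \<delta> \<in> {0<..}. hausdorff_pre m \<delta> A)"

text \<open>Only used for dimension \<open>m \<ge> 1\<close>, where the empty members of a cover do not contribute.\<close>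

definition hausdorff :: "nat \<Rightarrow> 'a::metric_space measure" where
  "hausdorff m = measure_of UNIV (sets borel) (hausdorff_outer m)"

text \<open>The outer measure is a metric outer measure, hence countably additive on the Borel sets, so that
  \<open>measure_of\<close> does not degenerate to the zero measure; see \<open>emeasure_hausdorff\<close> below.\<close>

lemma hausdorff_pre_empty: "m \<ge> 1 \<Longrightarrow> \<delta> > 0 \<Longrightarrow> hausdorff_pre m \<delta> {} = 0"
proof -
  assume "m \<ge> 1" "\<delta> > 0"
  then have "hausdorff_pre m \<delta> ({} :: 'a set) \<le> (\<Sum>i::nat. ennreal (unit_ball_vol (real m) * (diameter ({} :: 'a set) / 2) ^ m))"
    unfolding hausdorff_pre_def by (intro INF_lower2[of "\<lambda>_. {}"]) auto
  also have "\<dots> = 0" using \<open>m \<ge> 1\<close> by (simp add: power_0_left)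
  finally show ?thesis by simp
qed

lemma hausdorff_pre_mono: "A \<subseteq> B \<Longrightarrow> \<delta>' \<le> \<delta> \<Longrightarrow> hausdorff_pre m \<delta> A \<le> hausdorff_pre m \<delta>' B"
  unfolding hausdorff_pre_def by (rule INF_superset_mono) (auto intro: order_trans)

lemma hausdorff_pre_subadd:
  "hausdorff_pre m \<delta> (\<Union>n::nat. A n) \<le> (\<Sum>n. hausdorff_pre m \<delta> (A n))"
proof (rule ennreal_le_epsilon)
  let ?g = "\<lambda>C. ennreal (unit_ball_vol (real m) * (diameter C / 2) ^ m)"
  fix e :: real assume "0 < e" "(\<Sum>n. hausdorff_pre m \<delta> (A n)) < top"
  then have that: "\<And>n. hausdorff_pre m \<delta> (A n) < hausdorff_pre m \<delta> (A n) + e * (1/2)^Suc n"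
    by (auto simp add: less_top dest!: ennreal_suminf_lessD)
  have "\<exists>C. A n \<subseteq> (\<Union>i. C i) \<and> (\<forall>i. bounded (C i) \<and> diameter (C i) \<le> \<delta>) \<and>
      (\<Sum>i::nat. ?g (C i)) \<le> hausdorff_pre m \<delta> (A n) + e * (1/2)^Suc n" for n
  proof -
    let ?P = "\<lambda>C. A n \<subseteq> (\<Union>i. C i) \<and> (\<forall>i. bounded (C i) \<and> diameter (C i) \<le> \<delta>)"
    have "(INF C \<in> {C. ?P C}. \<Sum>i::nat. ?g (C i)) < hausdorff_pre m \<delta> (A n) + e * (1/2)^Suc n"
      using that[of n] unfolding hausdorff_pre_def[of m \<delta> "A n", symmetric] .
    then obtain C where "C \<in> {C. ?P C}" "(\<Sum>i::nat. ?g (C i)) < hausdorff_pre m \<delta> (A n) + e * (1/2)^Suc n"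
      unfolding INF_less_iff by blast
    then show ?thesis by (intro exI[of _ C]) (simp add: less_imp_le)
  qed
  then obtain B where B: "\<And>n. A n \<subseteq> (\<Union>i. B n i)" "\<And>n i. bounded (B n i)" "\<And>n i. diameter (B n i) \<le> \<delta>"
      "\<And>n. (\<Sum>i::nat. ?g (B n i)) \<le> hausdorff_pre m \<delta> (A n) + e * (1/2)^Suc n"
    by metis
  define C where "C = case_prod B o prod_decode"
  have A_C: "(\<Union>i. A i) \<subseteq> (\<Union>i. C i)"
    using B(1) by (auto simp add: C_def subset_eq) (metis prod.case prod_encode_inverse)
  have "hausdorff_pre m \<delta> (\<Union>i. A i) \<le> (\<Sum>i. ?g (C i))"
    unfolding hausdorff_pre_def using A_C B(2,3)
    by (intro INF_lower) (auto simp: C_def split_def)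
  also have "\<dots> = (\<Sum>n. \<Sum>i. ?g (B n i))"
    using suminf_ennreal_2dimen[of "\<lambda>n. \<Sum>i. ?g (B n i)" "\<lambda>(n,i). ?g (B n i)"]
    by (simp add: C_def comp_def split_def)
  also have "\<dots> \<le> (\<Sum>n. hausdorff_pre m \<delta> (A n) + e * (1/2) ^ Suc n)"
    by (intro suminf_le allI B(4)) auto
  also have "... = (\<Sum>n. hausdorff_pre m \<delta> (A n)) + (\<Sum>n. ennreal e * ennreal ((1/2) ^ Suc n))"
    using \<open>0 < e\<close> by (subst suminf_add[symmetric])
                     (auto simp del: ennreal_suminf_cmult simp add: ennreal_mult[symmetric])
  also have "\<dots> = (\<Sum>n. hausdorff_pre m \<delta> (A n)) + e"
    unfolding ennreal_suminf_cmult
    by (subst suminf_ennreal_eq[OF zero_le_power power_half_series]) auto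
  finally show "hausdorff_pre m \<delta> (\<Union>i. A i) \<le> (\<Sum>n. hausdorff_pre m \<delta> (A n)) + e" .
qed

lemma hausdorff_outer_empty: "m \<ge> 1 \<Longrightarrow> hausdorff_outer m {} = 0"
  by (simp add: hausdorff_outer_def hausdorff_pre_empty)

lemma hausdorff_outer_mono: "A \<subseteq> B \<Longrightarrow> hausdorff_outer m A \<le> hausdorff_outer m B"
  unfolding hausdorff_outer_def by (intro SUP_mono) (auto intro: hausdorff_pre_mono)

lemma hausdorff_outer_subadd: "hausdorff_outer m (\<Union>i::nat. A i) \<le> (\<Sum>n. hausdorff_outer m (A n))"
  unfolding hausdorff_outer_def[of m "\<Union>i. A i"]
proof (rule SUP_least)
  fix \<delta> :: real assume "\<delta> \<in> {0<..}"
  have "hausdorff_pre m \<delta> (\<Union>i. A i) \<le> (\<Sum>n. hausdorff_pre m \<delta> (A n))"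
    by (rule hausdorff_pre_subadd)
  also have "\<dots> \<le> (\<Sum>n. hausdorff_outer m (A n))"
    unfolding hausdorff_outer_def using \<open>\<delta> \<in> {0<..}\<close>
    by (intro suminf_le SUP_upper) auto
  finally show "hausdorff_pre m \<delta> (\<Union>i. A i) \<le> (\<Sum>n. hausdorff_outer m (A n))" .
qed

lemma outer_measure_space_hausdorff:
  assumes "m \<ge> 1"
  shows "outer_measure_space (Pow UNIV) (hausdorff_outer m)"
  unfolding outer_measure_space_def
proof (intro conjI)
  show "positive (Pow UNIV) (hausdorff_outer m)"
    unfolding positive_def by (rule hausdorff_outer_empty[OF assms])
  show "increasing (Pow UNIV) (hausdorff_outer m)"
    unfolding increasing_def by (intro ballI impI hausdorff_outer_mono)
  show "countably_subadditive (Pow UNIV) (hausdorff_outer m)"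
    unfolding countably_subadditive_def by (intro allI impI hausdorff_outer_subadd)
qed

lemma hausdorff_outer_Un:
  assumes "m \<ge> 1"
  shows "hausdorff_outer m (A \<union> B) \<le> hausdorff_outer m A + hausdorff_outer m B"
proof -
  have "hausdorff_outer m (\<Union>i. binaryset A B i) \<le> (\<Sum>n. hausdorff_outer m (binaryset A B n))"
    by (rule hausdorff_outer_subadd)
  also have "\<dots> = hausdorff_outer m A + hausdorff_outer m B"
    by (rule suminf_binaryset_eq) (rule hausdorff_outer_empty[OF assms])
  finally show ?thesis unfolding UN_binaryset_eq .
qed

lemma hausdorff_pre_separated:
  assumes m: "m \<ge> 1" and d: "\<delta> < d" and sep: "\<And>x y. x \<in> A \<Longrightarrow> y \<in> B \<Longrightarrow> dist x y \<ge> d" and "\<delta> > 0"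
  shows "hausdorff_pre m \<delta> A + hausdorff_pre m \<delta> B \<le> hausdorff_pre m \<delta> (A \<union> B)"
  unfolding hausdorff_pre_def[of m \<delta> "A \<union> B"]
proof (rule INF_greatest)
  let ?g = "\<lambda>C. ennreal (unit_ball_vol (real m) * (diameter C / 2) ^ m)"
  fix C :: "nat \<Rightarrow> 'a set"
  assume "C \<in> {C. A \<union> B \<subseteq> \<Union> (range C) \<and> (\<forall>i. bounded (C i) \<and> diameter (C i) \<le> \<delta>)}"
  then have C: "A \<union> B \<subseteq> \<Union> (range C)" "\<And>i. bounded (C i)" "\<And>i. diameter (C i) \<le> \<delta>" by auto
  define D where "D i = (if C i \<inter> A \<noteq> {} then C i else {})" for i
  define E where "E i = (if C i \<inter> A \<noteq> {} then {} else C i)" for i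
  have AD: "A \<subseteq> \<Union>(range D)" 
  proof
    fix x assume x: "x \<in> A"
    then obtain i where "x \<in> C i" using C(1) by auto
    then have "x \<in> D i" using x by (auto simp: D_def)
    then show "x \<in> \<Union>(range D)" by blast
  qed
  have BE: "B \<subseteq> \<Union>(range E)"
  proof
    fix y assume y: "y \<in> B"
    then obtain i where i: "y \<in> C i" using C(1) by auto
    have "C i \<inter> A = {}"
    proof (rule ccontr)
      assume "C i \<inter> A \<noteq> {}"
      then obtain x where x: "x \<in> C i" "x \<in> A" by auto
      have "dist x y \<le> diameter (C i)" using diameter_bounded_bound[OF C(2) x(1) i] .
      with C(3)[of i] d sep[OF x(2) y] show False by linarith
    qed
    with i show "y \<in> \<Union>(range E)" by (auto simp: E_def)
  qed
  have "hausdorff_pre m \<delta> A \<le> (\<Sum>i. ?g (D i))"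
    unfolding hausdorff_pre_def using AD C(2,3) \<open>\<delta> > 0\<close> by (intro INF_lower) (auto simp: D_def)
  moreover have "hausdorff_pre m \<delta> B \<le> (\<Sum>i. ?g (E i))"
    unfolding hausdorff_pre_def using BE C(2,3) \<open>\<delta> > 0\<close> by (intro INF_lower) (auto simp: E_def)
  ultimately have "hausdorff_pre m \<delta> A + hausdorff_pre m \<delta> B \<le> (\<Sum>i. ?g (D i)) + (\<Sum>i. ?g (E i))"
    by (rule add_mono)
  also have "\<dots> = (\<Sum>i. ?g (D i) + ?g (E i))"
    by (rule suminf_add) auto
  also have "\<dots> = (\<Sum>i. ?g (C i))"
    using m by (intro suminf_cong) (auto simp: D_def E_def)
  finally show "hausdorff_pre m \<delta> A + hausdorff_pre m \<delta> B \<le> (\<Sum>i. ?g (C i))" .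
qed

lemma hausdorff_outer_separated:
  assumes m: "m \<ge> 1" and d: "d > 0" and sep: "\<And>x y. x \<in> A \<Longrightarrow> y \<in> B \<Longrightarrow> dist x y \<ge> d"
  shows "hausdorff_outer m A + hausdorff_outer m B \<le> hausdorff_outer m (A \<union> B)"
proof -
  have *: "hausdorff_pre m \<delta>1 A + hausdorff_pre m \<delta>2 B \<le> hausdorff_outer m (A \<union> B)"
    if "\<delta>1 > 0" "\<delta>2 > 0" for \<delta>1 \<delta>2
  proof -
    define \<delta> where "\<delta> = min (d/2) (min \<delta>1 \<delta>2)"
    have \<delta>: "\<delta> > 0" "\<delta> < d" "\<delta> \<le> \<delta>1" "\<delta> \<le> \<delta>2" using that d by (auto simp: \<delta>_def)
    have "hausdorff_pre m \<delta>1 A + hausdorff_pre m \<delta>2 B \<le> hausdorff_pre m \<delta> A + hausdorff_pre m \<delta> B"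
      using \<delta> by (intro add_mono hausdorff_pre_mono) auto
    also have "\<dots> \<le> hausdorff_pre m \<delta> (A \<union> B)"
      using \<delta> by (intro hausdorff_pre_separated[OF m _ sep]) auto
    also have "\<dots> \<le> hausdorff_outer m (A \<union> B)"
      unfolding hausdorff_outer_def using \<delta> by (intro SUP_upper) auto
    finally show ?thesis .
  qed
  have ne: "{0<..} \<noteq> ({}::real set)" by (auto intro: exI[of _ 1])
  have "hausdorff_outer m A + hausdorff_pre m \<delta>2 B \<le> hausdorff_outer m (A \<union> B)" if "\<delta>2 > 0" for \<delta>2
    unfolding hausdorff_outer_def[of m A] ennreal_SUP_add_left[OF ne, symmetric]
    using * that by (intro SUP_least) auto
  then have "hausdorff_outer m A + (SUP \<delta>\<in>{0<..}. hausdorff_pre m \<delta> B) \<le> hausdorff_outer m (A \<union> B)"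
    by (subst ennreal_SUP_add_right[OF ne]) (auto intro!: SUP_least)
  then show ?thesis by (simp only: hausdorff_outer_def[of m B, symmetric])
qed

lemma hausdorff_closed_measurable:
  fixes F :: "'a::metric_space set"
  assumes m: "m \<ge> 1" and F: "closed F"
  shows "hausdorff_outer m (A \<inter> F) + hausdorff_outer m (A - F) \<le> hausdorff_outer m A"
proof (cases "F = {} \<or> hausdorff_outer m A = \<infinity>")
  case True
  then show ?thesis
    using hausdorff_outer_empty[OF m, where 'a='a] by auto
next
  case False
  let ?\<mu> = "hausdorff_outer m :: 'a set \<Rightarrow> ennreal"
  have ne: "F \<noteq> {}" and fin: "?\<mu> A < \<infinity>" using False by (auto simp: less_top)
  define B where "B n = {x \<in> A - F. infdist x F \<ge> 1 / (real n + 1)}" for n :: nat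
  define D where "D n = B (Suc n) - B n" for n
  have incB: "B n \<subseteq> B (Suc n)" for n
  proof -
    have "1 / (real (Suc n) + 1) \<le> 1 / (real n + 1)" by (simp add: field_simps)
    then show ?thesis unfolding B_def by (auto intro: order_trans)
  qed
  have sepD: "dist x y \<ge> 1 / (real n + 1) - 1 / (real n + 2)" if "x \<in> B n" "y \<in> D (Suc n)" for x y n
  proof -
    have "infdist x F \<ge> 1 / (real n + 1)" using that by (auto simp: B_def)
    moreover have "infdist y F < 1 / (real n + 2)" using that by (auto simp: D_def B_def algebra_simps)
    moreover have "infdist x F \<le> infdist y F + dist x y" by (rule infdist_triangle)
    ultimately show ?thesis by linarith
  qed
  have step: "?\<mu> (B n) + ?\<mu> (D (Suc n)) \<le> ?\<mu> (B (Suc (Suc n)))" for n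
  proof -
    have "?\<mu> (B n) + ?\<mu> (D (Suc n)) \<le> ?\<mu> (B n \<union> D (Suc n))"
      by (rule hausdorff_outer_separated[OF m _ sepD]) (simp_all add: frac_less2)
    also have "\<dots> \<le> ?\<mu> (B (Suc (Suc n)))"
      using incB[of n] incB[of "Suc n"] by (intro hausdorff_outer_mono) (auto simp: D_def)
    finally show ?thesis .
  qed
  have sums: "(\<Sum>i<Suc n. ?\<mu> (D i)) \<le> ?\<mu> (B n) + ?\<mu> (B (Suc n))" for n
  proof (induction n)
    case 0
    have "?\<mu> (D 0) \<le> ?\<mu> (B (Suc 0))" by (rule hausdorff_outer_mono) (auto simp: D_def)
    then show ?case by (simp add: add_increasing)
  next
    case (Suc n)
    have "(\<Sum>i<Suc (Suc n). ?\<mu> (D i)) \<le> (?\<mu> (B n) + ?\<mu> (B (Suc n))) + ?\<mu> (D (Suc n))"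
      using Suc.IH by (simp add: add_right_mono)
    also have "\<dots> = ?\<mu> (B (Suc n)) + (?\<mu> (B n) + ?\<mu> (D (Suc n)))" by (simp add: ac_simps)
    also have "\<dots> \<le> ?\<mu> (B (Suc n)) + ?\<mu> (B (Suc (Suc n)))" by (rule add_left_mono[OF step])
    finally show ?case .
  qed
  have BA: "?\<mu> (B n) \<le> ?\<mu> A" for n by (rule hausdorff_outer_mono) (auto simp: B_def)
  define S where "S = (\<Sum>i. ?\<mu> (D i))"
  have "S \<le> ?\<mu> A + ?\<mu> A"
    unfolding S_def suminf_eq_SUP
  proof (rule SUP_least)
    fix n
    have "(\<Sum>i<n. ?\<mu> (D i)) \<le> (\<Sum>i<Suc n. ?\<mu> (D i))" by (rule sum_mono2) auto
    also have "\<dots> \<le> ?\<mu> A + ?\<mu> A" using sums[of n] add_mono[OF BA[of n] BA[of "Suc n"]] by (rule order_trans)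
    finally show "(\<Sum>i<n. ?\<mu> (D i)) \<le> ?\<mu> A + ?\<mu> A" .
  qed
  with fin have Sfin: "S < \<infinity>" by (metis ennreal_add_less_top infinity_ennreal_def order_le_less_trans)
  have cover: "A - F \<subseteq> B n \<union> (\<Union>i. D (i + n))" for n
  proof
    fix x assume x: "x \<in> A - F"
    then have "infdist x F > 0" using infdist_pos_not_in_closed[OF F ne] by auto
    then obtain k where "inverse (real (Suc k)) < infdist x F" using reals_Archimedean by blast
    then have ex: "x \<in> B k" using x by (auto simp: B_def field_simps)
    show "x \<in> B n \<union> (\<Union>i. D (i + n))"
    proof (cases "x \<in> B n")
      case False
      define l where "l = (LEAST l. x \<in> B l)"
      have l: "x \<in> B l" unfolding l_def using ex by (rule LeastI)
      have "mono B" using incB by (rule incseq_SucI)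
      then have "n < l" using False l by (metis linorder_not_le monoD subsetD)
      then obtain l' where l': "l = Suc l'" "n \<le> l'" by (cases l) auto
      have "x \<notin> B l'" using l'(1) not_less_Least[of l' "\<lambda>l. x \<in> B l"] unfolding l_def[symmetric] by auto
      with l l' have "x \<in> D l'" by (auto simp: D_def)
      then have "x \<in> D ((l' - n) + n)" using l' by simp
      then show ?thesis by blast
    qed auto
  qed
  have main: "(?\<mu> (A \<inter> F) + ?\<mu> (A - F)) + (\<Sum>i<n. ?\<mu> (D i)) \<le> ?\<mu> A + S" for n
  proof -
    have "?\<mu> (A - F) \<le> ?\<mu> (B n \<union> (\<Union>i. D (i + n)))" by (rule hausdorff_outer_mono[OF cover])
    also have "\<dots> \<le> ?\<mu> (B n) + ?\<mu> (\<Union>i. D (i + n))" by (rule hausdorff_outer_Un[OF m])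
    also have "\<dots> \<le> ?\<mu> (B n) + (\<Sum>i. ?\<mu> (D (i + n)))"
      by (intro add_left_mono hausdorff_outer_subadd)
    finally have 1: "?\<mu> (A - F) \<le> ?\<mu> (B n) + (\<Sum>i. ?\<mu> (D (i + n)))" .
    have 2: "S = (\<Sum>i. ?\<mu> (D (i + n))) + (\<Sum>i<n. ?\<mu> (D i))"
      unfolding S_def by (rule suminf_offset) auto
    have 3: "?\<mu> (A \<inter> F) + ?\<mu> (B n) \<le> ?\<mu> A"
    proof -
      have "dist x y \<ge> 1 / (real n + 1)" if "x \<in> A \<inter> F" "y \<in> B n" for x y
      proof -
        have "infdist y F \<le> dist y x" using that by (intro infdist_le) auto
        with that show ?thesis by (auto simp: B_def dist_commute)
      qed
      then have "?\<mu> (A \<inter> F) + ?\<mu> (B n) \<le> ?\<mu> ((A \<inter> F) \<union> B n)"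
        by (rule hausdorff_outer_separated[OF m, rotated]) auto
      also have "\<dots> \<le> ?\<mu> A" by (rule hausdorff_outer_mono) (auto simp: B_def)
      finally show ?thesis .
    qed
    have "(?\<mu> (A \<inter> F) + ?\<mu> (A - F)) + (\<Sum>i<n. ?\<mu> (D i))
        \<le> (?\<mu> (A \<inter> F) + (?\<mu> (B n) + (\<Sum>i. ?\<mu> (D (i + n))))) + (\<Sum>i<n. ?\<mu> (D i))"
      by (intro add_right_mono add_left_mono 1)
    also have "\<dots> = (?\<mu> (A \<inter> F) + ?\<mu> (B n)) + S" unfolding 2 by (simp add: ac_simps)
    also have "\<dots> \<le> ?\<mu> A + S" by (rule add_right_mono[OF 3])
    finally show ?thesis .
  qed
  have "(?\<mu> (A \<inter> F) + ?\<mu> (A - F)) + S = (SUP n. (?\<mu> (A \<inter> F) + ?\<mu> (A - F)) + (\<Sum>i<n. ?\<mu> (D i)))"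
    unfolding S_def suminf_eq_SUP by (rule ennreal_SUP_add_right) auto
  also have "\<dots> \<le> ?\<mu> A + S" by (intro SUP_least main)
  finally show ?thesis using Sfin by (auto simp: ennreal_add_left_cancel_le add.commute[of _ S])
qed

lemma measure_space_hausdorff:
  assumes m: "m \<ge> 1"
  shows "measure_space UNIV (sets borel) (hausdorff_outer m :: 'a::metric_space set \<Rightarrow> ennreal)"
proof -
  let ?\<mu> = "hausdorff_outer m :: 'a set \<Rightarrow> ennreal"
  let ?L = "lambda_system UNIV (Pow UNIV) ?\<mu>"
  interpret sigma_algebra "UNIV :: 'a set" "Pow UNIV" by (rule sigma_algebra_Pow)
  have ms: "measure_space UNIV ?L ?\<mu>"
    by (rule caratheodory_lemma[OF outer_measure_space_hausdorff[OF m]])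
  have "F \<in> ?L" if "closed F" for F
  proof -
    have "?\<mu> (F \<inter> A) + ?\<mu> ((UNIV - F) \<inter> A) = ?\<mu> A" for A
    proof (rule antisym)
      show "?\<mu> (F \<inter> A) + ?\<mu> ((UNIV - F) \<inter> A) \<le> ?\<mu> A"
        using hausdorff_closed_measurable[OF m that, of A] by (simp add: Int_commute Diff_eq)
      have "?\<mu> A \<le> ?\<mu> ((F \<inter> A) \<union> ((UNIV - F) \<inter> A))" by (rule hausdorff_outer_mono) auto
      also have "\<dots> \<le> ?\<mu> (F \<inter> A) + ?\<mu> ((UNIV - F) \<inter> A)" by (rule hausdorff_outer_Un[OF m])
      finally show "?\<mu> A \<le> ?\<mu> (F \<inter> A) + ?\<mu> ((UNIV - F) \<inter> A)" .
    qed
    then show ?thesis by (auto simp: lambda_system_def)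
  qed
  moreover have "sigma_algebra UNIV ?L" using ms by (simp add: measure_space_def)
  ultimately have "sigma_sets UNIV {F :: 'a set. closed F} \<subseteq> ?L"
    by (intro sigma_algebra.sigma_sets_subset) auto
  then have "sets (borel :: 'a measure) \<subseteq> ?L"
    by (simp add: borel_eq_closed)
  then show ?thesis
    using measure_down[OF ms, of "sets borel"] sets.sigma_algebra_axioms[of "borel :: 'a measure"] by simp
qed

lemma emeasure_hausdorff:
  assumes "m \<ge> 1" "A \<in> sets borel"
  shows "emeasure (hausdorff m) A = hausdorff_outer m A"
  using measure_space_hausdorff[OF assms(1), where 'a='a] assms(2)
  unfolding hausdorff_def measure_space_def
  by (intro emeasure_measure_of_sigma) (auto simp: sets.sigma_algebra_axioms)


definition surf :: "(real^'n) measure" where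
  "surf = hausdorff (CARD('n) - 1)"


section \<open>Function spaces and domains\<close>

definition L2_on :: "'a::topological_space measure \<Rightarrow> 'a set \<Rightarrow> ('a \<Rightarrow> 'b::{real_normed_vector,second_countable_topology}) \<Rightarrow> bool" where
  "L2_on M A f \<longleftrightarrow> set_borel_measurable M A f \<and> (\<integral>\<^sup>+x\<in>A. ennreal ((norm (f x))\<^sup>2) \<partial>M) < \<infinity>"

definition ip :: "(real^'n) set \<Rightarrow> (real^'n \<Rightarrow> 'b::euclidean_space) \<Rightarrow> (real^'n \<Rightarrow> 'b) \<Rightarrow> real" where
  "ip A f g = (LINT x:A|lebesgue. f x \<bullet> g x)"

definition grad :: "(real^'n \<Rightarrow> real) \<Rightarrow> real^'n \<Rightarrow> real^'n" where
  "grad q x = (\<chi> i. frechet_derivative q (at x) (axis i 1))"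

definition test_function :: "(real^'n) set \<Rightarrow> (real^'n \<Rightarrow> real) \<Rightarrow> bool" where
  "test_function \<Omega> \<phi> \<longleftrightarrow> (\<forall>x. \<phi> differentiable (at x)) \<and> continuous_on UNIV (grad \<phi>) \<and>
     (\<exists>S. compact S \<and> S \<subseteq> \<Omega> \<and> (\<forall>x. x \<notin> S \<longrightarrow> \<phi> x = 0))"

text \<open>Weak derivatives are tested against continuously differentiable functions of compact support;
  this gives the same space as smooth test functions.\<close>

definition H1 :: "(real^'n) set \<Rightarrow> (real^'n \<Rightarrow> real) \<Rightarrow> bool" where
  "H1 \<Omega> v \<longleftrightarrow> L2_on lebesgue \<Omega> v \<and>
     (\<exists>g :: real^'n \<Rightarrow> real^'n. L2_on lebesgue \<Omega> g \<and>
        (\<forall>\<phi>. test_function \<Omega> \<phi> \<longrightarrow>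
           (\<forall>i. (LINT x:\<Omega>|lebesgue. v x * grad \<phi> x $ i) = - (LINT x:\<Omega>|lebesgue. g x $ i * \<phi> x))))"

definition lipschitz_domain :: "(real^'n) set \<Rightarrow> bool" where
  "lipschitz_domain \<Omega> \<longleftrightarrow> open \<Omega> \<and> connected \<Omega> \<and> \<Omega> \<noteq> {} \<and>
     (\<forall>x\<in>frontier \<Omega>. \<exists>r>0. \<exists>e L. \<exists>g :: real^'n \<Rightarrow> real. norm e = 1 \<and> L-lipschitz_on UNIV g \<and>
        \<Omega> \<inter> ball x r = {y \<in> ball x r. y \<bullet> e > g (y - (y \<bullet> e) *\<^sub>R e)})"

text \<open>Classical normal: close to \<open>x\<close>, the set \<open>S\<close> agrees with the half space with outer normal
  \<open>\<nu>\<close> up to arbitrarily thin cones around its boundary. At boundary points without a normal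
  (a null set for a Lipschitz domain) the value is 0.\<close>

definition is_outer_normal :: "(real^'n) set \<Rightarrow> real^'n \<Rightarrow> real^'n \<Rightarrow> bool" where
  "is_outer_normal S x \<nu> \<longleftrightarrow> norm \<nu> = 1 \<and>
     (\<forall>\<epsilon>>0. \<exists>\<delta>>0. \<forall>y \<in> ball x \<delta> - {x}.
        ((y - x) \<bullet> \<nu> \<ge> \<epsilon> * norm (y - x) \<longrightarrow> y \<notin> S) \<and>
        ((y - x) \<bullet> \<nu> \<le> - \<epsilon> * norm (y - x) \<longrightarrow> y \<in> S))"

definition outer_normal :: "(real^'n) set \<Rightarrow> real^'n \<Rightarrow> real^'n" where
  "outer_normal S x = (if \<exists>\<nu>. is_outer_normal S x \<nu> then (THE \<nu>. is_outer_normal S x \<nu>) else 0)"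


section \<open>Domain and coefficients\<close>

record ('n::finite) setting =
  dom :: "(real^'n) set"
  GDu :: "(real^'n) set"
  GNu :: "(real^'n) set"
  GDp :: "(real^'n) set"
  GNp :: "(real^'n) set"
  rho :: real
  alpha :: real
  c0 :: real
  Ct :: "'n \<Rightarrow> 'n \<Rightarrow> 'n \<Rightarrow> 'n \<Rightarrow> real"
  Kp :: "real^'n^'n"

definition valid_setting :: "('n::finite) setting \<Rightarrow> bool" where
  "valid_setting S \<longleftrightarrow>
     lipschitz_domain (dom S) \<and> bounded (dom S) \<and>
     frontier (dom S) = GDu S \<union> GNu S \<and> frontier (dom S) = GDp S \<union> GNp S \<and>
     closed (GDu S) \<and> closed (GDp S) \<and>
     emeasure surf (GDu S) \<noteq> 0 \<and> emeasure surf (GDp S) \<noteq> 0 \<and>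
     rho S > 0 \<and> alpha S > 0 \<and> c0 S > 0 \<and>
     (\<forall>i j k l. Ct S i j k l = Ct S k l i j \<and> Ct S i j k l = Ct S j i k l \<and> Ct S i j k l = Ct S i j l k) \<and>
     (\<exists>k0>0. \<forall>\<xi> :: real^'n^'n. transpose \<xi> = \<xi> \<longrightarrow>
        (\<Sum>i\<in>UNIV. \<Sum>j\<in>UNIV. \<Sum>k\<in>UNIV. \<Sum>l\<in>UNIV. \<xi>$i$j * Ct S i j k l * \<xi>$k$l)
          \<ge> k0 * (\<Sum>j\<in>UNIV. \<Sum>k\<in>UNIV. \<bar>\<xi>$j$k\<bar>\<^sup>2)) \<and>
     transpose (Kp S) = Kp S \<and>
     (\<exists>k1>0. \<forall>\<xi> :: real^'n.
        (\<Sum>i\<in>UNIV. \<Sum>j\<in>UNIV. \<xi>$i * Kp S $i$j * \<xi>$j) \<ge> k1 * (\<Sum>i\<in>UNIV. \<bar>\<xi>$i\<bar>\<^sup>2))"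

definition strain :: "(real^'n \<Rightarrow> real^'n) \<Rightarrow> real^'n \<Rightarrow> real^'n^'n" where
  "strain v x = (1/2) *\<^sub>R (jacobian v (at x) + transpose (jacobian v (at x)))"

definition stress :: "('n::finite) setting \<Rightarrow> (real^'n \<Rightarrow> real^'n) \<Rightarrow> real^'n \<Rightarrow> real^'n^'n" where
  "stress S v x = (\<chi> i j. \<Sum>k\<in>UNIV. \<Sum>l\<in>UNIV. Ct S i j k l * strain v x $k$l)"

definition div_of :: "(real^'n \<Rightarrow> real^'n) \<Rightarrow> real^'n \<Rightarrow> real" where
  "div_of v x = trace (jacobian v (at x))"

definition flux :: "('n::finite) setting \<Rightarrow> (real^'n \<Rightarrow> real) \<Rightarrow> real^'n \<Rightarrow> real^'n" where
  "flux S q x = Kp S *v grad q x"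

definition nrm :: "('n::finite) setting \<Rightarrow> real^'n \<Rightarrow> real^'n" where
  "nrm S = outer_normal (dom S)"


section \<open>Spatial mesh\<close>

definition polyQ :: "nat \<Rightarrow> (real^'n \<Rightarrow> real) set" where
  "polyQ r = {q. \<exists>c. \<forall>x. q x = (\<Sum>m | \<forall>i::'n. m i \<le> r. c m * (\<Prod>i\<in>UNIV. x $ i ^ m i))}"

definition polyP :: "nat \<Rightarrow> (real^'n \<Rightarrow> real) set" where
  "polyP r = {q. \<exists>c. \<forall>x. q x = (\<Sum>m | (\<Sum>i\<in>(UNIV::'n set). m i) \<le> r. c m * (\<Prod>i\<in>UNIV. x $ i ^ m i))}"

text \<open>\<open>cmap\<close> maps the closed reference cube onto the closure of a cell. A face is represented by the
  relatively open point set that it occupies. For an interior face, \<open>fplus\<close> and \<open>fminus\<close> are the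
  cells \<open>K\<^sup>+\<close> and \<open>K\<^sup>-\<close>, chosen in an arbitrary order; for a boundary face, \<open>fplus\<close> is the
  adjacent cell.\<close>

record ('n::finite) mesh =
  cells :: "(real^'n) set set"
  cmap :: "(real^'n) set \<Rightarrow> real^'n \<Rightarrow> real^'n"
  fplus :: "(real^'n) set \<Rightarrow> (real^'n) set"
  fminus :: "(real^'n) set \<Rightarrow> (real^'n) set"

definition ref_facets :: "(real^'n) set set" where
  "ref_facets = {{x. x$i = s \<and> (\<forall>j. j \<noteq> i \<longrightarrow> 0 < x$j \<and> x$j < 1)} | i s. s \<in> {0, 1}}"

definition ref_subfaces :: "(real^'n) set set" where
  "ref_subfaces = {{x \<in> cbox 0 1. \<forall>i\<in>I. x$i = s i} | I s. I \<noteq> {} \<and> range s \<subseteq> {0, 1}}"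

definition facets :: "('n::finite) mesh \<Rightarrow> (real^'n) set \<Rightarrow> (real^'n) set set" where
  "facets Th K = (\<lambda>E. cmap Th K ` E) ` ref_facets"

definition faces :: "('n::finite) mesh \<Rightarrow> (real^'n) set set" where
  "faces Th = (\<Union>K\<in>cells Th. facets Th K)"

definition bfaces :: "('n::finite) setting \<Rightarrow> 'n mesh \<Rightarrow> (real^'n) set set" where
  "bfaces S Th = {F \<in> faces Th. F \<subseteq> frontier (dom S)}"

definition faces_on :: "('n::finite) setting \<Rightarrow> 'n mesh \<Rightarrow> (real^'n) set \<Rightarrow> (real^'n) set set" where
  "faces_on S Th \<Gamma> = {F \<in> bfaces S Th. F \<subseteq> \<Gamma>}"

definition valid_mesh :: "('n::finite) setting \<Rightarrow> 'n mesh \<Rightarrow> bool" where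
  "valid_mesh S Th \<longleftrightarrow>
     finite (cells Th) \<and>
     (\<forall>K\<in>cells Th. K \<subseteq> dom S \<and> (\<forall>j. (\<lambda>x. cmap Th K x $ j) \<in> polyQ 1) \<and>
        inj_on (cmap Th K) (cbox 0 1) \<and>
        (\<forall>x\<in>cbox 0 1. det (jacobian (cmap Th K) (at x)) \<noteq> 0) \<and>
        cmap Th K ` box 0 1 = K) \<and>
     disjoint (cells Th) \<and>
     (\<Union>K\<in>cells Th. closure K) = closure (dom S) \<and>
     (\<forall>K\<in>cells Th. \<forall>K'\<in>cells Th. K \<noteq> K' \<longrightarrow> closure K \<inter> closure K' = {} \<or>
        (\<exists>E\<in>ref_subfaces. \<exists>E'\<in>ref_subfaces.
           closure K \<inter> closure K' = cmap Th K ` E \<and> closure K \<inter> closure K' = cmap Th K' ` E')) \<and>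
     (\<forall>F\<in>bfaces S Th. (F \<subseteq> GDu S \<or> F \<subseteq> GNu S) \<and> (F \<subseteq> GDp S \<or> F \<subseteq> GNp S)) \<and>
     (\<forall>F\<in>bfaces S Th. fplus Th F \<in> cells Th \<and> F \<in> facets Th (fplus Th F)) \<and>
     (\<forall>F\<in>faces Th - bfaces S Th. fplus Th F \<in> cells Th \<and> fminus Th F \<in> cells Th \<and>
        fplus Th F \<noteq> fminus Th F \<and> F \<in> facets Th (fplus Th F) \<and> F \<in> facets Th (fminus Th F))"

text \<open>Every cell contains a ball whose radius is comparable to the largest cell diameter of the mesh.\<close>

definition quasi_uniform_family :: "('n::finite) setting \<Rightarrow> 'n mesh set \<Rightarrow> bool" where
  "quasi_uniform_family S M \<longleftrightarrow> (\<forall>Th\<in>M. valid_mesh S Th) \<and>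
     (\<exists>\<sigma>>0. \<forall>Th\<in>M. \<forall>K\<in>cells Th. \<forall>K'\<in>cells Th. \<exists>x. ball x (\<sigma> * diameter K') \<subseteq> K)"


section \<open>Finite element spaces\<close>

text \<open>Members of the spaces are normalised to vanish outside the set on which they are determined
  (the closed domain for continuous functions, the open cells for discontinuous ones), so that
  equality of the functions is equality in the space.\<close>

definition Vh :: "('n::finite) setting \<Rightarrow> 'n mesh \<Rightarrow> nat \<Rightarrow> (real^'n \<Rightarrow> real^'n) set" where
  "Vh S Th r = {v. (\<forall>j. H1 (dom S) (\<lambda>x. v x $ j)) \<and> continuous_on (closure (dom S)) v \<and>
     (\<forall>x. x \<notin> closure (dom S) \<longrightarrow> v x = 0) \<and>
     (\<forall>K\<in>cells Th. \<forall>j. \<exists>q\<in>polyQ r. \<forall>y\<in>box 0 1. v (cmap Th K y) $ j = q y)}"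

datatype pressure_choice = Continuous | Discontinuous

fun Qh :: "('n::finite) setting \<Rightarrow> 'n mesh \<Rightarrow> nat \<Rightarrow> pressure_choice \<Rightarrow> (real^'n \<Rightarrow> real) set" where
  "Qh S Th r Continuous = {q. continuous_on (closure (dom S)) q \<and>
     (\<forall>x. x \<notin> closure (dom S) \<longrightarrow> q x = 0) \<and>
     (\<forall>K\<in>cells Th. \<exists>p\<in>polyQ (r - 1). \<forall>y\<in>box 0 1. q (cmap Th K y) = p y)}"
| "Qh S Th r Discontinuous = {q. L2_on lebesgue (dom S) q \<and>
     (\<forall>x. x \<notin> \<Union>(cells Th) \<longrightarrow> q x = 0) \<and>
     (\<forall>K\<in>cells Th. \<exists>p\<in>polyP (r - 1). \<forall>y\<in>box 0 1. q (cmap Th K y) = p y)}"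


section \<open>Traces and face integrals\<close>

text \<open>The trace from a cell is the limit from inside the (open) cell.\<close>

definition tr :: "(real^'n) set \<Rightarrow> (real^'n \<Rightarrow> 'b::t2_space) \<Rightarrow> real^'n \<Rightarrow> 'b" where
  "tr K w x = Lim (at x within K) w"

definition btr :: "('n::finite) mesh \<Rightarrow> (real^'n) set \<Rightarrow> (real^'n \<Rightarrow> 'b::t2_space) \<Rightarrow> real^'n \<Rightarrow> 'b" where
  "btr Th F w = tr (fplus Th F) w"

definition avg :: "('n::finite) setting \<Rightarrow> 'n mesh \<Rightarrow> (real^'n) set \<Rightarrow> (real^'n \<Rightarrow> 'b::real_normed_vector) \<Rightarrow> real^'n \<Rightarrow> 'b" where
  "avg S Th F w x = (if F \<in> bfaces S Th then tr (fplus Th F) w x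
     else (1/2) *\<^sub>R (tr (fplus Th F) w x + tr (fminus Th F) w x))"

definition jump :: "('n::finite) setting \<Rightarrow> 'n mesh \<Rightarrow> (real^'n) set \<Rightarrow> (real^'n \<Rightarrow> 'b::real_normed_vector) \<Rightarrow> real^'n \<Rightarrow> 'b" where
  "jump S Th F w x = (if F \<in> bfaces S Th then tr (fplus Th F) w x
     else tr (fplus Th F) w x - tr (fminus Th F) w x)"

definition fnormal :: "('n::finite) setting \<Rightarrow> 'n mesh \<Rightarrow> (real^'n) set \<Rightarrow> real^'n \<Rightarrow> real^'n" where
  "fnormal S Th F x = (if F \<in> bfaces S Th then nrm S x else outer_normal (fplus Th F) x)"

definition hF :: "('n::finite) setting \<Rightarrow> 'n mesh \<Rightarrow> (real^'n) set \<Rightarrow> real" where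
  "hF S Th F = (if F \<in> bfaces S Th then measure lebesgue (fplus Th F)
     else (measure lebesgue (fplus Th F) + measure lebesgue (fminus Th F)) / 2)"

text \<open>Integral over a boundary part of a facewise given integrand.\<close>

definition bint :: "('n::finite) setting \<Rightarrow> 'n mesh \<Rightarrow> (real^'n) set \<Rightarrow> ((real^'n) set \<Rightarrow> real^'n \<Rightarrow> real) \<Rightarrow> real" where
  "bint S Th \<Gamma> f = (\<Sum>F\<in>bfaces S Th. LINT x:(F \<inter> \<Gamma>)|surf. f F x)"


section \<open>Bilinear forms\<close>

definition a_form :: "('n::finite) setting \<Rightarrow> 'n mesh \<Rightarrow> real \<Rightarrow> (real^'n \<Rightarrow> real^'n) \<Rightarrow> (real^'n \<Rightarrow> real^'n) \<Rightarrow> real" where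
  "a_form S Th \<gamma>a w \<eta> =
     - bint S Th (GDu S) (\<lambda>F x. w x \<bullet> (btr Th F (stress S \<eta>) x *v nrm S x))
     + bint S Th (GDu S) (\<lambda>F x. \<gamma>a / hF S Th F * (w x \<bullet> \<eta> x))"

definition b_form :: "('n::finite) setting \<Rightarrow> 'n mesh \<Rightarrow> real \<Rightarrow> (real^'n \<Rightarrow> real) \<Rightarrow> (real^'n \<Rightarrow> real) \<Rightarrow> real" where
  "b_form S Th \<gamma>b q \<psi> =
     - bint S Th (GDp S) (\<lambda>F x. q x * (btr Th F (flux S \<psi>) x \<bullet> nrm S x))
     + bint S Th (GDp S) (\<lambda>F x. \<gamma>b / hF S Th F * (q x * \<psi> x))"

definition A_form :: "('n::finite) setting \<Rightarrow> 'n mesh \<Rightarrow> real \<Rightarrow> (real^'n \<Rightarrow> real^'n) \<Rightarrow> (real^'n \<Rightarrow> real^'n) \<Rightarrow> real" where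
  "A_form S Th \<gamma>a w \<eta> = ip (dom S) (stress S w) (strain \<eta>)
     - bint S Th (GDu S) (\<lambda>F x. (btr Th F (stress S w) x *v nrm S x) \<bullet> \<eta> x)
     + a_form S Th \<gamma>a w \<eta>"

definition C_form :: "('n::finite) setting \<Rightarrow> 'n mesh \<Rightarrow> (real^'n \<Rightarrow> real^'n) \<Rightarrow> (real^'n \<Rightarrow> real) \<Rightarrow> real" where
  "C_form S Th \<eta> q = - alpha S * ip (dom S) (div_of \<eta>) q
     + alpha S * bint S Th (GDu S) (\<lambda>F x. (\<eta> x \<bullet> nrm S x) * btr Th F q x)"

fun B_form :: "('n::finite) setting \<Rightarrow> 'n mesh \<Rightarrow> pressure_choice \<Rightarrow> real \<Rightarrow> (real^'n \<Rightarrow> real) \<Rightarrow> (real^'n \<Rightarrow> real) \<Rightarrow> real" where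
  "B_form S Th Continuous \<gamma> q \<psi> = ip (dom S) (flux S q) (grad \<psi>)
     - bint S Th (GDp S) (\<lambda>F x. (btr Th F (flux S q) x \<bullet> nrm S x) * \<psi> x)
     + b_form S Th \<gamma> q \<psi>"
| "B_form S Th Discontinuous \<gamma> q \<psi> =
     (\<Sum>K\<in>cells Th. ip K (flux S q) (grad \<psi>))
     - (\<Sum>F\<in>faces Th.
          (LINT x:F|surf. (avg S Th F (flux S q) x \<bullet> fnormal S Th F x) * jump S Th F \<psi> x)
        + (LINT x:F|surf. jump S Th F q x * (avg S Th F (flux S \<psi>) x \<bullet> fnormal S Th F x)))
     + (\<Sum>F\<in>faces Th. \<gamma> / hF S Th F * (LINT x:F|surf. jump S Th F q x * jump S Th F \<psi> x))"


section \<open>Data\<close>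

text \<open>The data that may be distributions are represented by their duality pairings:
  \<open>df D t \<eta>\<close> and \<open>dg D t \<psi>\<close> for the volume data, and for the Neumann data the pairing over a boundary part,
  evaluated at the trace of the test function extended by 0; \<open>dpN\<close> additionally takes the boundary part,
  which is the whole Neumann boundary or a single face. The Dirichlet data are functions on
  the Dirichlet boundary, square integrable at the times at which they are used.\<close>

record ('n::finite) data =
  df :: "real \<Rightarrow> (real^'n \<Rightarrow> real^'n) \<Rightarrow> real"
  duD :: "real \<Rightarrow> real^'n \<Rightarrow> real^'n"
  dvD :: "real \<Rightarrow> real^'n \<Rightarrow> real^'n"
  dtN :: "real \<Rightarrow> (real^'n \<Rightarrow> real^'n) \<Rightarrow> real"
  dg :: "real \<Rightarrow> (real^'n \<Rightarrow> real) \<Rightarrow> real"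
  dpD :: "real \<Rightarrow> real^'n \<Rightarrow> real"
  dpN :: "real \<Rightarrow> (real^'n) set \<Rightarrow> (real^'n \<Rightarrow> real) \<Rightarrow> real"

definition restr :: "(real^'n) set \<Rightarrow> (real^'n \<Rightarrow> 'b::zero) \<Rightarrow> real^'n \<Rightarrow> 'b" where
  "restr A w = (\<lambda>x. if x \<in> A then w x else 0)"

definition linear_functional_on :: "('a \<Rightarrow> 'b::real_vector) set \<Rightarrow> (('a \<Rightarrow> 'b) \<Rightarrow> real) \<Rightarrow> bool" where
  "linear_functional_on V L \<longleftrightarrow>
     (\<forall>v\<in>V. \<forall>w\<in>V. \<forall>a b. L (\<lambda>x. a *\<^sub>R v x + b *\<^sub>R w x) = a * L v + b * L w)"

definition F_fun :: "('n::finite) setting \<Rightarrow> 'n mesh \<Rightarrow> real \<Rightarrow> 'n data \<Rightarrow> real \<Rightarrow> (real^'n \<Rightarrow> real^'n) \<Rightarrow> real" where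
  "F_fun S Th \<gamma>a D t \<eta> =
     df D t \<eta> - dtN D t (restr (GNu S) \<eta>) + a_form S Th \<gamma>a (duD D t) \<eta>"

fun G_fun :: "('n::finite) setting \<Rightarrow> 'n mesh \<Rightarrow> pressure_choice \<Rightarrow> real \<Rightarrow> 'n data \<Rightarrow> real \<Rightarrow> (real^'n \<Rightarrow> real) \<Rightarrow> real" where
  "G_fun S Th Continuous \<gamma> D t \<psi> = dg D t \<psi>
     - alpha S * bint S Th (GDu S) (\<lambda>F x. (dvD D t x \<bullet> nrm S x) * \<psi> x)
     - dpN D t (GNp S) (restr (GNp S) \<psi>)
     + b_form S Th \<gamma> (dpD D t) \<psi>"
| "G_fun S Th Discontinuous \<gamma> D t \<psi> = dg D t \<psi>
     - (\<Sum>F\<in>faces_on S Th (GDu S). alpha S * (LINT x:F|surf. (dvD D t x \<bullet> nrm S x) * btr Th F \<psi> x))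
     - (\<Sum>F\<in>faces_on S Th (GDp S). LINT x:F|surf. dpD D t x * (avg S Th F (flux S \<psi>) x \<bullet> nrm S x))
     + (\<Sum>F\<in>faces_on S Th (GDp S). \<gamma> / hF S Th F * (LINT x:F|surf. dpD D t x * jump S Th F \<psi> x))
     - (\<Sum>F\<in>faces_on S Th (GNp S). dpN D t F (restr F (jump S Th F \<psi>)))"

fun pN_ok :: "('n::finite) setting \<Rightarrow> 'n mesh \<Rightarrow> nat \<Rightarrow> pressure_choice \<Rightarrow> 'n data \<Rightarrow> real \<Rightarrow> bool" where
  "pN_ok S Th r Continuous D t =
     linear_functional_on (Qh S Th r Continuous) (\<lambda>\<psi>. dpN D t (GNp S) (restr (GNp S) \<psi>))"
| "pN_ok S Th r Discontinuous D t = (\<forall>F\<in>faces_on S Th (GNp S).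
     linear_functional_on (Qh S Th r Discontinuous) (\<lambda>\<psi>. dpN D t F (restr F (jump S Th F \<psi>))))"

text \<open>\<open>J\<close> is the set of quadrature nodes in use. The time derivative of the displacement Dirichlet data
  is the derivative of the map from \<open>{0..T}\<close> to \<open>L\<^sup>2\<close> of the Dirichlet boundary.\<close>

definition valid_data :: "('n::finite) setting \<Rightarrow> 'n mesh \<Rightarrow> nat \<Rightarrow> pressure_choice \<Rightarrow> real \<Rightarrow> real set \<Rightarrow> 'n data \<Rightarrow> bool" where
  "valid_data S Th r ch T J D \<longleftrightarrow>
     (\<forall>t\<in>{0..T}. L2_on surf (GDu S) (duD D t)) \<and>
     (\<forall>t\<in>J. L2_on surf (GDu S) (dvD D t) \<and>
        ((\<lambda>s. \<integral>\<^sup>+x\<in>GDu S. ennreal ((norm ((1 / (s - t)) *\<^sub>R (duD D s x - duD D t x) - dvD D t x))\<^sup>2) \<partial>surf)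
           \<longlongrightarrow> 0) (at t within {0..T}) \<and>
        L2_on surf (GDp S) (dpD D t) \<and>
        linear_functional_on (Vh S Th r) (df D t) \<and>
        linear_functional_on (Vh S Th r) (\<lambda>\<eta>. dtN D t (restr (GNu S) \<eta>)) \<and>
        linear_functional_on (Qh S Th r ch) (dg D t) \<and>
        pN_ok S Th r ch D t)"


section \<open>Time discretisation\<close>

definition time_mesh :: "nat \<Rightarrow> real \<Rightarrow> (nat \<Rightarrow> real) \<Rightarrow> bool" where
  "time_mesh N T t \<longleftrightarrow> t 0 = 0 \<and> t N = T \<and> (\<forall>n<N. t n < t (Suc n))"

text \<open>Nodes and weights of the right-sided \<open>k+1\<close> point Gauss--Radau rule on \<open>[-1,1]\<close>; they are uniquely
  determined by these conditions.\<close>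

definition gauss_radau :: "nat \<Rightarrow> (nat \<Rightarrow> real) \<Rightarrow> (nat \<Rightarrow> real) \<Rightarrow> bool" where
  "gauss_radau k xh wh \<longleftrightarrow> strict_mono_on {1..k+1} xh \<and> xh ` {1..k+1} \<subseteq> {-1..1} \<and> xh (k+1) = 1 \<and>
     (\<forall>p :: real poly. degree p \<le> 2 * k \<longrightarrow>
        (\<Sum>\<mu>=1..k+1. wh \<mu> * poly p (xh \<mu>)) = integral {-1..1} (poly p))"

definition qnode :: "(nat \<Rightarrow> real) \<Rightarrow> real \<Rightarrow> real \<Rightarrow> nat \<Rightarrow> real" where
  "qnode xh a b \<mu> = (a + b) / 2 + (b - a) / 2 * xh \<mu>"

definition Qn :: "nat \<Rightarrow> (nat \<Rightarrow> real) \<Rightarrow> (nat \<Rightarrow> real) \<Rightarrow> real \<Rightarrow> real \<Rightarrow> (real \<Rightarrow> real) \<Rightarrow> real" where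
  "Qn k xh wh a b w = (b - a) / 2 * (\<Sum>\<mu>=1..k+1. wh \<mu> * w (qnode xh a b \<mu>))"

text \<open>A polynomial on a time interval is identified with its unique polynomial extension to the real line.\<close>

definition Pk :: "nat \<Rightarrow> ('a \<Rightarrow> 'b::real_vector) set \<Rightarrow> (real \<Rightarrow> 'a \<Rightarrow> 'b) set" where
  "Pk k B = {w. \<exists>c. (\<forall>j\<le>k. c j \<in> B) \<and> (\<forall>t x. w t x = (\<Sum>j\<le>k. t ^ j *\<^sub>R c j x))}"

definition dt :: "(real \<Rightarrow> 'a \<Rightarrow> 'b::real_normed_vector) \<Rightarrow> real \<Rightarrow> 'a \<Rightarrow> 'b" where
  "dt w t x = vector_derivative (\<lambda>s. w s x) (at t)"

definition right_lim :: "(real \<Rightarrow> 'a \<Rightarrow> 'b::t2_space) \<Rightarrow> real \<Rightarrow> 'a \<Rightarrow> 'b" where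
  "right_lim w t x = Lim (at_right t) (\<lambda>s. w s x)"


section \<open>The fully discrete equations on one time interval\<close>

text \<open>In the following, \<open>q\<close> abbreviates the quadrature formula on the interval with left endpoint \<open>a\<close>.\<close>

definition eq_displacement ::
  "('n::finite) setting \<Rightarrow> ((real \<Rightarrow> real) \<Rightarrow> real) \<Rightarrow> real \<Rightarrow> (real^'n \<Rightarrow> real^'n) \<Rightarrow>
   (real \<Rightarrow> real^'n \<Rightarrow> real^'n) \<Rightarrow> (real \<Rightarrow> real^'n \<Rightarrow> real^'n) \<Rightarrow> (real \<Rightarrow> real^'n \<Rightarrow> real^'n) \<Rightarrow> bool" where
  "eq_displacement S q a u0 u v \<phi> \<longleftrightarrow>
     q (\<lambda>t. ip (dom S) (dt u t) (\<phi> t) - ip (dom S) (v t) (\<phi> t))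
       + ip (dom S) (right_lim u a) (right_lim \<phi> a)
     = ip (dom S) u0 (right_lim \<phi> a)"

definition eq_velocity ::
  "('n::finite) setting \<Rightarrow> 'n mesh \<Rightarrow> real \<Rightarrow> 'n data \<Rightarrow> ((real \<Rightarrow> real) \<Rightarrow> real) \<Rightarrow> real \<Rightarrow> (real^'n \<Rightarrow> real^'n) \<Rightarrow>
   (real \<Rightarrow> real^'n \<Rightarrow> real^'n) \<Rightarrow> (real \<Rightarrow> real^'n \<Rightarrow> real^'n) \<Rightarrow> (real \<Rightarrow> real^'n \<Rightarrow> real) \<Rightarrow>
   (real \<Rightarrow> real^'n \<Rightarrow> real^'n) \<Rightarrow> bool" where
  "eq_velocity S Th \<gamma>a D q a v0 u v p \<eta> \<longleftrightarrow>
     q (\<lambda>t. ip (dom S) (\<lambda>x. rho S *\<^sub>R dt v t x) (\<eta> t) + A_form S Th \<gamma>a (u t) (\<eta> t) + C_form S Th (\<eta> t) (p t))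
       + ip (dom S) (\<lambda>x. rho S *\<^sub>R right_lim v a x) (right_lim \<eta> a)
     = q (\<lambda>t. F_fun S Th \<gamma>a D t (\<eta> t))
       + ip (dom S) (\<lambda>x. rho S *\<^sub>R v0 x) (right_lim \<eta> a)"

definition eq_pressure ::
  "('n::finite) setting \<Rightarrow> 'n mesh \<Rightarrow> pressure_choice \<Rightarrow> real \<Rightarrow> 'n data \<Rightarrow> ((real \<Rightarrow> real) \<Rightarrow> real) \<Rightarrow> real \<Rightarrow>
   (real^'n \<Rightarrow> real^'n) \<Rightarrow> (real^'n \<Rightarrow> real) \<Rightarrow>
   (real \<Rightarrow> real^'n \<Rightarrow> real^'n) \<Rightarrow> (real \<Rightarrow> real^'n \<Rightarrow> real) \<Rightarrow> (real \<Rightarrow> real^'n \<Rightarrow> real) \<Rightarrow> bool" where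
  "eq_pressure S Th ch \<gamma> D q a u0 p0 u p \<psi> \<longleftrightarrow>
     q (\<lambda>t. ip (dom S) (\<lambda>x. c0 S * dt p t x) (\<psi> t) - C_form S Th (dt u t) (\<psi> t) + B_form S Th ch \<gamma> (p t) (\<psi> t))
       + ip (dom S) (\<lambda>x. c0 S * right_lim p a x + alpha S * div_of (right_lim u a) x) (right_lim \<psi> a)
       - alpha S * bint S Th (GDu S) (\<lambda>F x. (right_lim u a x \<bullet> nrm S x) * btr Th F (right_lim \<psi> a) x)
     = q (\<lambda>t. G_fun S Th ch \<gamma> D t (\<psi> t))
       + ip (dom S) (\<lambda>x. c0 S * p0 x + alpha S * div_of u0 x) (right_lim \<psi> a)
       - alpha S * bint S Th (GDu S) (\<lambda>F x. (duD D a x \<bullet> nrm S x) * btr Th F (right_lim \<psi> a) x)"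

end

theory Submission
  imports Defs "HOL-Library.Function_Algebras"
begin

text \<open>The scheme is a square linear system on a finite dimensional space, so it suffices that the homogeneous
  system has only the trivial solution. Its first equation says that the velocity is the discontinuous
  Galerkin time derivative of the displacement; since this is an identity in time, the velocity may be replaced
  accordingly inside \<open>C\<close> in the third equation and inside \<open>A\<^sub>\<gamma>\<close> after testing the second equation with \<open>v\<close>.
  Testing the third equation with \<open>p\<close>, the coupling terms cancel, and as the Radau rule integrates the
  remaining derivatives exactly, \<open>v\<close> and \<open>p\<close> vanish at the left end point and the displacement there is in the
  kernel of \<open>A\<^sub>\<gamma>\<close>. The equations then hold as identities between polynomials in time, and the continuous energy
  \<open>\<rho>|v|\<^sup>2 + A\<^sub>\<gamma>(u, u) + c\<^sub>0|p|\<^sup>2\<close>, which starts at 0 and does not increase, is 0. Only the nonnegativity of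
  \<open>A\<^sub>\<gamma>\<close> and \<open>B\<^sub>\<gamma>\<close> is needed. It follows for large parameters on a fixed mesh from a finite dimensional argument:
  a quadratic form that vanishes on the kernel of a semidefinite form is dominated by a multiple of it.\<close>

text \<open>Nonnegativity alone leaves a gap: the first energy identity controls \<open>v\<close>
  and \<open>p\<close> only at the end points of the interval, and the quadrature sees only the
  \<open>k + 1\<close> nodes. Once the terms at the left end point have dropped out, however,
  testing with Lagrange polynomials annihilates each residual at all nodes; a residual has degree at
  most \<open>k\<close>, so it vanishes for all times, and monotonicity of the energy does the rest.
  The displacement has to wait until the end, since a semidefinite \<open>A\<close> cannot detect
  it: with \<open>v = 0\<close> known, the first equation alone shows that it starts at 0 and stays
  there. The analytic obstacle is that Bochner integrals are total, with value 0 for nonintegrable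
  functions. No form may be called bilinear before its integrands are known to be integrable, which
  explains the work on finite surface measure of faces, Borel measurable normals, and gradients that
  extend continuously to the closure of a cell. The last property also makes the traces in the face
  terms genuine limits that depend linearly on the function.\<close>

section \<open>Functions as a real vector space\<close>

text \<open>Both the spatial spaces and the spaces of time dependent functions are sets of
  functions. With the pointwise structure, \<open>subspace\<close>, \<open>span\<close> and
  \<open>independent\<close> apply to all of them, and to tables of coordinates as well.\<close>

instantiation "fun" :: (type, real_vector) real_vector
begin

definition scaleR_fun :: "real \<Rightarrow> ('a \<Rightarrow> 'b) \<Rightarrow> 'a \<Rightarrow> 'b" where
  "scaleR_fun a f = (\<lambda>x. a *\<^sub>R f x)"

instance
  by standard (simp_all add: scaleR_fun_def fun_eq_iff scaleR_add_right scaleR_add_left)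

end

lemma scaleR_fun_apply [simp]: "(a *\<^sub>R f) x = a *\<^sub>R f x"
  by (simp add: scaleR_fun_def)

lemma sum_fun_apply [simp]: "(\<Sum>i\<in>I. f i) x = (\<Sum>i\<in>I. f i x)"
  for f :: "'i \<Rightarrow> 'a \<Rightarrow> 'b::comm_monoid_add"
  by (induction I rule: infinite_finite_induct) auto


section \<open>Linear and bilinear functionals on subspaces\<close>

text \<open>Linearity is relative to \<open>V\<close>, because the forms of the scheme are integrals
  and need not be additive on functions that are not integrable.\<close>

definition lin_on :: "'a::real_vector set \<Rightarrow> ('a \<Rightarrow> real) \<Rightarrow> bool" where
  "lin_on V L \<longleftrightarrow> (\<forall>v\<in>V. \<forall>w\<in>V. \<forall>a b. L (a *\<^sub>R v + b *\<^sub>R w) = a * L v + b * L w)"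

definition bilin_on :: "'a::real_vector set \<Rightarrow> 'b::real_vector set \<Rightarrow> ('a \<Rightarrow> 'b \<Rightarrow> real) \<Rightarrow> bool" where
  "bilin_on V W b \<longleftrightarrow> (\<forall>w\<in>W. lin_on V (\<lambda>v. b v w)) \<and> (\<forall>v\<in>V. lin_on W (b v))"

definition psd_on :: "'a::real_vector set \<Rightarrow> ('a \<Rightarrow> 'a \<Rightarrow> real) \<Rightarrow> bool" where
  "psd_on V b \<longleftrightarrow> bilin_on V V b \<and> (\<forall>v\<in>V. \<forall>w\<in>V. b v w = b w v) \<and> (\<forall>v\<in>V. b v v \<ge> 0)"

definition findim :: "'a::real_vector set \<Rightarrow> bool" where
  "findim V \<longleftrightarrow> subspace V \<and> (\<exists>B. finite B \<and> V \<subseteq> span B)"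

lemma lin_onI:
  "(\<And>v w a b. v \<in> V \<Longrightarrow> w \<in> V \<Longrightarrow> L (a *\<^sub>R v + b *\<^sub>R w) = a * L v + b * L w) \<Longrightarrow> lin_on V L"
  by (simp add: lin_on_def)

lemma lin_onD:
  "lin_on V L \<Longrightarrow> v \<in> V \<Longrightarrow> w \<in> V \<Longrightarrow> L (a *\<^sub>R v + b *\<^sub>R w) = a * L v + b * L w"
  by (simp add: lin_on_def)

lemma lin_on_eq_linear_functional_on: "lin_on V L \<longleftrightarrow> linear_functional_on V L"
  by (simp add: lin_on_def linear_functional_on_def plus_fun_def scaleR_fun_def)

lemma lin_on_add: "lin_on V L \<Longrightarrow> lin_on V M \<Longrightarrow> lin_on V (\<lambda>v. L v + M v)"
  by (auto simp: lin_on_def algebra_simps)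

lemma lin_on_diff: "lin_on V L \<Longrightarrow> lin_on V M \<Longrightarrow> lin_on V (\<lambda>v. L v - M v)"
  by (auto simp: lin_on_def algebra_simps)

lemma lin_on_cmult: "lin_on V L \<Longrightarrow> lin_on V (\<lambda>v. c * L v)"
  by (auto simp: lin_on_def algebra_simps)

lemma lin_on_minus: "lin_on V L \<Longrightarrow> lin_on V (\<lambda>v. - L v)"
  by (auto simp: lin_on_def algebra_simps)

lemma lin_on_zero: "lin_on V (\<lambda>v. 0)"
  by (auto simp: lin_on_def)

lemma lin_on_sum: "(\<And>i. i \<in> I \<Longrightarrow> lin_on V (L i)) \<Longrightarrow> lin_on V (\<lambda>v. \<Sum>i\<in>I. L i v)"
  by (induction I rule: infinite_finite_induct) (auto intro: lin_on_zero lin_on_add)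

lemmas lin_on_intros = lin_on_add lin_on_diff lin_on_cmult lin_on_minus lin_on_zero lin_on_sum

lemma lin_on_0: assumes "lin_on V L" "v \<in> V" "subspace V" shows "L 0 = 0"
  using lin_onD[OF assms(1,2,2), of 0 0] by simp

lemma lin_on_lincomb:
  assumes "lin_on V L" "subspace V" "\<And>i. i \<in> I \<Longrightarrow> f i \<in> V"
  shows "L (\<Sum>i\<in>I. r i *\<^sub>R f i) = (\<Sum>i\<in>I. r i * L (f i))"
  using assms(3)
proof (induction I rule: infinite_finite_induct)
  case (insert i I)
  have "(\<Sum>i\<in>I. r i *\<^sub>R f i) \<in> V"
    using insert.prems assms(2) by (intro subspace_sum subspace_scale) auto
  then have "L (r i *\<^sub>R f i + 1 *\<^sub>R (\<Sum>i\<in>I. r i *\<^sub>R f i)) = r i * L (f i) + 1 * L (\<Sum>i\<in>I. r i *\<^sub>R f i)"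
    using insert.prems assms(1) by (intro lin_onD) auto
  then show ?case using insert by simp
qed (use lin_on_0[OF assms(1) subspace_0[OF assms(2)] assms(2)] in auto)

lemma bilin_onD1: "bilin_on V W b \<Longrightarrow> w \<in> W \<Longrightarrow> lin_on V (\<lambda>v. b v w)"
  and bilin_onD2: "bilin_on V W b \<Longrightarrow> v \<in> V \<Longrightarrow> lin_on W (b v)"
  by (auto simp: bilin_on_def)

lemma bilin_on_intros:
  "bilin_on V W b \<Longrightarrow> bilin_on V W c \<Longrightarrow> bilin_on V W (\<lambda>v w. b v w + c v w)"
  "bilin_on V W b \<Longrightarrow> bilin_on V W c \<Longrightarrow> bilin_on V W (\<lambda>v w. b v w - c v w)"
  "bilin_on V W b \<Longrightarrow> bilin_on V W (\<lambda>v w. r * b v w)"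
  "bilin_on V W b \<Longrightarrow> bilin_on V W (\<lambda>v w. - b v w)"
  "(\<And>i. i \<in> I \<Longrightarrow> bilin_on V W (g i)) \<Longrightarrow> bilin_on V W (\<lambda>v w. \<Sum>i\<in>I. g i v w)"
  by (auto simp: bilin_on_def intro!: lin_on_intros)

lemma findim_basis:
  assumes "findim V"
  obtains B where "finite B" "independent B" "B \<subseteq> V" "span B = V"
proof -
  from assms obtain F where F: "finite F" "V \<subseteq> span F" and V: "subspace V" by (auto simp: findim_def)
  obtain B where B: "B \<subseteq> V" "independent B" "V \<subseteq> span B"
    using maximal_independent_subset[of V] by blast
  have "finite B" using independent_span_bound[OF F(1) B(2)] B(1) F(2) by blast
  moreover have "span B = V" using B V by (metis span_subspace)
  ultimately show ?thesis using that B by blast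
qed

text \<open>A basis of \<open>V\<close> is carried to an independent subset of the span of
  \<open>F\<close>, which bounds its size. Later \<open>T\<close> records the values of a finite
  element function and \<open>F\<close> consists of monomials on single cells.\<close>

lemma findim_linear_inj:
  assumes V: "subspace V" and T: "linear T" and inj: "inj_on T V"
    and F: "finite F" "T ` V \<subseteq> span F"
  shows "findim V"
proof -
  obtain B where B: "B \<subseteq> V" "independent B" "V \<subseteq> span B"
    using maximal_independent_subset[of V] by blast
  have sB: "span B = V" using B V by (metis span_subspace)
  have "independent (T ` B)"
    using linear_independent_injective_image[OF T B(2)] inj sB by simp
  moreover have "T ` B \<subseteq> span F" using B(1) F(2) by blast
  ultimately have "finite (T ` B)" using independent_span_bound[OF F(1)] by blast
  then have "finite B" using inj_on_subset[OF inj B(1)] finite_imageD by blast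
  then show ?thesis using V B(3) by (auto simp: findim_def)
qed

lemma findim_Times:
  assumes "findim V" "findim W"
  shows "findim (V \<times> W)"
proof -
  obtain B C where "finite B" "V \<subseteq> span B" "finite C" "W \<subseteq> span C" "subspace V" "subspace W"
    using assms by (auto simp: findim_def)
  have *: "(v, w) \<in> span ((\<lambda>v. (v, 0)) ` B \<union> (\<lambda>w. (0, w)) ` C)" if "v \<in> span B" "w \<in> span C" for v w
  proof -
    have l1: "linear (\<lambda>v. (v, 0) :: 'a \<times> 'b)" and l2: "linear (\<lambda>w. (0, w) :: 'a \<times> 'b)"
      by (auto intro!: linearI)
    have "(v, 0) \<in> span ((\<lambda>v. (v, 0 :: 'b)) ` B)" "(0, w) \<in> span ((\<lambda>w. (0 :: 'a, w)) ` C)"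
      using that linear_span_image[OF l1, of B] linear_span_image[OF l2, of C] by auto
    then have "(v, 0) + (0, w) \<in> span ((\<lambda>v. (v, 0)) ` B \<union> (\<lambda>w. (0, w)) ` C)"
      by (intro span_add; metis (no_types, lifting) UnI1 UnI2 span_mono subsetD subsetI)
    then show ?thesis by simp
  qed
  have "subspace (V \<times> W)" using \<open>subspace V\<close> \<open>subspace W\<close> by (rule subspace_Times)
  moreover have "V \<times> W \<subseteq> span ((\<lambda>v. (v, 0)) ` B \<union> (\<lambda>w. (0, w)) ` C)"
    using * \<open>V \<subseteq> span B\<close> \<open>W \<subseteq> span C\<close> by blast
  ultimately show ?thesis using \<open>finite B\<close> \<open>finite C\<close> unfolding findim_def by (meson finite_UnI finite_imageI)
qed

text \<open>Injectivity gives surjectivity by counting dimensions. \<open>T\<close> sends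
  \<open>w\<close> to the table of the values \<open>b w z\<close> for \<open>z\<close> in a basis
  \<open>B\<close>; nondegeneracy keeps the images of the basis vectors independent, and a table has
  only \<open>card B\<close> entries.\<close>

lemma bilin_solve:
  assumes W: "findim W" and bil: "bilin_on W W b" and L: "lin_on W L"
    and nondeg: "\<And>w. w \<in> W \<Longrightarrow> (\<And>z. z \<in> W \<Longrightarrow> b w z = 0) \<Longrightarrow> w = 0"
  shows "\<exists>!w. w \<in> W \<and> (\<forall>z\<in>W. b w z = L z)"
proof -
  have sW: "subspace W" using W by (simp add: findim_def)
  obtain B where B: "finite B" "independent B" "B \<subseteq> W" "span B = W" using findim_basis[OF W] .
  define e :: "'a \<Rightarrow> 'a \<Rightarrow> real" where "e z = (\<lambda>y. if y = z then 1 else 0)" for z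
  define T :: "'a \<Rightarrow> 'a \<Rightarrow> real" where "T w = (\<lambda>z. if z \<in> B then b w z else 0)" for w
  have ext: "M z = M' z" if "lin_on W M" "lin_on W M'" "\<And>z. z \<in> B \<Longrightarrow> M z = M' z" "z \<in> W" for M M' z
  proof -
    obtain r where "z = (\<Sum>v\<in>B. r v *\<^sub>R v)" using \<open>z \<in> W\<close> B(1,4) by (auto simp: span_finite)
    then show ?thesis
      using B(3) that(3) lin_on_lincomb[OF that(1) sW, of B "\<lambda>v. v" r] lin_on_lincomb[OF that(2) sW, of B "\<lambda>v. v" r]
      by (auto simp: subset_iff)
  qed
  have T_sum: "T (\<Sum>v\<in>B. r v *\<^sub>R v) = (\<Sum>v\<in>B. r v *\<^sub>R T v)" for r
    using B(3) bil by (auto simp: T_def fun_eq_iff bilin_on_def subset_iff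
        intro!: lin_on_lincomb[OF _ sW, of "\<lambda>v. b v z" for z])
  have T0: "w = 0" if "w \<in> W" "T w = 0" for w
  proof (rule nondeg[OF that(1)])
    fix z assume "z \<in> W"
    have "b w z' = 0" if "z' \<in> B" for z' using \<open>T w = 0\<close> that by (auto simp: T_def fun_eq_iff split: if_splits)
    then show "b w z = 0"
      using ext[OF bilin_onD2[OF bil \<open>w \<in> W\<close>] lin_on_zero] \<open>z \<in> W\<close> by blast
  qed
  have Tr0: "r v = 0" if "(\<Sum>v\<in>B. r v *\<^sub>R T v) = 0" "v \<in> B" for r v
  proof -
    have "(\<Sum>v\<in>B. r v *\<^sub>R v) = 0"
      using that(1) B(3) sW by (intro T0 subspace_sum subspace_scale) (auto simp: T_sum)
    then show ?thesis using independentD[OF B(2,1) order_refl _ that(2)] by blast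
  qed
  have inj: "inj_on T B"
  proof (rule inj_onI, rule ccontr)
    fix v w assume vw: "v \<in> B" "w \<in> B" "T v = T w" "v \<noteq> w"
    have "(\<Sum>x\<in>B. ((if x = v then 1 else 0) - (if x = w then 1 else 0)) *\<^sub>R T x) = T v - T w"
      using vw B(1) by (simp add: scaleR_diff_left sum_subtractf if_distrib[of "\<lambda>c. c *\<^sub>R _"] cong: if_cong)
    from Tr0[of "\<lambda>x. (if x = v then 1 else 0) - (if x = w then 1 else 0)" v] this vw show False by auto
  qed
  have ind: "independent (T ` B)"
  proof (rule independent_if_scalars_zero)
    fix f x assume f: "(\<Sum>x\<in>T ` B. f x *\<^sub>R x) = 0" and x: "x \<in> T ` B"
    then obtain v where v: "v \<in> B" "x = T v" by auto
    have "(\<Sum>v\<in>B. f (T v) *\<^sub>R T v) = 0" using f by (simp add: sum.reindex[OF inj])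
    then show "f x = 0" using Tr0[of "\<lambda>v. f (T v)" v] v by simp
  qed (use B in auto)
  have span_e: "f \<in> span (e ` B)" if "\<And>z. z \<notin> B \<Longrightarrow> f z = 0" for f
  proof -
    have "f = (\<Sum>z\<in>B. f z *\<^sub>R e z)"
      using that B(1) by (auto simp: fun_eq_iff e_def if_distrib[of "\<lambda>c. _ * c"] cong: if_cong)
    also have "\<dots> \<in> span (e ` B)" by (intro span_sum span_scale span_base) auto
    finally show ?thesis .
  qed
  define l where "l = (\<lambda>z. if z \<in> B then L z else 0)"
  \<comment> \<open>Otherwise adjoining \<open>l\<close> would give \<open>card B + 1\<close>
    independent vectors in the span of the coordinate functions \<open>e z\<close>, of which there
    are at most \<open>card B\<close>.\<close>
  have "l \<in> span (T ` B)"
  proof (rule ccontr)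
    assume l: "l \<notin> span (T ` B)"
    then have "independent (insert l (T ` B))" using ind by (rule independent_insertI)
    moreover have "insert l (T ` B) \<subseteq> span (e ` B)" by (auto simp: l_def T_def intro!: span_e)
    ultimately have "card (insert l (T ` B)) \<le> card (e ` B)"
      using independent_span_bound[of "e ` B"] B(1) by auto
    also have "\<dots> \<le> card B" using B(1) by (rule card_image_le)
    finally show False using span_base[of l "T ` B"] l B(1) by (simp add: card_insert_if card_image[OF inj] split: if_splits)
  qed
  then obtain g where g: "l = (\<Sum>v\<in>T ` B. g v *\<^sub>R v)" using B(1) by (auto simp: span_finite)
  define w where "w = (\<Sum>v\<in>B. g (T v) *\<^sub>R v)"
  have wW: "w \<in> W" unfolding w_def B(4)[symmetric] by (intro span_sum span_scale span_base)
  have Tw: "T w = l" unfolding w_def T_sum g by (simp add: sum.reindex[OF inj])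
  have "b w z = L z" if "z \<in> B" for z
  proof -
    have "T w z = l z" unfolding Tw ..
    then show ?thesis using that by (simp add: T_def l_def)
  qed
  then have ex: "\<forall>z\<in>W. b w z = L z" using ext[OF bilin_onD2[OF bil wW] L] by blast
  show ?thesis
  proof (rule ex1I[of _ w])
    show "w \<in> W \<and> (\<forall>z\<in>W. b w z = L z)" using wW ex by blast
    fix w' assume w': "w' \<in> W \<and> (\<forall>z\<in>W. b w' z = L z)"
    have "w' - w = 0"
    proof (rule nondeg)
      show "w' - w \<in> W" using w' wW sW by (simp add: subspace_diff)
      fix z assume "z \<in> W"
      then show "b (w' - w) z = 0"
        using lin_onD[OF bilin_onD1[OF bil \<open>z \<in> W\<close>], of w' w 1 "-1"] w' wW ex by simp
    qed
    then show "w' = w" by simp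
  qed
qed

section \<open>Semidefinite forms\<close>

lemma psd_on_expand:
  assumes "psd_on V b" "v \<in> V" "w \<in> V" "subspace V"
  shows "b (r *\<^sub>R v + s *\<^sub>R w) (r *\<^sub>R v + s *\<^sub>R w) = r\<^sup>2 * b v v + 2 * r * s * b v w + s\<^sup>2 * b w w"
proof -
  have V: "r *\<^sub>R v + s *\<^sub>R w \<in> V" using assms by (simp add: subspace_add subspace_scale)
  have bil: "bilin_on V V b" and sym: "b w v = b v w" using assms by (auto simp: psd_on_def)
  show ?thesis
    using lin_onD[OF bilin_onD1[OF bil V] assms(2,3), of r s]
      lin_onD[OF bilin_onD2[OF bil assms(2)] assms(2,3), of r s]
      lin_onD[OF bilin_onD2[OF bil assms(3)] assms(2,3), of r s] sym
    by (simp add: algebra_simps power2_eq_square)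
qed

text \<open>If \<open>b v v = 0\<close>, the quadratic form at \<open>r *\<^sub>R v + w\<close> is
  affine in \<open>r\<close>, so a nonzero slope would make it negative; the \<open>r\<close> chosen
  below gives the value -1.\<close>

lemma psd_on_null:
  assumes "psd_on V b" "subspace V" "v \<in> V" "w \<in> V" "b v v = 0"
  shows "b v w = 0"
proof (rule ccontr)
  assume ne: "b v w \<noteq> 0"
  define r where "r = - (b w w + 1) / (2 * b v w)"
  have "0 \<le> b (r *\<^sub>R v + 1 *\<^sub>R w) (r *\<^sub>R v + 1 *\<^sub>R w)"
    using assms by (auto simp: psd_on_def subspace_add subspace_scale)
  also have "\<dots> = 2 * r * b v w + b w w"
    using psd_on_expand[OF assms(1,3,4), of r 1] assms(2,5) by simp
  also have "2 * r * b v w = - (b w w + 1)" using ne by (simp add: r_def)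
  finally show False by simp
qed

lemma psd_on_add_le:
  assumes "psd_on V b" "subspace V" "v \<in> V" "w \<in> V"
  shows "b (v + w) (v + w) \<le> 2 * b v v + 2 * b w w"
proof -
  have "0 \<le> b (1 *\<^sub>R v + (-1) *\<^sub>R w) (1 *\<^sub>R v + (-1) *\<^sub>R w)"
    using assms unfolding psd_on_def by (metis subspace_add subspace_scale)
  then show ?thesis
    using psd_on_expand[OF assms(1,3,4,2), of 1 "-1"] psd_on_expand[OF assms(1,3,4,2), of 1 1] by simp
qed

text \<open>Gram-Schmidt for a form that may be degenerate: the new vector \<open>f\<close> is
  replaced by its part \<open>e\<close> orthogonal to \<open>span F\<close>, and the projection onto
  \<open>span F\<close> is corrected in the direction \<open>e\<close>.\<close>

lemma psd_projection:
  assumes b: "psd_on V b" and V: "subspace V" and F: "finite F" "F \<subseteq> V"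
  shows "v \<in> V \<Longrightarrow> \<exists>w\<in>span F. \<forall>x\<in>span F. b (v - w) x = 0"
  using F
proof (induction F arbitrary: v rule: finite_induct)
  case empty
  have "b v 0 = 0" using b V empty.prems(1) by (intro lin_on_0[of V "b v"] bilin_onD2[of V V]) (auto simp: psd_on_def)
  then show ?case by simp
next
  case (insert f F)
  have bil: "bilin_on V V b" using b by (simp add: psd_on_def)
  have sF: "span F \<subseteq> V" using insert.prems V by (simp add: span_minimal)
  from insert obtain g where g: "g \<in> span F" "\<And>x. x \<in> span F \<Longrightarrow> b (f - g) x = 0" by (metis insert_subset)
  define e where "e = f - g"
  have eV: "e \<in> V" using g sF insert.prems V by (auto simp: e_def subspace_diff)
  have e_span: "e \<in> span (insert f F)"
    unfolding e_def using g(1) by (intro span_diff) (auto intro: span_base span_mono[THEN subsetD, of F])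
  from insert obtain w where w: "w \<in> span F" "\<And>x. x \<in> span F \<Longrightarrow> b (v - w) x = 0" by (metis insert_subset)
  have wV: "w \<in> V" "v - w \<in> V" using w sF insert.prems V by (auto simp: subspace_diff)
  \<comment> \<open>If \<open>b e e = 0\<close> the quotient is 0 by convention. This is consistent,
    since then \<open>e\<close> is orthogonal to all of \<open>V\<close> by
    \<open>psd_on_null\<close>.\<close>
  define c where "c = b (v - w) e / b e e"
  have ce: "b (v - w) e - c * b e e = 0"
    using psd_on_null[OF b V eV wV(2)] b wV(2) eV by (cases "b e e = 0") (auto simp: c_def psd_on_def)
  have "b (v - (w + c *\<^sub>R e)) x = 0" if x: "x \<in> span (insert f F)" for x
  proof -
    from x obtain k where k: "x - k *\<^sub>R f \<in> span F" by (auto simp: span_breakdown_eq)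
    define y where "y = x - k *\<^sub>R e"
    have "y = (x - k *\<^sub>R f) + k *\<^sub>R g" by (simp add: y_def e_def algebra_simps)
    then have y: "y \<in> span F" using k g(1) by (simp add: span_add span_scale)
    have xV: "x \<in> V" using x insert.prems V span_minimal[of "insert f F" V] by auto
    have xe: "x = 1 *\<^sub>R y + k *\<^sub>R e" by (simp add: y_def)
    have yV: "y \<in> V" using y sF by auto
    have 1: "b (v - w) x = k * b (v - w) e"
      using lin_onD[OF bilin_onD2[OF bil wV(2)] yV eV, of 1 k] w(2)[OF y] xe by simp
    have 2: "b e x = k * b e e"
      using lin_onD[OF bilin_onD2[OF bil eV] yV eV, of 1 k] g(2)[OF y] xe by (simp add: e_def)
    have "b (1 *\<^sub>R (v - w) + (- c) *\<^sub>R e) x = b (v - w) x - c * b e x"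
      using lin_onD[OF bilin_onD1[OF bil xV] wV(2) eV, of 1 "- c"] by simp
    also have "\<dots> = k * (b (v - w) e - c * b e e)" unfolding 1 2 by (simp add: algebra_simps)
    finally show ?thesis unfolding ce by (simp add: algebra_simps)
  qed
  moreover have "w + c *\<^sub>R e \<in> span (insert f F)"
    using w(1) e_span by (intro span_add span_scale) (auto intro: span_mono[THEN subsetD, of F])
  ultimately show ?case by blast
qed

text \<open>Induction over a basis, each new vector being made orthogonal with respect to
  \<open>b\<close>. Then \<open>b\<close> splits exactly into the two parts, while \<open>t\<close>
  splits up to the factor 2 of \<open>psd_on_add_le\<close>, which is lost in every step.\<close>

lemma psd_dominated:
  assumes V: "findim V" and b: "psd_on V b" and t: "psd_on V t"
    and ker: "\<And>v. v \<in> V \<Longrightarrow> b v v = 0 \<Longrightarrow> t v v = 0"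
  shows "\<exists>c>0. \<forall>v\<in>V. t v v \<le> c * b v v"
proof -
  have sV: "subspace V" using V by (simp add: findim_def)
  obtain B where B: "finite B" "B \<subseteq> V" "span B = V" using findim_basis[OF V] by metis
  have "F \<subseteq> V \<Longrightarrow> \<exists>c>0. \<forall>v\<in>span F. t v v \<le> c * b v v" if "finite F" for F
    using that
  proof (induction F rule: finite_induct)
    case empty
    have "t 0 0 = 0" "b 0 0 = 0"
      using b t sV subspace_0[OF sV]
      by (auto intro!: lin_on_0[of V "b 0"] lin_on_0[of V "t 0"] bilin_onD2[of V V] simp: psd_on_def)
    then show ?case by (auto intro: exI[of _ 1])
  next
    case (insert f F)
    then obtain c where c: "c > 0" "\<And>v. v \<in> span F \<Longrightarrow> t v v \<le> c * b v v" by auto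
    have sF: "span F \<subseteq> V" using insert.prems sV by (simp add: span_minimal)
    obtain g where g: "g \<in> span F" "\<And>x. x \<in> span F \<Longrightarrow> b (f - g) x = 0"
      using psd_projection[OF b sV insert.hyps(1)] insert.prems by blast
    define e where "e = f - g"
    have eV: "e \<in> V" using g sF insert.prems sV by (auto simp: e_def subspace_diff)
    \<comment> \<open>The kernel condition enters for \<open>b e e = 0\<close>: then
      \<open>t e e = 0\<close> and any constant serves. Otherwise the quotient is the best constant
      in the direction \<open>e\<close>.\<close>
    define d where "d = max c (if b e e = 0 then 0 else t e e / b e e)"
    have d: "d > 0" "c \<le> d" using c(1) by (auto simp: d_def)
    have be: "b e e \<ge> 0" using b eV by (auto simp: psd_on_def)
    have te: "t e e \<le> d * b e e"
    proof (cases "b e e = 0")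
      case False
      then have "t e e = (t e e / b e e) * b e e" by simp
      also have "\<dots> \<le> d * b e e" using be False by (intro mult_right_mono) (auto simp: d_def)
      finally show ?thesis .
    qed (use ker eV in auto)
    have "t x x \<le> (2 * d) * b x x" if x: "x \<in> span (insert f F)" for x
    proof -
      from x obtain k where k: "x - k *\<^sub>R f \<in> span F" by (auto simp: span_breakdown_eq)
      define y where "y = x - k *\<^sub>R e"
      have "y = (x - k *\<^sub>R f) + k *\<^sub>R g" by (simp add: y_def e_def algebra_simps)
      then have y: "y \<in> span F" using k g(1) by (simp add: span_add span_scale)
      have yV: "y \<in> V" and keV: "k *\<^sub>R e \<in> V" using y sF eV sV by (auto simp: subspace_scale)
      have bye: "b y e = 0" using g(2)[OF y] b yV eV by (auto simp: psd_on_def e_def)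
      have bx: "b x x = b y y + k\<^sup>2 * b e e"
        using psd_on_expand[OF b yV eV sV, of 1 k] bye by (simp add: y_def)
      have tk: "t (k *\<^sub>R e) (k *\<^sub>R e) = k\<^sup>2 * t e e"
        using psd_on_expand[OF t eV eV sV, of k 0] by simp
      have "t x x \<le> 2 * t y y + 2 * (k\<^sup>2 * t e e)"
        using psd_on_add_le[OF t sV yV keV] unfolding tk by (simp add: y_def)
      also have "\<dots> \<le> 2 * (d * b y y) + 2 * (k\<^sup>2 * (d * b e e))"
      proof -
        have "t y y \<le> d * b y y" using c(2)[OF y] d(2) b yV
          by (meson mult_right_mono order_trans psd_on_def)
        then show ?thesis using te by (intro add_mono mult_left_mono) auto
      qed
      also have "\<dots> = (2 * d) * b x x" unfolding bx by (simp add: algebra_simps)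
      finally show ?thesis .
    qed
    then show ?case using d(1) by (intro exI[of _ "2 * d"]) auto
  qed
  from this[OF B(1,2)] show ?thesis unfolding B(3) .
qed


section \<open>The Gauss--Radau rule\<close>

locale radau_interval =
  fixes k :: nat and xh wh :: "nat \<Rightarrow> real" and a b :: real
  assumes radau: "gauss_radau k xh wh" and ab: "a < b"
begin

abbreviation node :: "nat \<Rightarrow> real" where "node \<equiv> qnode xh a b"
abbreviation Q :: "(real \<Rightarrow> real) \<Rightarrow> real" where "Q \<equiv> Qn k xh wh a b"

lemma exact: "degree p \<le> 2 * k \<Longrightarrow> (\<Sum>\<mu>=1..k+1. wh \<mu> * poly p (xh \<mu>)) = integral {-1..1} (poly p)"
  using radau by (auto simp: gauss_radau_def)

lemma inj_xh: "inj_on xh {1..k+1}"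
  using radau by (auto simp: gauss_radau_def intro: strict_mono_on_imp_inj_on)

lemma inj_node: "inj_on node {1..k+1}"
  using inj_xh ab by (auto simp: inj_on_def qnode_def)

lemma node_mem: "\<mu> \<in> {1..k+1} \<Longrightarrow> node \<mu> \<in> {a..b}"
proof -
  assume "\<mu> \<in> {1..k+1}"
  then have "xh \<mu> \<in> {-1..1}" using radau unfolding gauss_radau_def by blast
  then have x: "xh \<mu> \<ge> -1" "xh \<mu> \<le> 1" by auto
  have "(b - a) / 2 * xh \<mu> \<le> (b - a) / 2 * 1" "(b - a) / 2 * (-1) \<le> (b - a) / 2 * xh \<mu>"
    using x ab by (intro mult_left_mono; simp)+
  then show ?thesis by (auto simp: qnode_def field_simps)
qed

text \<open>Exactness is applied to the square of the node polynomial with the factor of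
  \<open>xh \<mu>\<close> left out: it has degree exactly \<open>2 * k\<close>, vanishes at all
  other nodes and has a positive integral.\<close>

lemma weight_pos:
  assumes \<mu>: "\<mu> \<in> {1..k+1}"
  shows "wh \<mu> > 0"
proof -
  define p where "p = (\<Prod>\<nu>\<in>{1..k+1} - {\<mu>}. [:- xh \<nu>, 1:]\<^sup>2)"
  have "degree p = (\<Sum>\<nu>\<in>{1..k+1} - {\<mu>}. degree ([:- xh \<nu>, 1:]\<^sup>2))"
    unfolding p_def by (intro degree_prod_eq_sum_degree) auto
  also have "\<dots> = 2 * k" using \<mu> by (simp add: degree_power_eq)
  finally have deg: "degree p = 2 * k" .
  have p0: "p \<noteq> 0" unfolding p_def by (auto simp: prod_zero_iff)
  have pp: "poly p x = (\<Prod>\<nu>\<in>{1..k+1} - {\<mu>}. (x - xh \<nu>)\<^sup>2)" for x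
    unfolding p_def poly_prod by (intro prod.cong) (auto simp: power2_eq_square algebra_simps)
  have nonneg: "poly p x \<ge> 0" for x unfolding pp by (intro prod_nonneg) auto
  have "wh \<mu> * poly p (xh \<mu>) = (\<Sum>\<nu>=1..k+1. wh \<nu> * poly p (xh \<nu>))"
  proof -
    have "poly p (xh \<nu>) = 0" if "\<nu> \<in> {1..k+1} - {\<mu>}" for \<nu>
      unfolding pp using that by (intro prod_zero) auto
    then have "(\<Sum>\<nu>=1..k+1. wh \<nu> * poly p (xh \<nu>)) = (\<Sum>\<nu>\<in>{\<mu>}. wh \<nu> * poly p (xh \<nu>))"
      using \<mu> by (intro sum.mono_neutral_right) auto
    then show ?thesis by simp
  qed
  also have "\<dots> = integral {-1..1} (poly p)" using deg by (intro exact) auto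
  also have "\<dots> > 0"
  proof -
    have c: "continuous_on {-1..1} (poly p)" by (intro continuous_intros)
    then have "integral {-1..1} (poly p) \<ge> 0"
      using nonneg by (intro integral_nonneg integrable_continuous_real) auto
    moreover have "integral {-1..1} (poly p) \<noteq> 0"
    proof
      assume "integral {-1..1} (poly p) = 0"
      then have "\<forall>x\<in>{-1..1::real}. poly p x = 0"
        using integral_eq_0_iff[OF c] nonneg by auto
      then have "{-1..1::real} \<subseteq> {x. poly p x = 0}" by auto
      then have "finite {-1..1::real}" using poly_roots_finite[OF p0] finite_subset by blast
      then show False by (simp add: infinite_Icc)
    qed
    ultimately show ?thesis by simp
  qed
  finally show ?thesis using nonneg[of "xh \<mu>"] by (simp add: zero_less_mult_iff not_less)
qed

lemma Q_pderiv:
  assumes "degree p \<le> 2 * k"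
  shows "Q (poly (pderiv p)) = poly p b - poly p a"
proof -
  \<comment> \<open>The affine map from [-1, 1] to [a, b]; the factor \<open>(b - a) / 2\<close>
    from the chain rule is the scaling factor in \<open>Qn\<close>.\<close>
  define l where "l = [:(a + b) / 2, (b - a) / 2:]"
  define g where "g = pcompose p l"
  have l: "poly l x = (a + b) / 2 + (b - a) / 2 * x" for x by (simp add: l_def algebra_simps)
  have "degree g \<le> 2 * k" using assms ab by (simp add: g_def l_def degree_pcompose)
  then have "(\<Sum>\<mu>=1..k+1. wh \<mu> * poly (pderiv g) (xh \<mu>)) = integral {-1..1} (poly (pderiv g))"
    by (intro exact) (simp add: degree_pderiv)
  also have "\<dots> = poly g 1 - poly g (-1)"
    by (intro integral_unique fundamental_theorem_of_calculus)
       (auto simp: has_real_derivative_iff_has_vector_derivative[symmetric] intro: has_field_derivative_at_within)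
  also have "\<dots> = poly p b - poly p a" by (simp add: g_def poly_pcompose l field_simps)
  finally have "(\<Sum>\<mu>=1..k+1. wh \<mu> * poly (pderiv g) (xh \<mu>)) = poly p b - poly p a" .
  moreover have "poly (pderiv g) x = (b - a) / 2 * poly (pderiv p) (poly l x)" for x
    by (simp add: g_def pderiv_pcompose poly_pcompose l_def pderiv_pCons)
  ultimately show ?thesis
    by (simp add: Qn_def qnode_def l sum_distrib_left mult.left_commute del: sum.cl_ivl_Suc)
qed

lemma Q_add: "Q (\<lambda>t. f t + g t) = Q f + Q g"
  and Q_diff: "Q (\<lambda>t. f t - g t) = Q f - Q g"
  and Q_cmult: "Q (\<lambda>t. c * f t) = c * Q f"
  by (simp_all add: Qn_def sum.distrib sum_subtractf sum_distrib_left algebra_simps del: sum.cl_ivl_Suc)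

lemma Q_sum: "Q (\<lambda>t. \<Sum>i\<in>I. f i t) = (\<Sum>i\<in>I. Q (f i))"
  by (induction I rule: infinite_finite_induct) (auto simp: Q_add, auto simp: Qn_def)

lemma Q_cong: "(\<And>\<mu>. \<mu> \<in> {1..k+1} \<Longrightarrow> f (node \<mu>) = g (node \<mu>)) \<Longrightarrow> Q f = Q g"
  unfolding Qn_def by (intro arg_cong[of _ _ "\<lambda>x. _ * x"] sum.cong) auto

lemma Q_nonneg: "(\<And>\<mu>. \<mu> \<in> {1..k+1} \<Longrightarrow> f (node \<mu>) \<ge> 0) \<Longrightarrow> Q f \<ge> 0"
  unfolding Qn_def using ab weight_pos by (intro mult_nonneg_nonneg sum_nonneg) (auto intro: less_imp_le)

lemma lin_on_Q:
  assumes "\<And>\<mu>. \<mu> \<in> {1..k+1} \<Longrightarrow> lin_on W (f (node \<mu>))"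
  shows "lin_on W (\<lambda>z. Q (\<lambda>t. f t z))"
  unfolding Qn_def by (intro lin_on_intros assms)

lemma poly_zero_at_nodes:
  assumes "degree p \<le> k" "\<And>\<mu>. \<mu> \<in> {1..k+1} \<Longrightarrow> poly p (node \<mu>) = 0"
  shows "p = 0"
proof (rule poly_eqI_degree[where A = "node ` {1..k+1}"])
  have "card (node ` {1..k+1}) = k + 1" by (simp only: card_image[OF inj_node]) simp
  then show "card (node ` {1..k+1}) > degree p" "card (node ` {1..k+1}) > degree (0 :: real poly)"
    using assms(1) by auto
qed (use assms in auto)

text \<open>A Lagrange polynomial divided by its scaled quadrature weight. Since \<open>Q\<close>
  looks only at the nodes, this gives a point evaluation for arbitrary \<open>f\<close>.\<close>

lemma nodal_poly:
  assumes \<mu>: "\<mu> \<in> {1..k+1}"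
  obtains p where "degree p \<le> k" "\<And>f. Q (\<lambda>t. poly p t * f t) = f (node \<mu>)"
proof -
  define q where "q = (\<Prod>\<nu>\<in>{1..k+1} - {\<mu>}. [:- node \<nu>, 1:])"
  have qq: "poly q x = (\<Prod>\<nu>\<in>{1..k+1} - {\<mu>}. (x - node \<nu>))" for x
    unfolding q_def poly_prod by (intro prod.cong) auto
  have "degree q \<le> sum (degree \<circ> (\<lambda>\<nu>. [:- node \<nu>, 1:])) ({1..k+1} - {\<mu>})"
    unfolding q_def by (rule degree_prod_sum_le) auto
  also have "\<dots> = k" using \<mu> by simp
  finally have deg: "degree q \<le> k" .
  have q\<mu>: "poly q (node \<mu>) \<noteq> 0"
    unfolding qq using inj_node \<mu> by (auto simp: prod_zero_iff inj_on_def)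
  define c where "c = (b - a) / 2 * (wh \<mu> * poly q (node \<mu>))"
  have c: "c \<noteq> 0" using q\<mu> weight_pos[OF \<mu>] ab by (simp add: c_def)
  define p where "p = smult (1 / c) q"
  have "Q (\<lambda>t. poly p t * f t) = f (node \<mu>)" for f
  proof -
    have "(\<Sum>\<nu>=1..k+1. wh \<nu> * (poly q (node \<nu>) * f (node \<nu>))) = wh \<mu> * (poly q (node \<mu>) * f (node \<mu>))"
    proof -
      have "poly q (node \<nu>) = 0" if "\<nu> \<in> {1..k+1} - {\<mu>}" for \<nu>
        unfolding qq using that by (intro prod_zero) auto
      then have "(\<Sum>\<nu>=1..k+1. wh \<nu> * (poly q (node \<nu>) * f (node \<nu>)))
          = (\<Sum>\<nu>\<in>{\<mu>}. wh \<nu> * (poly q (node \<nu>) * f (node \<nu>)))"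
        using \<mu> by (intro sum.mono_neutral_right) auto
      then show ?thesis by simp
    qed
    then have "Q (\<lambda>t. poly q t * f t) = c * f (node \<mu>)" by (simp add: Qn_def c_def del: sum.cl_ivl_Suc)
    moreover have "Q (\<lambda>t. poly p t * f t) = (1 / c) * Q (\<lambda>t. poly q t * f t)"
      unfolding Q_cmult[symmetric] by (simp add: p_def algebra_simps)
    ultimately show ?thesis using c by simp
  qed
  moreover have "degree p \<le> k" using deg by (simp add: p_def)
  ultimately show ?thesis using that by blast
qed

end


section \<open>Polynomials in time with values in a function space\<close>

lemma Pk_iff:
  "w \<in> Pk k V \<longleftrightarrow> (\<exists>c. (\<forall>j\<le>k. c j \<in> V) \<and> w = (\<lambda>t. \<Sum>j\<le>k. t ^ j *\<^sub>R c j))"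
  by (auto simp: Pk_def fun_eq_iff)

lemma dt_eq:
  assumes "w = (\<lambda>t. \<Sum>j\<le>k. t ^ j *\<^sub>R c j)"
  shows "dt w t = (\<Sum>j\<le>k. (real j * t ^ (j - 1)) *\<^sub>R c j)"
proof
  fix x
  have "((\<lambda>s. w s x) has_vector_derivative (\<Sum>j\<le>k. (real j * t ^ (j - 1)) *\<^sub>R c j x)) (at t)"
    unfolding assms by (auto intro!: derivative_eq_intros has_vector_derivative_scaleR simp: algebra_simps)
  then show "dt w t x = (\<Sum>j\<le>k. (real j * t ^ (j - 1)) *\<^sub>R c j) x"
    by (simp add: dt_def vector_derivative_at)
qed

lemma Pk_rep:
  assumes "w \<in> Pk k V"
  obtains c where "\<And>j. j \<le> k \<Longrightarrow> c j \<in> V" "w = (\<lambda>t. \<Sum>j\<le>k. t ^ j *\<^sub>R c j)"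
    "\<And>t. dt w t = (\<Sum>j\<le>k. (real j * t ^ (j - 1)) *\<^sub>R c j)"
proof -
  from assms obtain c where "\<forall>j\<le>k. c j \<in> V" "w = (\<lambda>t. \<Sum>j\<le>k. t ^ j *\<^sub>R c j)" unfolding Pk_iff by blast
  then show ?thesis using that[of c] dt_eq[of w c k] by blast
qed

lemma right_lim_Pk:
  fixes V :: "('a \<Rightarrow> 'b::real_normed_vector) set"
  assumes "w \<in> Pk k V"
  shows "right_lim w t = w t"
proof
  fix x
  obtain c where c: "w = (\<lambda>t. \<Sum>j\<le>k. t ^ j *\<^sub>R c j)" by (rule Pk_rep[OF assms]) blast
  have "((\<lambda>s. w s x) \<longlongrightarrow> w t x) (at_right t)"
    unfolding c by (auto intro!: tendsto_intros)
  then show "right_lim w t x = w t x"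
    unfolding right_lim_def by (intro tendsto_Lim) auto
qed

lemma Pk_mem:
  fixes V :: "('a \<Rightarrow> 'b::real_normed_vector) set"
  assumes "w \<in> Pk k V" "subspace V"
  shows "w t \<in> V" "dt w t \<in> V"
proof -
  obtain c where c: "\<And>j. j \<le> k \<Longrightarrow> c j \<in> V" "w = (\<lambda>t. \<Sum>j\<le>k. t ^ j *\<^sub>R c j)"
    "\<And>t. dt w t = (\<Sum>j\<le>k. (real j * t ^ (j - 1)) *\<^sub>R c j)" by (rule Pk_rep[OF assms(1)]) blast
  show "w t \<in> V" "dt w t \<in> V"
    unfolding c(2)[THEN fun_cong] c(3) using c(1) assms(2) by (auto intro!: subspace_sum subspace_scale)
qed

text \<open>Reduces vector valued polynomials to real ones, where root counting and the quadrature
  rule are available; the same \<open>p\<close> serves the function and its time derivative.\<close>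

lemma Pk_lin:
  fixes V :: "('a \<Rightarrow> 'b::real_normed_vector) set"
  assumes "w \<in> Pk k V" "subspace V" "lin_on V L"
  obtains p where "degree p \<le> k" "\<And>t. L (w t) = poly p t" "\<And>t. L (dt w t) = poly (pderiv p) t"
proof -
  obtain c where c: "\<And>j. j \<le> k \<Longrightarrow> c j \<in> V" "w = (\<lambda>t. \<Sum>j\<le>k. t ^ j *\<^sub>R c j)"
    "\<And>t. dt w t = (\<Sum>j\<le>k. (real j * t ^ (j - 1)) *\<^sub>R c j)" by (rule Pk_rep[OF assms(1)]) blast
  define p where "p = (\<Sum>j\<le>k. monom (L (c j)) j)"
  have "degree p \<le> k" unfolding p_def
    by (intro degree_sum_le) (auto intro: order_trans[OF degree_monom_le])
  moreover have "L (w t) = poly p t" for t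
    using c(1) lin_on_lincomb[OF assms(3,2), of "{..k}" c "\<lambda>j. t ^ j"]
    by (simp add: c(2) p_def poly_sum poly_monom mult.commute)
  moreover have "L (dt w t) = poly (pderiv p) t" for t
    using c(1) lin_on_lincomb[OF assms(3,2), of "{..k}" c "\<lambda>j. real j * t ^ (j - 1)"]
    by (simp add: c(3) p_def poly_sum poly_monom pderiv_monom higher_pderiv_sum[of 1, simplified] mult_ac)
  ultimately show ?thesis using that by blast
qed

text \<open>A product of two polynomials of degree \<open>k\<close> just meets the degree bound of
  \<open>Q_pderiv\<close>; the last conclusion is the product rule.\<close>

lemma Pk_bilin:
  fixes V :: "('a \<Rightarrow> 'b::real_normed_vector) set"
  assumes w: "w \<in> Pk k V" and z: "z \<in> Pk k W" and V: "subspace V" and W: "subspace W" and \<beta>: "bilin_on V W \<beta>"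
  obtains p where "degree p \<le> 2 * k" "\<And>t. \<beta> (w t) (z t) = poly p t"
    "\<And>t. \<beta> (dt w t) (z t) + \<beta> (w t) (dt z t) = poly (pderiv p) t"
proof -
  obtain c where c: "\<And>j. j \<le> k \<Longrightarrow> c j \<in> V" "w = (\<lambda>t. \<Sum>j\<le>k. t ^ j *\<^sub>R c j)"
    "\<And>t. dt w t = (\<Sum>j\<le>k. (real j * t ^ (j - 1)) *\<^sub>R c j)" by (rule Pk_rep[OF w]) blast
  have "\<exists>p. degree p \<le> k \<and> (\<forall>t. \<beta> (c j) (z t) = poly p t) \<and> (\<forall>t. \<beta> (c j) (dt z t) = poly (pderiv p) t)"
    if "j \<le> k" for j
    using Pk_lin[OF z W bilin_onD2[OF \<beta> c(1)[OF that]]] by metis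
  then obtain q where q: "\<And>j. j \<le> k \<Longrightarrow> degree (q j) \<le> k" "\<And>j t. j \<le> k \<Longrightarrow> \<beta> (c j) (z t) = poly (q j) t"
    "\<And>j t. j \<le> k \<Longrightarrow> \<beta> (c j) (dt z t) = poly (pderiv (q j)) t" by metis
  define p where "p = (\<Sum>j\<le>k. monom 1 j * q j)"
  have "degree p \<le> 2 * k" unfolding p_def
  proof (intro degree_sum_le)
    fix j assume "j \<in> {..k}"
    then show "degree (monom 1 j * q j) \<le> 2 * k"
      using degree_mult_le[of "monom 1 j" "q j"] q(1)[of j] by (simp add: degree_monom_eq)
  qed auto
  moreover have "\<beta> (w t) (z t) = poly p t" for t
    using c(1) lin_on_lincomb[OF bilin_onD1[OF \<beta> Pk_mem(1)[OF z W]] V, of "{..k}" c "\<lambda>j. t ^ j"]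
    by (simp add: c(2) p_def poly_sum poly_monom q(2))
  moreover have "\<beta> (dt w t) (z t) + \<beta> (w t) (dt z t) = poly (pderiv p) t" for t
  proof -
    have "\<beta> (dt w t) (z t) = (\<Sum>j\<le>k. real j * t ^ (j - 1) * poly (q j) t)"
      using c(1) lin_on_lincomb[OF bilin_onD1[OF \<beta> Pk_mem(1)[OF z W]] V, of "{..k}" c "\<lambda>j. real j * t ^ (j - 1)"]
      unfolding c(3) by (simp add: q(2))
    moreover have "\<beta> (w t) (dt z t) = (\<Sum>j\<le>k. t ^ j * poly (pderiv (q j)) t)"
      using c(1) lin_on_lincomb[OF bilin_onD1[OF \<beta> Pk_mem(2)[OF z W]] V, of "{..k}" c "\<lambda>j. t ^ j"]
      unfolding c(2) by (simp add: q(3))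
    ultimately show ?thesis
      by (simp add: p_def poly_sum poly_monom pderiv_mult pderiv_monom higher_pderiv_sum[of 1, simplified]
          sum.distrib[symmetric] mult_ac add_ac)
  qed
  ultimately show ?thesis using that by blast
qed

lemma Pk_smult_poly:
  assumes "degree p \<le> k" "y \<in> V" "subspace V"
  shows "(\<lambda>t. poly p t *\<^sub>R y) \<in> Pk k V"
  unfolding Pk_iff
proof (intro exI conjI)
  show "\<forall>j\<le>k. poly.coeff p j *\<^sub>R y \<in> V" using assms by (simp add: subspace_scale)
  show "(\<lambda>t. poly p t *\<^sub>R y) = (\<lambda>t. \<Sum>j\<le>k. t ^ j *\<^sub>R poly.coeff p j *\<^sub>R y)"
  proof
    fix t
    have "poly p t = (\<Sum>j\<le>k. t ^ j * poly.coeff p j)"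
      unfolding poly_altdef using assms(1)
      by (intro sum.mono_neutral_cong_left) (auto simp: coeff_eq_0 mult.commute)
    then show "poly p t *\<^sub>R y = (\<Sum>j\<le>k. t ^ j *\<^sub>R poly.coeff p j *\<^sub>R y)"
      by (simp add: scaleR_sum_left)
  qed
qed

lemma Pk_lincomb:
  fixes V :: "('a \<Rightarrow> 'b::real_normed_vector) set"
  assumes "w \<in> Pk k V" "z \<in> Pk k V" "subspace V"
  shows "r *\<^sub>R w + s *\<^sub>R z \<in> Pk k V" "dt (r *\<^sub>R w + s *\<^sub>R z) t = r *\<^sub>R dt w t + s *\<^sub>R dt z t"
proof -
  obtain c where c: "\<And>j. j \<le> k \<Longrightarrow> c j \<in> V" "w = (\<lambda>t. \<Sum>j\<le>k. t ^ j *\<^sub>R c j)"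
    "\<And>t. dt w t = (\<Sum>j\<le>k. (real j * t ^ (j - 1)) *\<^sub>R c j)" by (rule Pk_rep[OF assms(1)]) blast
  obtain d where d: "\<And>j. j \<le> k \<Longrightarrow> d j \<in> V" "z = (\<lambda>t. \<Sum>j\<le>k. t ^ j *\<^sub>R d j)"
    "\<And>t. dt z t = (\<Sum>j\<le>k. (real j * t ^ (j - 1)) *\<^sub>R d j)" by (rule Pk_rep[OF assms(2)]) blast
  have eq: "r *\<^sub>R w + s *\<^sub>R z = (\<lambda>t. \<Sum>j\<le>k. t ^ j *\<^sub>R (r *\<^sub>R c j + s *\<^sub>R d j))"
    by (auto simp: c(2) d(2) fun_eq_iff scaleR_sum_right sum.distrib algebra_simps)
  have "\<forall>j\<le>k. r *\<^sub>R c j + s *\<^sub>R d j \<in> V" using c(1) d(1) assms(3) by (simp add: subspace_add subspace_scale)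
  then show "r *\<^sub>R w + s *\<^sub>R z \<in> Pk k V" unfolding Pk_iff eq by (intro exI[of _ "\<lambda>j. r *\<^sub>R c j + s *\<^sub>R d j"]) auto
  show "dt (r *\<^sub>R w + s *\<^sub>R z) t = r *\<^sub>R dt w t + s *\<^sub>R dt z t"
    unfolding dt_eq[OF eq] c(3) d(3) by (simp add: scaleR_sum_right sum.distrib algebra_simps)
qed

lemma Pk_0: "subspace V \<Longrightarrow> 0 \<in> Pk k V"
  unfolding Pk_iff by (intro exI[of _ "\<lambda>_. 0"]) (auto simp: subspace_0 fun_eq_iff)

lemma subspace_Pk:
  fixes V :: "('a \<Rightarrow> 'b::real_normed_vector) set"
  assumes "subspace V"
  shows "subspace (Pk k V)"
  using Pk_lincomb(1)[of _ k V _ 1 1] Pk_lincomb(1)[of _ k V 0 _ 0] Pk_0[OF assms] assms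
  by (intro subspaceI) auto

lemma findim_Pk:
  fixes V :: "('a \<Rightarrow> 'b::real_normed_vector) set"
  assumes "findim V"
  shows "findim (Pk k V)"
proof -
  obtain B where B: "finite B" "V \<subseteq> span B" and V: "subspace V" using assms by (auto simp: findim_def)
  define T :: "nat \<Rightarrow> ('a \<Rightarrow> 'b) \<Rightarrow> real \<Rightarrow> 'a \<Rightarrow> 'b" where "T j c = (\<lambda>t. t ^ j *\<^sub>R c)" for j c
  have T: "linear (T j)" for j
    by (intro linearI) (auto simp: T_def fun_eq_iff algebra_simps)
  have "w \<in> span (\<Union>j\<le>k. T j ` B)" if w: "w \<in> Pk k V" for w
  proof -
    obtain c where c: "\<And>j. j \<le> k \<Longrightarrow> c j \<in> V" "w = (\<lambda>t. \<Sum>j\<le>k. t ^ j *\<^sub>R c j)" by (rule Pk_rep[OF w]) blast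
    have "w = (\<Sum>j\<le>k. T j (c j))" by (simp add: c(2) T_def fun_eq_iff)
    moreover have "T j (c j) \<in> span (\<Union>j\<le>k. T j ` B)" if "j \<le> k" for j
    proof -
      have "T j (c j) \<in> span (T j ` B)" using linear_span_image[OF T, of j B] c(1)[OF that] B(2) by auto
      then show ?thesis using span_mono[of "T j ` B" "\<Union>j\<le>k. T j ` B"] that by blast
    qed
    ultimately show ?thesis by (auto intro: span_sum)
  qed
  moreover have "finite (\<Union>j\<le>k. T j ` B)" using B(1) by auto
  ultimately show ?thesis using subspace_Pk[OF V] unfolding findim_def by blast
qed


section \<open>The discrete system on one time interval\<close>

text \<open>The scheme reduced to its algebra: \<open>m\<close> and \<open>mp\<close> stand for the
  inner products of the displacement and pressure spaces, \<open>A\<close>, \<open>B\<close> and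
  \<open>C\<close> for the elasticity, diffusion and coupling forms. Definiteness is a property of
  \<open>m\<close> and \<open>mp\<close>; \<open>A\<close> and \<open>B\<close> may be
  degenerate.\<close>

locale dg_system = radau_interval k xh wh a b
  for k :: nat and xh wh :: "nat \<Rightarrow> real" and a b :: real +
  fixes V :: "('x \<Rightarrow> 'v::real_normed_vector) set" and P :: "('y \<Rightarrow> 'p::real_normed_vector) set"
    and m A :: "('x \<Rightarrow> 'v) \<Rightarrow> ('x \<Rightarrow> 'v) \<Rightarrow> real" and mp B :: "('y \<Rightarrow> 'p) \<Rightarrow> ('y \<Rightarrow> 'p) \<Rightarrow> real"
    and C :: "('x \<Rightarrow> 'v) \<Rightarrow> ('y \<Rightarrow> 'p) \<Rightarrow> real" and \<rho> c :: real
  assumes V: "findim V" and P: "findim P"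
    and m: "psd_on V m" and m0: "\<And>v. v \<in> V \<Longrightarrow> m v v = 0 \<Longrightarrow> v = 0"
    and mp: "psd_on P mp" and mp0: "\<And>q. q \<in> P \<Longrightarrow> mp q q = 0 \<Longrightarrow> q = 0"
    and A: "psd_on V A" and B: "bilin_on P P B" and B0: "\<And>q. q \<in> P \<Longrightarrow> B q q \<ge> 0"
    and C: "bilin_on V P C" and \<rho>: "\<rho> > 0" and c: "c > 0"
begin

lemma sV: "subspace V" and sP: "subspace P"
  using V P by (auto simp: findim_def)

lemma bil: "bilin_on V V m" "bilin_on P P mp" "bilin_on V V A"
  and sym: "\<And>v w. v \<in> V \<Longrightarrow> w \<in> V \<Longrightarrow> m v w = m w v" "\<And>v w. v \<in> V \<Longrightarrow> w \<in> V \<Longrightarrow> A v w = A w v"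
    "\<And>v w. v \<in> P \<Longrightarrow> w \<in> P \<Longrightarrow> mp v w = mp w v"
  and nonneg: "\<And>v. v \<in> V \<Longrightarrow> m v v \<ge> 0" "\<And>v. v \<in> V \<Longrightarrow> A v v \<ge> 0" "\<And>v. v \<in> P \<Longrightarrow> mp v v \<ge> 0"
  using m mp A by (auto simp: psd_on_def)

definition lhs1 where "lhs1 u v \<phi> = Q (\<lambda>t. m (dt u t) (\<phi> t) - m (v t) (\<phi> t)) + m (u a) (\<phi> a)"
definition lhs2 where "lhs2 u v p \<eta> = Q (\<lambda>t. \<rho> * m (dt v t) (\<eta> t) + A (u t) (\<eta> t) + C (\<eta> t) (p t)) + \<rho> * m (v a) (\<eta> a)"
text \<open>The initial divergence and the initial normal trace of the third equation are collected
  in \<open>- C (u a) (\<psi> a)\<close>. Thus \<open>u\<close> enters through its discontinuous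
  Galerkin derivative inside \<open>C\<close>, as \<open>velocity_identity\<close> requires.\<close>

definition lhs3 where "lhs3 u p \<psi> = Q (\<lambda>t. c * mp (dt p t) (\<psi> t) - C (dt u t) (\<psi> t) + B (p t) (\<psi> t))
  + c * mp (p a) (\<psi> a) - C (u a) (\<psi> a)"

text \<open>Summation by parts: the initial value term turns the difference of the end point energies into their sum.\<close>

lemma Q_energy:
  assumes w: "w \<in> Pk k W" and W: "subspace W" and \<beta>: "psd_on W \<beta>"
  shows "Q (\<lambda>t. \<beta> (dt w t) (w t)) + \<beta> (w a) (w a) = (\<beta> (w b) (w b) + \<beta> (w a) (w a)) / 2"
proof -
  have bl: "bilin_on W W \<beta>" and sy: "\<And>x y. x \<in> W \<Longrightarrow> y \<in> W \<Longrightarrow> \<beta> x y = \<beta> y x" using \<beta> by (auto simp: psd_on_def)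
  obtain p where p: "degree p \<le> 2 * k" "\<And>t. \<beta> (w t) (w t) = poly p t"
    "\<And>t. \<beta> (dt w t) (w t) + \<beta> (w t) (dt w t) = poly (pderiv p) t"
    using Pk_bilin[OF w w W W bl] by metis
  have "\<beta> (dt w t) (w t) = 1/2 * poly (pderiv p) t" for t
    using p(3)[of t] sy[OF Pk_mem(1)[OF w W] Pk_mem(2)[OF w W], of t t] by simp
  then have "Q (\<lambda>t. \<beta> (dt w t) (w t)) = 1/2 * (poly p b - poly p a)"
    unfolding Q_pderiv[OF p(1), symmetric] Q_cmult[symmetric] by (intro Q_cong) auto
  then show ?thesis by (simp add: p(2) field_simps)
qed

text \<open>With \<open>y\<close> times a nodal polynomial as test function, the quadrature reduces
  to the residual at one node.\<close>

lemma Q_test: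
  assumes W: "subspace W" and R: "\<And>\<mu>. \<mu> \<in> {1..k+1} \<Longrightarrow> lin_on W (R (node \<mu>))"
    and 0: "\<And>\<eta>. \<eta> \<in> Pk k W \<Longrightarrow> Q (\<lambda>t. R t (\<eta> t)) = 0"
    and y: "y \<in> W" and \<mu>: "\<mu> \<in> {1..k+1}"
  shows "R (node \<mu>) y = 0"
proof -
  obtain p where p: "degree p \<le> k" "\<And>f. Q (\<lambda>t. poly p t * f t) = f (node \<mu>)" by (rule nodal_poly[OF \<mu>]) blast
  have "Q (\<lambda>t. R t (poly p t *\<^sub>R y)) = 0" using 0[OF Pk_smult_poly[OF p(1) y W]] by simp
  moreover have "Q (\<lambda>t. R t (poly p t *\<^sub>R y)) = Q (\<lambda>t. poly p t * R t y)"
    using lin_onD[OF R y y, of _ _ 0] by (intro Q_cong) auto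
  ultimately show ?thesis using p(2)[of "\<lambda>t. R t y"] by simp
qed

text \<open>The first equation identifies the velocity with the discontinuous Galerkin time derivative of the
  displacement, so that it may be tested in any bilinear form instead of the inner product.\<close>

lemma velocity_identity:
  fixes W :: "('s \<Rightarrow> 'r::real_normed_vector) set"
  assumes u: "u \<in> Pk k V" and v: "v \<in> Pk k V" and eq: "\<forall>\<phi>\<in>Pk k V. lhs1 u v \<phi> = 0"
    and W: "subspace W" and \<beta>: "bilin_on V W \<beta>" and x: "x \<in> Pk k W"
  shows "Q (\<lambda>t. \<beta> (dt u t) (x t)) + \<beta> (u a) (x a) = Q (\<lambda>t. \<beta> (v t) (x t))"
proof -
  define d where "d t = dt u t - v t" for t
  have d: "d t \<in> V" for t unfolding d_def using Pk_mem[OF u sV] Pk_mem[OF v sV] sV by (simp add: subspace_diff)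
  have d_diff: "\<gamma> (d t) y = \<gamma> (dt u t) y - \<gamma> (v t) y" if "bilin_on V X \<gamma>" "y \<in> X"
    for t y X and \<gamma> :: "_ \<Rightarrow> 'c::real_vector \<Rightarrow> real"
    using lin_onD[OF bilin_onD1[OF that] Pk_mem(2)[OF u sV] Pk_mem(1)[OF v sV], of 1 t "-1" t] by (simp add: d_def)
  \<comment> \<open>The moment of order \<open>j\<close> of the residual of the first equation,
    initial value included: \<open>lhs1\<close> tested with \<open>t ^ j *\<^sub>R y\<close> for a
    fixed \<open>y\<close> in \<open>V\<close> equals \<open>m (z j) y\<close>.\<close>
  define z where "z j = 1 *\<^sub>R (\<Sum>\<mu>=1..k+1. ((b - a) / 2 * wh \<mu> * node \<mu> ^ j) *\<^sub>R d (node \<mu>)) + a ^ j *\<^sub>R u a" for j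
  have zs: "(\<Sum>\<mu>=1..k+1. ((b - a) / 2 * wh \<mu> * node \<mu> ^ j) *\<^sub>R d (node \<mu>)) \<in> V" for j
    using d sV by (intro subspace_sum subspace_scale) auto
  have zV: "z j \<in> V" for j unfolding z_def using zs Pk_mem(1)[OF u sV] sV
    by (intro subspace_add subspace_scale) auto
  have \<gamma>z: "\<gamma> (z j) y = Q (\<lambda>t. t ^ j * \<gamma> (d t) y) + a ^ j * \<gamma> (u a) y" if "bilin_on V X \<gamma>" "y \<in> X"
    for j y X and \<gamma> :: "_ \<Rightarrow> 'c::real_vector \<Rightarrow> real"
  proof -
    have l: "lin_on V (\<lambda>v. \<gamma> v y)" using that by (rule bilin_onD1)
    have "\<gamma> (1 *\<^sub>R (\<Sum>\<mu>=1..k+1. ((b - a) / 2 * wh \<mu> * node \<mu> ^ j) *\<^sub>R d (node \<mu>)) + a ^ j *\<^sub>R u a) y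
      = 1 * \<gamma> (\<Sum>\<mu>=1..k+1. ((b - a) / 2 * wh \<mu> * node \<mu> ^ j) *\<^sub>R d (node \<mu>)) y + a ^ j * \<gamma> (u a) y"
      using lin_onD[OF l zs Pk_mem(1)[OF u sV]] by blast
    also have "\<gamma> (\<Sum>\<mu>=1..k+1. ((b - a) / 2 * wh \<mu> * node \<mu> ^ j) *\<^sub>R d (node \<mu>)) y
        = (\<Sum>\<mu>=1..k+1. ((b - a) / 2 * wh \<mu> * node \<mu> ^ j) * \<gamma> (d (node \<mu>)) y)"
      using d by (intro lin_on_lincomb[OF l sV])
    also have "\<dots> = Q (\<lambda>t. t ^ j * \<gamma> (d t) y)"
      by (simp add: Qn_def sum_distrib_left mult_ac del: sum.cl_ivl_Suc)
    finally show ?thesis unfolding z_def mult_1_left .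
  qed
  \<comment> \<open>Testing with \<open>z j\<close> itself: definiteness of \<open>m\<close> makes
    each moment vanish as a vector, hence also inside any other bilinear form.\<close>
  have z0: "z j = 0" if j: "j \<le> k" for j
  proof (rule m0[OF zV])
    have "(\<lambda>t. poly (monom 1 j) t *\<^sub>R z j) \<in> Pk k V"
      using j zV sV by (intro Pk_smult_poly) (auto intro: order_trans[OF degree_monom_le])
    then have "lhs1 u v (\<lambda>t. t ^ j *\<^sub>R z j) = 0" using eq by (simp add: poly_monom)
    moreover have "m x (t ^ j *\<^sub>R z j) = t ^ j * m x (z j)" if "x \<in> V" for x t
      using lin_onD[OF bilin_onD2[OF bil(1) that] zV zV, of "t ^ j" j 0 j] by simp
    ultimately have "Q (\<lambda>t. t ^ j * (m (dt u t) (z j) - m (v t) (z j))) + a ^ j * m (u a) (z j) = 0"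
      using Pk_mem[OF u sV] Pk_mem[OF v sV] by (simp add: lhs1_def right_diff_distrib)
    then show "m (z j) (z j) = 0"
      unfolding \<gamma>z[OF bil(1) zV] d_diff[OF bil(1) zV] .
  qed
  obtain e where e: "\<And>j. j \<le> k \<Longrightarrow> e j \<in> W" "x = (\<lambda>t. \<Sum>j\<le>k. t ^ j *\<^sub>R e j)" by (rule Pk_rep[OF x]) blast
  have \<beta>x: "\<beta> y (x t) = (\<Sum>j\<le>k. t ^ j * \<beta> y (e j))" if "y \<in> V" for y t
    unfolding e(2) using e(1) by (intro lin_on_lincomb[OF bilin_onD2[OF \<beta> that] W]) auto
  \<comment> \<open>Expanding \<open>x\<close> in powers of \<open>t\<close> expresses the claim
    through the vanishing moments.\<close>
  have "0 = (\<Sum>j\<le>k. \<beta> (z j) (e j))"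
    using z0 e(1) lin_on_0[OF bilin_onD1[OF \<beta>] zV sV] by (intro sum.neutral[symmetric]) auto
  also have "\<dots> = (\<Sum>j\<le>k. Q (\<lambda>t. t ^ j * \<beta> (d t) (e j)) + a ^ j * \<beta> (u a) (e j))"
    using e(1) by (intro sum.cong \<gamma>z[OF \<beta>]) auto
  also have "\<dots> = Q (\<lambda>t. \<beta> (d t) (x t)) + \<beta> (u a) (x a)"
    using d Pk_mem[OF u sV] by (simp add: \<beta>x sum.distrib Q_sum)
  also have "Q (\<lambda>t. \<beta> (d t) (x t)) = Q (\<lambda>t. \<beta> (dt u t) (x t)) - Q (\<lambda>t. \<beta> (v t) (x t))"
    unfolding Q_diff[symmetric] d_diff[OF \<beta> Pk_mem(1)[OF x W]] ..
  finally show ?thesis by simp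
qed

text \<open>The expression is a real polynomial of degree at most \<open>k\<close> with
  \<open>k + 1\<close> zeros. Its four slots cover each of the evolution equations below; a slot
  that an equation lacks receives the zero functional.\<close>

lemma poly_zero_of_test:
  assumes w: "w \<in> Pk k V" and z: "z \<in> Pk k V" and x: "x \<in> Pk k P"
    and L: "lin_on V L" and M: "lin_on V M" and N: "lin_on P N" and L': "lin_on P L'" and x': "x' \<in> Pk k P"
    and 0: "\<And>\<mu>. \<mu> \<in> {1..k+1} \<Longrightarrow> L (dt w (node \<mu>)) + M (z (node \<mu>)) + N (x (node \<mu>)) + L' (dt x' (node \<mu>)) = 0"
  shows "L (dt w t) + M (z t) + N (x t) + L' (dt x' t) = 0"
proof -
  obtain p1 where p1: "degree p1 \<le> k" "\<And>t. L (dt w t) = poly (pderiv p1) t" by (rule Pk_lin[OF w sV L]) blast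
  obtain p2 where p2: "degree p2 \<le> k" "\<And>t. M (z t) = poly p2 t" by (rule Pk_lin[OF z sV M]) blast
  obtain p3 where p3: "degree p3 \<le> k" "\<And>t. N (x t) = poly p3 t" by (rule Pk_lin[OF x sP N]) blast
  obtain p4 where p4: "degree p4 \<le> k" "\<And>t. L' (dt x' t) = poly (pderiv p4) t" by (rule Pk_lin[OF x' sP L']) blast
  have "pderiv p1 + p2 + p3 + pderiv p4 = 0"
  proof (rule poly_zero_at_nodes)
    show "degree (pderiv p1 + p2 + p3 + pderiv p4) \<le> k"
      using p1(1) p2(1) p3(1) p4(1) by (intro degree_add_le) (auto simp: degree_pderiv)
    fix \<mu> assume "\<mu> \<in> {1..k+1}"
    from 0[OF this] show "poly (pderiv p1 + p2 + p3 + pderiv p4) (node \<mu>) = 0"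
      by (simp add: p1 p2 p3 p4)
  qed
  then have "poly (pderiv p1 + p2 + p3 + pderiv p4) t = 0" by simp
  then show ?thesis by (simp add: p1 p2 p3 p4)
qed

lemma homogeneous:
  assumes u: "u \<in> Pk k V" and v: "v \<in> Pk k V" and p: "p \<in> Pk k P"
    and eq1: "\<And>\<phi>. \<phi> \<in> Pk k V \<Longrightarrow> lhs1 u v \<phi> = 0"
    and eq2: "\<And>\<eta>. \<eta> \<in> Pk k V \<Longrightarrow> lhs2 u v p \<eta> = 0"
    and eq3: "\<And>\<psi>. \<psi> \<in> Pk k P \<Longrightarrow> lhs3 u p \<psi> = 0"
  shows "u = 0" "v = 0" "p = 0"
proof -
  note uV = Pk_mem[OF u sV] and vV = Pk_mem[OF v sV] and pP = Pk_mem[OF p sP]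
  have "\<forall>\<phi>\<in>Pk k V. lhs1 u v \<phi> = 0" using eq1 by blast
  note vel = velocity_identity[OF u v this]
  \<comment> \<open>Here \<open>C\<close> of the discontinuous Galerkin derivative of
    \<open>u\<close> becomes \<open>C\<close> of \<open>v\<close>, matching the coupling term of the
    second equation tested with \<open>v\<close>.\<close>
  have eq3': "Q (\<lambda>t. c * mp (dt p t) (\<psi> t) - C (v t) (\<psi> t) + B (p t) (\<psi> t)) + c * mp (p a) (\<psi> a) = 0"
    if \<psi>: "\<psi> \<in> Pk k P" for \<psi>
    using eq3[OF \<psi>] vel[OF sP C \<psi>] by (simp add: lhs3_def Q_add Q_diff)
  have Evm: "Q (\<lambda>t. m (dt v t) (v t)) + m (v a) (v a) = (m (v b) (v b) + m (v a) (v a)) / 2"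
    by (rule Q_energy[OF v sV m])
  have Ep: "Q (\<lambda>t. mp (dt p t) (p t)) + mp (p a) (p a) = (mp (p b) (p b) + mp (p a) (p a)) / 2"
    by (rule Q_energy[OF p sP mp])
  \<comment> \<open>By symmetry of \<open>A\<close> and the velocity identity, the left side is the
    discontinuous Galerkin derivative of \<open>u\<close> tested with \<open>u\<close> in
    \<open>A\<close>, so \<open>Q_energy\<close> applies.\<close>
  have EA: "Q (\<lambda>t. A (u t) (v t)) = (A (u b) (u b) + A (u a) (u a)) / 2"
    using Q_energy[OF u sV A] vel[OF sV bil(3) u] Q_cong[of "\<lambda>t. A (u t) (v t)" "\<lambda>t. A (v t) (u t)"]
      sym(2)[OF uV(1) vV(1)] by simp
  \<comment> \<open>Sum of the second equation tested with \<open>v\<close> and the third tested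
    with \<open>p\<close>; the terms \<open>C (v t) (p t)\<close> cancel.\<close>
  have "\<rho> * (Q (\<lambda>t. m (dt v t) (v t)) + m (v a) (v a)) + Q (\<lambda>t. A (u t) (v t))
      + c * (Q (\<lambda>t. mp (dt p t) (p t)) + mp (p a) (p a)) + Q (\<lambda>t. B (p t) (p t)) = 0"
    using eq2[OF v] eq3'[OF p] by (simp add: lhs2_def Q_add Q_diff Q_cmult algebra_simps)
  moreover have "Q (\<lambda>t. B (p t) (p t)) \<ge> 0" using B0 pP by (intro Q_nonneg) auto
  ultimately have "\<rho> * ((m (v b) (v b) + m (v a) (v a)) / 2) + (A (u b) (u b) + A (u a) (u a)) / 2
      + c * ((mp (p b) (p b) + mp (p a) (p a)) / 2) \<le> 0"
    unfolding Evm Ep EA by linarith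
  \<comment> \<open>To be read with \<open>x'\<close> and \<open>y'\<close> as the kinetic and
    pressure contributions of both end points, \<open>x\<close> and \<open>y\<close> as their parts
    from the left end point, and \<open>s'\<close>, \<open>s\<close> as the values of
    \<open>A (u, u)\<close> at \<open>b\<close> and \<open>a\<close>.\<close>
  moreover have "x = 0 \<and> y = 0 \<and> s = 0"
    if "x' + (s' + s) / 2 + y' \<le> 0" "x \<le> x'" "y \<le> y'" "0 \<le> x" "0 \<le> y" "0 \<le> s'" "0 \<le> s" for x x' y y' s s' :: real
  proof -
    have "x \<le> 0" using that by argo
    moreover have "y \<le> 0" using that by argo
    moreover have "s \<le> 0" using that by argo
    ultimately show ?thesis using that by simp
  qed
  moreover have "\<rho> * ((m (v b) (v b) + m (v a) (v a)) / 2) \<ge> \<rho> * (m (v a) (v a) / 2)"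
    "c * ((mp (p b) (p b) + mp (p a) (p a)) / 2) \<ge> c * (mp (p a) (p a) / 2)"
    using \<rho> c nonneg(1)[OF vV(1)] nonneg(3)[OF pP(1)] by (auto intro!: mult_left_mono)
  moreover have "\<rho> * (m (v a) (v a) / 2) \<ge> 0" "c * (mp (p a) (p a) / 2) \<ge> 0" "A (u b) (u b) \<ge> 0" "A (u a) (u a) \<ge> 0"
    using \<rho> c nonneg(1)[OF vV(1)] nonneg(3)[OF pP(1)] nonneg(2)[OF uV(1)] by auto
  ultimately have *: "\<rho> * (m (v a) (v a) / 2) = 0 \<and> c * (mp (p a) (p a) / 2) = 0 \<and> A (u a) (u a) = 0"
    by blast
  then have Aua: "A (u a) (u a) = 0" by simp
  from * have va: "v a = 0" and pa: "p a = 0"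
    using \<rho> c m0[OF vV(1)] mp0[OF pP(1)] by auto
  \<comment> \<open>A null vector of a semidefinite form lies in its kernel, so the initial term of
    the first equation drops out when that equation is read through \<open>A\<close>.\<close>
  have Aua': "A (u a) y = 0" if "y \<in> V" for y using psd_on_null[OF A sV uV(1)[of a] that] Aua by blast
  have m_va: "m (v a) y = 0" if "y \<in> V" for y using lin_on_0[OF bilin_onD1[OF bil(1) that] that sV] va by simp
  have mp_pa: "mp (p a) y = 0" if "y \<in> P" for y using lin_on_0[OF bilin_onD1[OF bil(2) that] that sP] pa by simp

  \<comment> \<open>Only the image of \<open>dt u - v\<close> under \<open>A\<close> is reached
    here: \<open>u a\<close> is merely known to lie in the kernel of \<open>A\<close>, so the first
    equation itself still carries an initial term.\<close>
  have ode1: "A (dt u t) y = A (v t) y" if y: "y \<in> V" for t y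
  proof -
    have "A (dt u (node \<mu>)) y - A (v (node \<mu>)) y = 0" if "\<mu> \<in> {1..k+1}" for \<mu>
    proof (rule Q_test[OF sV _ _ y that, of "\<lambda>t y. A (dt u t) y - A (v t) y"])
      show "lin_on V (\<lambda>y. A (dt u (node \<mu>)) y - A (v (node \<mu>)) y)" for \<mu>
        using uV vV by (intro lin_on_intros bilin_onD2[OF bil(3)])
      show "Q (\<lambda>t. A (dt u t) (\<eta> t) - A (v t) (\<eta> t)) = 0" if "\<eta> \<in> Pk k V" for \<eta>
        using vel[OF sV bil(3) that] Aua' Pk_mem(1)[OF that sV] by (simp add: Q_diff)
    qed
    then have "A (dt u t) y + (- A (v t) y) + 0 + 0 = 0"
      using bilin_onD1[OF bil(3) y]
      by - (rule poly_zero_of_test[OF u v p, of "\<lambda>x. A x y" "\<lambda>x. - A x y" "\<lambda>_. 0" "\<lambda>_. 0", OF _ _ _ _ p]; auto intro!: lin_on_intros)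
    then show ?thesis by simp
  qed
  have ode2: "\<rho> * m (dt v t) y + A (u t) y + C y (p t) = 0" if y: "y \<in> V" for t y
  proof -
    have "\<rho> * m (dt v (node \<mu>)) y + A (u (node \<mu>)) y + C y (p (node \<mu>)) = 0" if "\<mu> \<in> {1..k+1}" for \<mu>
    proof (rule Q_test[OF sV _ _ y that, of "\<lambda>t y. \<rho> * m (dt v t) y + A (u t) y + C y (p t)"])
      show "lin_on V (\<lambda>y. \<rho> * m (dt v (node \<mu>)) y + A (u (node \<mu>)) y + C y (p (node \<mu>)))" for \<mu>
        using uV vV pP by (intro lin_on_intros bilin_onD2[OF bil(3)] bilin_onD2[OF bil(1)] bilin_onD1[OF C])
      show "Q (\<lambda>t. \<rho> * m (dt v t) (\<eta> t) + A (u t) (\<eta> t) + C (\<eta> t) (p t)) = 0" if "\<eta> \<in> Pk k V" for \<eta>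
        using eq2[OF that] m_va[OF Pk_mem(1)[OF that sV]] by (simp add: lhs2_def)
    qed
    then have "\<rho> * m (dt v t) y + A (u t) y + C y (p t) + 0 = 0"
      using bilin_onD1[OF bil(3) y] bilin_onD1[OF bil(1) y] bilin_onD2[OF C y]
      by - (rule poly_zero_of_test[OF v u p, of "\<lambda>x. \<rho> * m x y" "\<lambda>x. A x y" "\<lambda>x. C y x" "\<lambda>_. 0", OF _ _ _ _ p]; auto intro!: lin_on_intros)
    then show ?thesis by simp
  qed
  have ode3: "c * mp (dt p t) y - C (v t) y + B (p t) y = 0" if y: "y \<in> P" for t y
  proof -
    have "c * mp (dt p (node \<mu>)) y - C (v (node \<mu>)) y + B (p (node \<mu>)) y = 0" if "\<mu> \<in> {1..k+1}" for \<mu>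
    proof (rule Q_test[OF sP _ _ y that, of "\<lambda>t y. c * mp (dt p t) y - C (v t) y + B (p t) y"])
      show "lin_on P (\<lambda>y. c * mp (dt p (node \<mu>)) y - C (v (node \<mu>)) y + B (p (node \<mu>)) y)" for \<mu>
        using uV vV pP by (intro lin_on_intros bilin_onD2[OF bil(2)] bilin_onD2[OF C] bilin_onD2[OF B])
      show "Q (\<lambda>t. c * mp (dt p t) (\<eta> t) - C (v t) (\<eta> t) + B (p t) (\<eta> t)) = 0" if "\<eta> \<in> Pk k P" for \<eta>
        using eq3'[OF that] mp_pa[OF Pk_mem(1)[OF that sP]] by simp
    qed
    then have "0 + - C (v t) y + B (p t) y + c * mp (dt p t) y = 0"
      using bilin_onD1[OF bil(2) y] bilin_onD1[OF C y] bilin_onD1[OF B y]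
      by - (rule poly_zero_of_test[OF v v p, of "\<lambda>_. 0" "\<lambda>x. - C x y" "\<lambda>x. B x y" "\<lambda>x. c * mp x y", OF _ _ _ _ p]; auto intro!: lin_on_intros simp: algebra_simps)
    then show ?thesis by simp
  qed

  obtain pm where pm: "\<And>t. m (v t) (v t) = poly pm t" "\<And>t. m (dt v t) (v t) + m (v t) (dt v t) = poly (pderiv pm) t"
    by (rule Pk_bilin[OF v v sV sV bil(1)]) blast
  obtain pp where pp: "\<And>t. mp (p t) (p t) = poly pp t" "\<And>t. mp (dt p t) (p t) + mp (p t) (dt p t) = poly (pderiv pp) t"
    by (rule Pk_bilin[OF p p sP sP bil(2)]) blast
  obtain pA where pA: "\<And>t. A (u t) (u t) = poly pA t" "\<And>t. A (dt u t) (u t) + A (u t) (dt u t) = poly (pderiv pA) t"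
    by (rule Pk_bilin[OF u u sV sV bil(3)]) blast
  \<comment> \<open>The energy as a polynomial in time. Its derivative follows by testing the three
    identities with \<open>u\<close>, \<open>v\<close> and \<open>p\<close> at the same time
    \<open>t\<close>, where the coupling terms cancel again.\<close>
  define E where "E = smult \<rho> pm + smult c pp + pA"
  have E: "poly E t = \<rho> * m (v t) (v t) + c * mp (p t) (p t) + A (u t) (u t)" for t
    by (simp add: E_def pm pp pA)
  have E': "poly (pderiv E) t \<le> 0" for t
  proof -
    have "poly (pderiv E) t = 2 * (\<rho> * m (dt v t) (v t)) + 2 * (c * mp (dt p t) (p t)) + 2 * A (dt u t) (u t)"
      using sym(1)[OF vV(1) vV(2), of t t] sym(2)[OF uV(1) uV(2), of t t] sym(3)[OF pP(1) pP(2), of t t]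
      by (simp add: E_def pderiv_add pderiv_smult pm(2)[symmetric] pp(2)[symmetric] pA(2)[symmetric])
    also have "\<dots> = - 2 * B (p t) (p t)"
      using ode1[OF uV(1), of t t] ode2[OF vV(1), of t t] ode3[OF pP(1), of t t] sym(2)[OF uV(1) vV(1), of t t] by simp
    finally show ?thesis using B0[OF pP(1), of t] by simp
  qed
  have Ea: "poly E a = 0" unfolding E using va pa Aua m_va[OF subspace_0[OF sV]] mp_pa[OF subspace_0[OF sP]] by simp
  \<comment> \<open>Monotonicity yields this only to the right of \<open>a\<close>, which is enough
    for polynomials to vanish identically.\<close>
  have zero: "m (v t) (v t) = 0 \<and> mp (p t) (p t) = 0" if "a \<le> t" for t
  proof -
    have "poly E t \<le> poly E a"
      using that E' by (intro DERIV_nonpos_imp_nonincreasing[of a t "poly E"]) (auto intro!: exI poly_DERIV)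
    moreover have "\<rho> * m (v t) (v t) \<ge> 0" "c * mp (p t) (p t) \<ge> 0" "A (u t) (u t) \<ge> 0"
      using \<rho> c nonneg(1)[OF vV(1)] nonneg(3)[OF pP(1)] nonneg(2)[OF uV(1)] by auto
    ultimately have "\<rho> * m (v t) (v t) + c * mp (p t) (p t) + A (u t) (u t) \<le> 0" using Ea E[of t] by simp
    then have "\<rho> * m (v t) (v t) \<le> 0" "c * mp (p t) (p t) \<le> 0"
      using \<open>\<rho> * m (v t) (v t) \<ge> 0\<close> \<open>c * mp (p t) (p t) \<ge> 0\<close> \<open>A (u t) (u t) \<ge> 0\<close> by simp_all
    with \<open>\<rho> * m (v t) (v t) \<ge> 0\<close> \<open>c * mp (p t) (p t) \<ge> 0\<close>
    have "\<rho> * m (v t) (v t) = 0" "c * mp (p t) (p t) = 0" by simp_all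
    then show ?thesis using \<rho> c by simp
  qed
  have poly0: "q = 0" if "\<And>t. a \<le> t \<Longrightarrow> poly q t = 0" for q :: "real poly"
  proof (rule ccontr)
    assume "q \<noteq> 0"
    then have "finite {t. poly q t = 0}" by (rule poly_roots_finite)
    moreover have "{a..} \<subseteq> {t. poly q t = 0}" using that by auto
    ultimately show False using infinite_Ici finite_subset by blast
  qed
  have "pm = 0" "pp = 0" using zero pm(1) pp(1) by (auto intro!: poly0)
  then have v0: "v t = 0" and p0: "p t = 0" for t
    using m0[OF vV(1)] mp0[OF pP(1)] pm(1) pp(1) by auto
  then show "v = 0" "p = 0" by (auto simp: fun_eq_iff)
  have mv: "m (v t) y = 0" if "y \<in> V" for t y using lin_on_0[OF bilin_onD1[OF bil(1) that] that sV] v0 by simp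
  \<comment> \<open>With \<open>v = 0\<close>, the first equation tested with \<open>u\<close> in
    the inner product makes the squared norms at both end points sum to 0; the energy in
    \<open>A\<close> gave only membership in its kernel.\<close>
  have "Q (\<lambda>t. m (dt u t) (u t)) + m (u a) (u a) = 0"
    using eq1[OF u] uV mv by (simp add: lhs1_def)
  then have "m (u b) (u b) + m (u a) (u a) = 0" using Q_energy[OF u sV m] by simp
  then have ua: "u a = 0"
    using nonneg(1)[OF uV(1), of a] nonneg(1)[OF uV(1), of b] by (intro m0[OF uV(1)]) (simp add: add_nonneg_eq_0_iff)
  have m_ua: "m (u a) y = 0" if "y \<in> V" for y using lin_on_0[OF bilin_onD1[OF bil(1) that] that sV] ua by simp
  have du: "m (dt u t) y = 0" if y: "y \<in> V" for t y
  proof -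
    have "m (dt u (node \<mu>)) y = 0" if "\<mu> \<in> {1..k+1}" for \<mu>
    proof (rule Q_test[OF sV _ _ y that, of "\<lambda>t y. m (dt u t) y"])
      show "lin_on V (m (dt u (node \<mu>)))" for \<mu>
        using uV by (intro bilin_onD2[OF bil(1)])
      show "Q (\<lambda>t. m (dt u t) (\<eta> t)) = 0" if "\<eta> \<in> Pk k V" for \<eta>
        using eq1[OF that] mv m_ua Pk_mem(1)[OF that sV] by (simp add: lhs1_def)
    qed
    then have "m (dt u t) y + 0 + 0 + 0 = 0"
      using bilin_onD1[OF bil(1) y]
      by - (rule poly_zero_of_test[OF u v p, of "\<lambda>x. m x y" "\<lambda>x. 0" "\<lambda>_. 0" "\<lambda>_. 0", OF _ _ _ _ p]; auto intro!: lin_on_intros)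
    then show ?thesis by simp
  qed
  obtain q where q: "\<And>t. m (u t) (u t) = poly q t" "\<And>t. m (dt u t) (u t) + m (u t) (dt u t) = poly (pderiv q) t"
    by (rule Pk_bilin[OF u u sV sV bil(1)]) blast
  \<comment> \<open>A vanishing time derivative makes the squared norm of \<open>u t\<close>
    constant, and it is 0 at \<open>a\<close>.\<close>
  have "poly (pderiv q) t = 0" for t
    using du[OF uV(1)] sym(1)[OF uV(1) uV(2), of t t] by (simp add: q(2)[symmetric])
  then have "pderiv q = 0" by (intro poly0) auto
  then obtain h where "q = [:h:]" using pderiv_iszero by blast
  then have "m (u t) (u t) = m (u a) (u a)" for t by (simp add: q)
  then have "u t = 0" for t using m0[OF uV(1)] m_ua[OF uV(1)] by simp
  then show "u = 0" by (auto simp: fun_eq_iff)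
qed

text \<open>Evaluation at a time and time differentiation of one component are such maps on the
  space of triples; composing forms with them gives bilinearity of the whole system.\<close>

definition lmap_on :: "'s::real_vector set \<Rightarrow> 'r::real_vector set \<Rightarrow> ('s \<Rightarrow> 'r) \<Rightarrow> bool" where
  "lmap_on W X f \<longleftrightarrow> (\<forall>x\<in>W. f x \<in> X) \<and> (\<forall>x\<in>W. \<forall>y\<in>W. \<forall>r s. f (r *\<^sub>R x + s *\<^sub>R y) = r *\<^sub>R f x + s *\<^sub>R f y)"

lemma bilin_on_comp:
  "bilin_on X Y \<beta> \<Longrightarrow> lmap_on W X f \<Longrightarrow> lmap_on W' Y g \<Longrightarrow> bilin_on W W' (\<lambda>w z. \<beta> (f w) (g z))"
  by (simp add: bilin_on_def lmap_on_def lin_on_def)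

lemma lin_on_comp: "lin_on X L \<Longrightarrow> lmap_on W X f \<Longrightarrow> lin_on W (\<lambda>w. L (f w))"
  by (simp add: lmap_on_def lin_on_def)

lemma bilin_on_Q:
  "(\<And>\<mu>. \<mu> \<in> {1..k+1} \<Longrightarrow> bilin_on W W' (f (node \<mu>))) \<Longrightarrow> bilin_on W W' (\<lambda>w z. Q (\<lambda>t. f t w z))"
  unfolding Qn_def by (intro bilin_on_intros) auto

text \<open>The equations are added to a single one on the space of triples. As the test functions
  vary independently, setting two of them to 0 recovers each equation, and
  \<open>homogeneous\<close> becomes the nondegeneracy asked for in
  \<open>bilin_solve\<close>.\<close>

theorem unique_solvability:
  assumes F: "\<And>\<mu>. \<mu> \<in> {1..k+1} \<Longrightarrow> lin_on V (F (node \<mu>))"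
    and G: "\<And>\<mu>. \<mu> \<in> {1..k+1} \<Longrightarrow> lin_on P (G (node \<mu>))"
    and L: "lin_on V L1" "lin_on V L2" "lin_on P L3"
  shows "\<exists>!(u, v, p). (u, v, p) \<in> Pk k V \<times> Pk k V \<times> Pk k P \<and>
    (\<forall>(\<phi>, \<eta>, \<psi>) \<in> Pk k V \<times> Pk k V \<times> Pk k P.
      lhs1 u v \<phi> = L1 (\<phi> a) \<and> lhs2 u v p \<eta> = Q (\<lambda>t. F t (\<eta> t)) + L2 (\<eta> a) \<and>
      lhs3 u p \<psi> = Q (\<lambda>t. G t (\<psi> t)) + L3 (\<psi> a))"
proof -
  define W where "W = Pk k V \<times> Pk k V \<times> Pk k P"
  define \<beta> where "\<beta> w z = lhs1 (fst w) (fst (snd w)) (fst z) + lhs2 (fst w) (fst (snd w)) (snd (snd w)) (fst (snd z))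
    + lhs3 (fst w) (snd (snd w)) (snd (snd z))" for w z :: "(real \<Rightarrow> 'x \<Rightarrow> 'v) \<times> (real \<Rightarrow> 'x \<Rightarrow> 'v) \<times> (real \<Rightarrow> 'y \<Rightarrow> 'p)"
  define L where "L z = L1 (fst z a) + (Q (\<lambda>t. F t (fst (snd z) t)) + L2 (fst (snd z) a))
    + (Q (\<lambda>t. G t (snd (snd z) t)) + L3 (snd (snd z) a))" for z :: "(real \<Rightarrow> 'x \<Rightarrow> 'v) \<times> (real \<Rightarrow> 'x \<Rightarrow> 'v) \<times> (real \<Rightarrow> 'y \<Rightarrow> 'p)"
  have W: "findim W" unfolding W_def by (intro findim_Times findim_Pk V P)
  have 0: "0 \<in> Pk k V" "0 \<in> Pk k P" using Pk_0 sV sP by auto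
  have lmaps: "lmap_on W V (\<lambda>w. fst w t)" "lmap_on W V (\<lambda>w. dt (fst w) t)" "lmap_on W V (\<lambda>w. fst (snd w) t)"
    "lmap_on W V (\<lambda>w. dt (fst (snd w)) t)" "lmap_on W P (\<lambda>w. snd (snd w) t)" "lmap_on W P (\<lambda>w. dt (snd (snd w)) t)" for t
    using Pk_mem[OF _ sV, of _ k t] Pk_mem[OF _ sP, of _ k t] Pk_lincomb(2)[OF _ _ sV] Pk_lincomb(2)[OF _ _ sP]
    by (auto simp: lmap_on_def W_def)
  have C': "bilin_on P V (\<lambda>q v. C v q)" using C by (auto simp: bilin_on_def)
  have bW: "bilin_on W W \<beta>"
    unfolding \<beta>_def lhs1_def lhs2_def lhs3_def
    by (intro bilin_on_intros bilin_on_Q bilin_on_comp[OF bil(1)] bilin_on_comp[OF bil(2)] bilin_on_comp[OF bil(3)]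
        bilin_on_comp[OF C] bilin_on_comp[OF C'] bilin_on_comp[OF B] lmaps)
  have LW: "lin_on W L"
    unfolding L_def by (intro lin_on_intros lin_on_Q lin_on_comp[OF F] lin_on_comp[OF G] lin_on_comp[OF L(1)]
        lin_on_comp[OF L(2)] lin_on_comp[OF L(3)] lmaps)
  have lz: "lhs1 u v 0 = 0" "lhs2 u v p 0 = 0" "lhs3 u p 0 = 0"
    if "u \<in> Pk k V" "v \<in> Pk k V" "p \<in> Pk k P" for u v p
  proof -
    have z: "\<beta> x 0 = 0" if "lin_on X (\<beta> x)" "subspace X" for x X and \<beta> :: "'r \<Rightarrow> 's::real_vector \<Rightarrow> real"
      using lin_on_0[OF that(1) subspace_0[OF that(2)] that(2)] .
    note u = Pk_mem[OF that(1) sV] and v = Pk_mem[OF that(2) sV] and p = Pk_mem[OF that(3) sP]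
    note zs = z[OF bilin_onD2[OF bil(1)] sV] z[OF bilin_onD2[OF bil(2)] sP] z[OF bilin_onD2[OF bil(3)] sV]
      z[OF bilin_onD2[OF C] sP] z[OF bilin_onD2[OF C'] sV] z[OF bilin_onD2[OF B] sP]
    show "lhs1 u v 0 = 0" "lhs2 u v p 0 = 0" "lhs3 u p 0 = 0"
      using u v p by (simp_all add: lhs1_def lhs2_def lhs3_def zs Qn_def)
  qed
  have Lz: "Q (\<lambda>t. F t 0) = 0" "Q (\<lambda>t. G t 0) = 0" "L1 0 = 0" "L2 0 = 0" "L3 0 = 0"
    using lin_on_0[OF F subspace_0[OF sV] sV] lin_on_0[OF G subspace_0[OF sP] sP]
      lin_on_0[OF L(1) subspace_0[OF sV] sV] lin_on_0[OF L(2) subspace_0[OF sV] sV] lin_on_0[OF L(3) subspace_0[OF sP] sP]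
    by (auto simp: Qn_def)
  have nondeg: "w = 0" if w: "w \<in> W" "\<And>z. z \<in> W \<Longrightarrow> \<beta> w z = 0" for w
  proof -
    obtain u v p where uvp: "w = (u, v, p)" "u \<in> Pk k V" "v \<in> Pk k V" "p \<in> Pk k P" using w(1) by (auto simp: W_def)
    have "lhs1 u v \<phi> = 0" if "\<phi> \<in> Pk k V" for \<phi>
      using w(2)[of "(\<phi>, 0, 0)"] that 0 lz[OF uvp(2-4)] by (simp add: W_def \<beta>_def uvp(1))
    moreover have "lhs2 u v p \<eta> = 0" if "\<eta> \<in> Pk k V" for \<eta>
      using w(2)[of "(0, \<eta>, 0)"] that 0 lz[OF uvp(2-4)] by (simp add: W_def \<beta>_def uvp(1))
    moreover have "lhs3 u p \<psi> = 0" if "\<psi> \<in> Pk k P" for \<psi>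
      using w(2)[of "(0, 0, \<psi>)"] that 0 lz[OF uvp(2-4)] by (simp add: W_def \<beta>_def uvp(1))
    ultimately show ?thesis using homogeneous[OF uvp(2-4)] by (simp add: uvp(1) zero_prod_def)
  qed
  have split: "(\<forall>z\<in>W. \<beta> (u, v, p) z = L z) \<longleftrightarrow> (\<forall>(\<phi>, \<eta>, \<psi>) \<in> Pk k V \<times> Pk k V \<times> Pk k P.
      lhs1 u v \<phi> = L1 (\<phi> a) \<and> lhs2 u v p \<eta> = Q (\<lambda>t. F t (\<eta> t)) + L2 (\<eta> a) \<and>
      lhs3 u p \<psi> = Q (\<lambda>t. G t (\<psi> t)) + L3 (\<psi> a))" (is "?l \<longleftrightarrow> ?r")
    if uvp: "u \<in> Pk k V" "v \<in> Pk k V" "p \<in> Pk k P" for u v p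
  proof
    assume l: ?l
    show ?r
    proof (clarify, intro conjI)
      fix \<phi> \<eta> \<psi> assume "\<phi> \<in> Pk k V" "\<eta> \<in> Pk k V" "\<psi> \<in> Pk k P"
      then have "(\<phi>, 0, 0) \<in> W" "(0, \<eta>, 0) \<in> W" "(0, 0, \<psi>) \<in> W" using 0 by (auto simp: W_def)
      from this[THEN l[rule_format]]
      show "lhs1 u v \<phi> = L1 (\<phi> a)" "lhs2 u v p \<eta> = Q (\<lambda>t. F t (\<eta> t)) + L2 (\<eta> a)"
        "lhs3 u p \<psi> = Q (\<lambda>t. G t (\<psi> t)) + L3 (\<psi> a)"
        using lz[OF uvp] Lz by (auto simp: \<beta>_def L_def)
    qed
  next
    assume r: ?r
    show ?l
    proof
      fix z assume "z \<in> W"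
      then obtain \<phi> \<eta> \<psi> where "z = (\<phi>, \<eta>, \<psi>)" "\<phi> \<in> Pk k V" "\<eta> \<in> Pk k V" "\<psi> \<in> Pk k P" by (auto simp: W_def)
      moreover have "lhs1 u v \<phi> = L1 (\<phi> a)" "lhs2 u v p \<eta> = Q (\<lambda>t. F t (\<eta> t)) + L2 (\<eta> a)"
        "lhs3 u p \<psi> = Q (\<lambda>t. G t (\<psi> t)) + L3 (\<psi> a)"
        using r calculation(2-4) by auto
      ultimately show "\<beta> (u, v, p) z = L z" by (simp add: \<beta>_def L_def)
    qed
  qed
  obtain w where "w \<in> W \<and> (\<forall>z\<in>W. \<beta> w z = L z)" and
    w3: "\<forall>w'. w' \<in> W \<and> (\<forall>z\<in>W. \<beta> w' z = L z) \<longrightarrow> w' = w"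
    using bilin_solve[OF W bW LW nondeg] by (rule ex1E)
  then have w: "w \<in> W" "\<forall>z\<in>W. \<beta> w z = L z" by auto
  obtain u v p where uvp: "w = (u, v, p)" "u \<in> Pk k V" "v \<in> Pk k V" "p \<in> Pk k P" using w(1) by (auto simp: W_def)
  show ?thesis
  proof (rule ex1I[of _ w], goal_cases)
    case 1
    then show ?case using w(1,2) split[OF uvp(2-4)] by (simp add: uvp(1) W_def)
  next
    case (2 w')
    obtain u' v' p' where w': "w' = (u', v', p')" by (cases w') auto
    show ?case using 2 w3[rule_format, of w'] split[of u' v' p'] unfolding w' by (simp add: W_def)
  qed
qed

end


section \<open>Surface measure and normals\<close>

lemma sets_surf [simp, measurable_cong]: "sets (surf :: (real^'n) measure) = sets borel"
  and space_surf [simp]: "space (surf :: (real^'n) measure) = UNIV"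
  by (simp_all add: surf_def hausdorff_def sets_measure_of_conv space_measure_of_conv sets.sigma_sets_eq[of borel, simplified])

text \<open>The finite cover is padded with empty sets, which contribute 0 because
  \<open>m \<ge> 1\<close>.\<close>

lemma hausdorff_pre_finite_cover:
  assumes m: "m \<ge> 1" and \<delta>: "\<delta> > 0" and I: "finite I"
    and D: "A \<subseteq> (\<Union>c\<in>I. D c)" "\<And>c. c \<in> I \<Longrightarrow> bounded (D c)" "\<And>c. c \<in> I \<Longrightarrow> diameter (D c) \<le> \<delta>"
  shows "hausdorff_pre m \<delta> A \<le> (\<Sum>c\<in>I. ennreal (unit_ball_vol (real m) * (diameter (D c) / 2) ^ m))"
proof -
  let ?v = "\<lambda>C. ennreal (unit_ball_vol (real m) * (diameter C / 2) ^ m)"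
  obtain e where e: "bij_betw e {..<card I} I" using ex_bij_betw_nat_finite[OF I] unfolding atLeast0LessThan by blast
  define C where "C i = (if i < card I then D (e i) else {})" for i
  have "A \<subseteq> (\<Union>i. C i)"
  proof
    fix x assume "x \<in> A"
    then obtain c where c: "c \<in> I" "x \<in> D c" using D(1) by blast
    then obtain i where "i < card I" "e i = c" using bij_betw_imp_surj_on[OF e] by (metis imageE lessThan_iff)
    then have "x \<in> C i" using c by (simp add: C_def)
    then show "x \<in> (\<Union>i. C i)" by blast
  qed
  moreover have "bounded (C i) \<and> diameter (C i) \<le> \<delta>" for i
    using D(2,3) e \<delta> by (auto simp: C_def bij_betw_def)
  ultimately have "hausdorff_pre m \<delta> A \<le> (\<Sum>i. ?v (C i))"
    unfolding hausdorff_pre_def by (intro INF_lower) auto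
  also have "\<dots> = (\<Sum>i<card I. ?v (C i))"
    using m by (intro suminf_finite) (auto simp: C_def)
  also have "\<dots> = (\<Sum>i<card I. ?v (D (e i)))" by (intro sum.cong) (auto simp: C_def)
  also have "\<dots> = (\<Sum>c\<in>I. ?v (D c))" by (rule sum.reindex_bij_betw[OF e])
  finally show ?thesis .
qed

text \<open>Cutting the facet into \<open>N ^ m\<close> cubes of side \<open>1 / N\<close>, the
  Lipschitz map produces pieces of diameter at most \<open>L * CARD('n) / N\<close>. The powers of
  \<open>N\<close> cancel in the sum, so the bound \<open>b\<close> does not depend on
  \<delta>.\<close>

lemma hausdorff_outer_facet_image:
  fixes g :: "real^'n \<Rightarrow> real^'n"
  assumes n: "CARD('n) \<ge> 2" and L: "L-lipschitz_on (cbox 0 1) g" and s: "s \<in> {0, 1}"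
  shows "hausdorff_outer (CARD('n) - 1) (g ` {x. x$i = s \<and> (\<forall>j. j \<noteq> i \<longrightarrow> 0 < x$j \<and> x$j < 1)}) < \<infinity>"
proof -
  define m where "m = CARD('n) - 1"
  define E where "E = {x :: real^'n. x$i = s \<and> (\<forall>j. j \<noteq> i \<longrightarrow> 0 < x$j \<and> x$j < 1)}"
  have m: "m \<ge> 1" using n by (simp add: m_def)
  have L0: "L \<ge> 0" using L by (rule lipschitz_on_nonneg)
  have EC: "E \<subseteq> cbox 0 1" using s by (auto simp: E_def mem_box_cart less_imp_le) (metis order_less_imp_le zero_le_one order_refl)+
  define b where "b = unit_ball_vol (real m) * (L * CARD('n) / 2) ^ m"
  have "hausdorff_pre m \<delta> (g ` E) \<le> ennreal b" if \<delta>: "\<delta> > 0" for \<delta>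
  proof -
    obtain N :: nat where N: "N > 0" "L * CARD('n) / N \<le> \<delta>"
    proof -
      obtain N :: nat where "L * CARD('n) / \<delta> < N" using reals_Archimedean2 by blast
      then have "L * CARD('n) / real (Suc N) \<le> \<delta>" using \<delta> by (simp add: field_simps)
      then show ?thesis using that[of "Suc N"] by simp
    qed
    define I where "I = (\<Pi>\<^sub>E j\<in>(UNIV :: 'n set). if j = i then {0} else {..<N})"
    define D where "D c = g ` {x \<in> cbox 0 1. x$i = s \<and> (\<forall>j. j \<noteq> i \<longrightarrow> real (c j) / N \<le> x$j \<and> x$j \<le> (real (c j) + 1) / N)}"
      for c :: "'n \<Rightarrow> nat"
    have fI: "finite I" unfolding I_def by (intro finite_PiE) auto
    have "card I = (\<Prod>j\<in>(UNIV :: 'n set). card (if j = i then {0} else {..<N}))"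
      unfolding I_def by (rule card_PiE) auto
    also have "\<dots> = (\<Prod>j\<in>UNIV - {i}. N)"
      by (subst prod.remove[of UNIV i]) (auto intro!: prod.cong)
    finally have cI: "card I = N ^ m" by (simp add: m_def)
    have dist: "dist x y \<le> L * CARD('n) / N" if "x \<in> D c" "y \<in> D c" for x y c
    proof -
      obtain x' y' where xy: "x = g x'" "y = g y'" "x' \<in> cbox 0 1" "y' \<in> cbox 0 1"
        and x': "x'$i = s" "\<And>j. j \<noteq> i \<Longrightarrow> real (c j) / N \<le> x'$j \<and> x'$j \<le> (real (c j) + 1) / N"
        and y': "y'$i = s" "\<And>j. j \<noteq> i \<Longrightarrow> real (c j) / N \<le> y'$j \<and> y'$j \<le> (real (c j) + 1) / N"
        using \<open>x \<in> D c\<close> \<open>y \<in> D c\<close> unfolding D_def by blast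
      have "\<bar>(x' - y') $ j\<bar> \<le> 1 / N" for j
        using x'(1) y'(1) x'(2)[of j] y'(2)[of j] by (cases "j = i") (auto simp: abs_le_iff add_divide_distrib)
      then have "(\<Sum>j\<in>UNIV. \<bar>(x' - y') $ j\<bar>) \<le> (\<Sum>j\<in>(UNIV :: 'n set). 1 / N)" by (intro sum_mono)
      then have "dist x' y' \<le> CARD('n) / N"
        using norm_le_l1_cart[of "x' - y'"] by (simp add: dist_norm)
      then have "L * dist x' y' \<le> L * (CARD('n) / N)" using L0 by (intro mult_left_mono)
      then show ?thesis using lipschitz_onD[OF L xy(3,4)] by (simp add: xy)
    qed
    have bdd: "bounded (D c)" for c
    proof (cases "D c = {}")
      case False
      then obtain x where "x \<in> D c" by blast
      then show ?thesis using dist unfolding bounded_def by blast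
    qed simp
    have diam: "diameter (D c) \<le> L * CARD('n) / N" for c
      using dist L0 by (intro diameter_le) (auto simp: dist_norm)
    have cover: "g ` E \<subseteq> (\<Union>c\<in>I. D c)"
    proof
      fix y assume "y \<in> g ` E"
      then obtain x where x: "x \<in> E" "y = g x" by blast
      define c where "c j = (if j = i then 0 else nat \<lfloor>N * x$j\<rfloor>)" for j
      have xj: "0 < x$j" "x$j < 1" if "j \<noteq> i" for j using x that by (auto simp: E_def)
      have cj: "real (c j) \<le> N * x$j" "N * x$j < real (c j) + 1" if "j \<noteq> i" for j
        using xj[OF that] N(1) that by (simp_all add: c_def)
      have "c j < N" if "j \<noteq> i" for j
      proof -
        have "real N * x$j < real N * 1" using xj[OF that] N(1) by (intro mult_strict_left_mono) auto
        then have "real (c j) < real N" using cj(1)[OF that] by simp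
        then show ?thesis by simp
      qed
      then have "c \<in> I" by (auto simp: I_def c_def)
      moreover have "y \<in> D c"
        unfolding D_def x(2) using x(1) EC cj N(1) by (auto simp: E_def field_simps intro!: imageI intro: less_imp_le)
      ultimately show "y \<in> (\<Union>c\<in>I. D c)" by blast
    qed
    have "hausdorff_pre m \<delta> (g ` E) \<le> (\<Sum>c\<in>I. ennreal (unit_ball_vol (real m) * (diameter (D c) / 2) ^ m))"
      using diam N(2) by (intro hausdorff_pre_finite_cover[OF m \<delta> fI cover bdd]) (auto intro: order_trans)
    also have "\<dots> \<le> (\<Sum>c\<in>I. ennreal (unit_ball_vol (real m) * (L * CARD('n) / N / 2) ^ m))"
      using diam diameter_ge_0[OF bdd]
      by (intro sum_mono ennreal_leI mult_left_mono power_mono divide_right_mono) auto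
    also have "\<dots> = ennreal (real (N ^ m) * (unit_ball_vol (real m) * (L * CARD('n) / N / 2) ^ m))"
      using L0 by (simp add: cI ennreal_mult'' ennreal_of_nat_eq_real_of_nat)
    also have "real (N ^ m) * (unit_ball_vol (real m) * (L * CARD('n) / N / 2) ^ m) = b"
      using N(1) by (simp add: b_def power_divide power_mult_distrib)
    finally show ?thesis .
  qed
  then have "hausdorff_outer m (g ` E) \<le> ennreal b" unfolding hausdorff_outer_def by (intro SUP_least) auto
  also have "\<dots> < \<infinity>" by simp
  finally show ?thesis by (simp add: m_def E_def)
qed

text \<open>Along the difference \<open>\<nu> - \<nu>'\<close> the first normal places nearby points
  outside \<open>S\<close> and the second places them inside.\<close>

lemma is_outer_normal_unique:
  assumes "is_outer_normal S x \<nu>" "is_outer_normal S x \<nu>'"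
  shows "\<nu> = \<nu>'"
proof (rule ccontr)
  assume ne: "\<nu> \<noteq> \<nu>'"
  have n: "norm \<nu> = 1" "norm \<nu>' = 1" using assms by (auto simp: is_outer_normal_def)
  then have n': "\<nu> \<bullet> \<nu> = 1" "\<nu>' \<bullet> \<nu>' = 1" by (simp_all add: norm_eq_1)
  define w where "w = \<nu> - \<nu>'"
  have w: "norm w > 0" using ne by (simp add: w_def)
  have "norm w ^ 2 = 2 * (w \<bullet> \<nu>)" "w \<bullet> \<nu>' = - (w \<bullet> \<nu>)"
    using n' by (simp_all add: w_def power2_norm_eq_inner inner_diff inner_commute)
  \<comment> \<open>For unit vectors, \<open>norm w / 2\<close> is the cone parameter at which the
    direction \<open>w\<close> meets both cone conditions, with equality.\<close>
  then have wn: "w \<bullet> \<nu> = norm w / 2 * norm w" "w \<bullet> \<nu>' = - (norm w / 2) * norm w" by (auto simp: power2_eq_square)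
  have e: "norm w / 2 > 0" using w by simp
  obtain \<delta> where \<delta>: "\<delta> > 0" "\<And>y. y \<in> ball x \<delta> - {x} \<Longrightarrow> (y - x) \<bullet> \<nu> \<ge> norm w / 2 * norm (y - x) \<Longrightarrow> y \<notin> S"
    using assms(1) e unfolding is_outer_normal_def by blast
  obtain \<delta>' where \<delta>': "\<delta>' > 0" "\<And>y. y \<in> ball x \<delta>' - {x} \<Longrightarrow> (y - x) \<bullet> \<nu>' \<le> - (norm w / 2) * norm (y - x) \<Longrightarrow> y \<in> S"
    using assms(2) e unfolding is_outer_normal_def by blast
  define s where "s = min \<delta> \<delta>' / (2 * norm w)"
  have s: "s > 0" using \<delta>(1) \<delta>'(1) w by (simp add: s_def)
  have "norm (s *\<^sub>R w) = min \<delta> \<delta>' / 2" using \<delta>(1) \<delta>'(1) w by (simp add: s_def)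
  then have "x + s *\<^sub>R w \<in> ball x \<delta> - {x}" "x + s *\<^sub>R w \<in> ball x \<delta>' - {x}"
    using \<delta>(1) \<delta>'(1) s w by (auto simp: dist_norm)
  with \<delta>(2)[of "x + s *\<^sub>R w"] \<delta>'(2)[of "x + s *\<^sub>R w"] s show False
    by (simp add: wn)
qed

text \<open>With strict cone inequalities the condition is closed in point and direction jointly, for an arbitrary set.
  By compactness of the sphere, this makes the normal field Borel measurable without any regularity of the set.\<close>

lemma closed_cone_condition:
  fixes S :: "(real^'n) set"
  shows "closed {(x, \<nu>). \<forall>y. 0 < dist x y \<and> dist x y < \<delta> \<longrightarrow>
    ((y - x) \<bullet> \<nu> > \<epsilon> * norm (y - x) \<longrightarrow> y \<notin> S) \<and> ((y - x) \<bullet> \<nu> < - \<epsilon> * norm (y - x) \<longrightarrow> y \<in> S)}"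
    (is "closed ?G")
proof -
  define U where "U y = {p :: (real^'n) \<times> (real^'n). 0 < dist (fst p) y \<and> dist (fst p) y < \<delta> \<and>
      \<epsilon> * norm (y - fst p) < (y - fst p) \<bullet> snd p}" for y
  define W where "W y = {p :: (real^'n) \<times> (real^'n). 0 < dist (fst p) y \<and> dist (fst p) y < \<delta> \<and>
      (y - fst p) \<bullet> snd p < - \<epsilon> * norm (y - fst p)}" for y
  have "open (U y)" "open (W y)" for y
    unfolding U_def W_def by (intro open_Collect_conj open_Collect_less continuous_intros)+
  then have "open ((\<Union>y\<in>S. U y) \<union> (\<Union>y\<in>-S. W y))" by blast
  moreover have "?G = - ((\<Union>y\<in>S. U y) \<union> (\<Union>y\<in>-S. W y))" by (auto simp: U_def W_def)
  ultimately show ?thesis by (simp add: closed_def)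
qed

lemma outer_normal_measurable [measurable]:
  fixes S :: "(real^'n) set"
  shows "outer_normal S \<in> borel_measurable borel"
proof -
  define G where "G \<epsilon> \<delta> = {(x, \<nu>). \<forall>y. 0 < dist x y \<and> dist x y < \<delta> \<longrightarrow>
    ((y - x) \<bullet> \<nu> > \<epsilon> * norm (y - x) \<longrightarrow> y \<notin> S) \<and> ((y - x) \<bullet> \<nu> < - \<epsilon> * norm (y - x) \<longrightarrow> y \<in> S)}" for \<epsilon> \<delta> :: real
  have G_mono: "(x, \<nu>) \<in> G \<epsilon>' \<delta>'" if "(x, \<nu>) \<in> G \<epsilon> \<delta>" "\<epsilon> \<le> \<epsilon>'" "\<delta>' \<le> \<delta>" for x \<nu> \<epsilon> \<epsilon>' \<delta> \<delta>'
  proof -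
    have "\<epsilon> * norm (y - x) \<le> \<epsilon>' * norm (y - x)" for y using that(2) by (intro mult_right_mono) auto
    then have *: "(y - x) \<bullet> \<nu> > \<epsilon>' * norm (y - x) \<Longrightarrow> (y - x) \<bullet> \<nu> > \<epsilon> * norm (y - x)"
      "(y - x) \<bullet> \<nu> < - \<epsilon>' * norm (y - x) \<Longrightarrow> (y - x) \<bullet> \<nu> < - \<epsilon> * norm (y - x)" for y
      unfolding mult_minus_left by (smt (verit))+
    show ?thesis
      using that(1,3) * unfolding G_def mem_Collect_eq prod.case by (meson order_less_le_trans)
  qed
  \<comment> \<open>The points with a normal in \<open>T\<close>, with \<epsilon> and \<delta>
    running through reciprocals of positive integers. Each set in the union is the projection of a
    closed set along a compact factor when \<open>T\<close> is closed.\<close>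
  define A where "A T = (\<Inter>m. \<Union>l. fst ` (G (inverse (real (Suc m))) (inverse (real (Suc l))) \<inter> (UNIV \<times> (T \<inter> sphere 0 1))))"
    for T :: "(real^'n) set"
  have A_iff: "(\<exists>\<nu>\<in>T. is_outer_normal S x \<nu>) \<longleftrightarrow> x \<in> A T" if T: "closed T" for T x
  proof
    assume "\<exists>\<nu>\<in>T. is_outer_normal S x \<nu>"
    then obtain \<nu> where \<nu>: "\<nu> \<in> T" "is_outer_normal S x \<nu>" by blast
    show "x \<in> A T" unfolding A_def
    proof
      fix m :: nat
      obtain \<delta> where \<delta>: "\<delta> > 0" "\<And>y. y \<in> ball x \<delta> - {x} \<Longrightarrow>
          ((y - x) \<bullet> \<nu> \<ge> inverse (real (Suc m)) * norm (y - x) \<longrightarrow> y \<notin> S) \<and>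
          ((y - x) \<bullet> \<nu> \<le> - inverse (real (Suc m)) * norm (y - x) \<longrightarrow> y \<in> S)"
        using \<nu>(2) unfolding is_outer_normal_def by (metis inverse_positive_iff_positive of_nat_0_less_iff zero_less_Suc)
      obtain l where l: "inverse (real (Suc l)) < \<delta>" using reals_Archimedean[OF \<delta>(1)] by blast
      have "(x, \<nu>) \<in> G (inverse (real (Suc m))) (inverse (real (Suc l)))"
        using \<delta>(2) l unfolding G_def by (auto simp: less_imp_le)
      moreover have "\<nu> \<in> sphere 0 1" using \<nu>(2) by (simp add: is_outer_normal_def)
      ultimately show "x \<in> (\<Union>l. fst ` (G (inverse (real (Suc m))) (inverse (real (Suc l))) \<inter> (UNIV \<times> (T \<inter> sphere 0 1))))"
        using \<nu>(1) by force
    qed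
  next
    assume "x \<in> A T"
    then have "\<forall>m. \<exists>l \<nu>. \<nu> \<in> T \<inter> sphere 0 1 \<and> (x, \<nu>) \<in> G (inverse (real (Suc m))) (inverse (real (Suc l)))"
      unfolding A_def by force
    then obtain l \<nu> where ln: "\<And>m. \<nu> m \<in> T \<inter> sphere 0 1"
      "\<And>m. (x, \<nu> m) \<in> G (inverse (real (Suc m))) (inverse (real (Suc (l m))))" by metis
    have "compact (T \<inter> sphere 0 1)" using T by (intro closed_Int_compact compact_sphere)
    then obtain \<nu>0 \<sigma> where \<nu>0: "\<nu>0 \<in> T \<inter> sphere 0 1" "strict_mono (\<sigma> :: nat \<Rightarrow> nat)" "(\<nu> \<circ> \<sigma>) \<longlonglongrightarrow> \<nu>0"
      using ln(1) unfolding compact_def by metis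
    have "is_outer_normal S x \<nu>0" unfolding is_outer_normal_def
    proof (intro conjI allI impI)
      show "norm \<nu>0 = 1" using \<nu>0(1) by simp
      fix \<epsilon> :: real assume \<epsilon>: "\<epsilon> > 0"
      \<comment> \<open>One third of \<epsilon> is spent on the cone condition at
        \<open>\<nu> (\<sigma> j)\<close> and one third on its distance to the limit; the rest
        provides the strict inequalities in \<open>G\<close>.\<close>
      have "\<forall>\<^sub>F j in sequentially. dist ((\<nu> \<circ> \<sigma>) j) \<nu>0 < \<epsilon> / 3" using tendstoD[OF \<nu>0(3), of "\<epsilon> / 3"] \<epsilon> by simp
      moreover have "\<forall>\<^sub>F j in sequentially. inverse (real (Suc j)) < \<epsilon> / 3"
        using order_tendstoD(2)[OF LIMSEQ_inverse_real_of_nat, of "\<epsilon> / 3"] \<epsilon> by simp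
      ultimately have "\<forall>\<^sub>F j in sequentially. dist ((\<nu> \<circ> \<sigma>) j) \<nu>0 < \<epsilon> / 3 \<and> inverse (real (Suc j)) < \<epsilon> / 3"
        by (rule eventually_conj)
      from eventually_happens'[OF sequentially_bot this]
      obtain j where j: "dist (\<nu> (\<sigma> j)) \<nu>0 < \<epsilon> / 3" "inverse (real (Suc j)) < \<epsilon> / 3" by auto
      have "j \<le> \<sigma> j" using \<nu>0(2) by (rule seq_suble)
      then have "inverse (real (Suc (\<sigma> j))) \<le> inverse (real (Suc j))" by (simp add: field_simps)
      from order.trans[OF this less_imp_le[OF j(2)]] have "inverse (real (Suc (\<sigma> j))) \<le> \<epsilon> / 3" .
      then have G: "(x, \<nu> (\<sigma> j)) \<in> G (\<epsilon> / 3) (inverse (real (Suc (l (\<sigma> j)))))"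
        by (intro G_mono[OF ln(2)[of "\<sigma> j"]]) auto
      let ?\<delta> = "inverse (real (Suc (l (\<sigma> j))))"
      have "((y - x) \<bullet> \<nu>0 \<ge> \<epsilon> * norm (y - x) \<longrightarrow> y \<notin> S) \<and> ((y - x) \<bullet> \<nu>0 \<le> - \<epsilon> * norm (y - x) \<longrightarrow> y \<in> S)"
        if y: "y \<in> ball x ?\<delta> - {x}" for y
      proof -
        have n: "norm (y - x) > 0" using y by auto
        have "\<bar>(y - x) \<bullet> (\<nu> (\<sigma> j) - \<nu>0)\<bar> \<le> norm (y - x) * norm (\<nu> (\<sigma> j) - \<nu>0)" by (rule Cauchy_Schwarz_ineq2)
        also have "\<dots> < norm (y - x) * (\<epsilon> / 3)" using j(1) n by (simp add: dist_norm)
        finally have d: "\<bar>(y - x) \<bullet> \<nu> (\<sigma> j) - (y - x) \<bullet> \<nu>0\<bar> < (\<epsilon> / 3) * norm (y - x)" by (simp add: inner_diff_right mult.commute)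
        have p: "\<epsilon> / 3 * norm (y - x) > 0" using n \<epsilon> by simp
        define q where "q = \<epsilon> / 3 * norm (y - x)"
        have q: "\<epsilon> * norm (y - x) = 3 * q" "- \<epsilon> * norm (y - x) = - 3 * q" by (simp_all add: q_def)
        have g: "((y - x) \<bullet> \<nu> (\<sigma> j) > \<epsilon> / 3 * norm (y - x) \<longrightarrow> y \<notin> S)"
          "((y - x) \<bullet> \<nu> (\<sigma> j) < - (\<epsilon> / 3 * norm (y - x)) \<longrightarrow> y \<in> S)"
          using G y unfolding G_def by auto
        show ?thesis
          unfolding q
        proof (intro conjI impI)
          assume "3 * q \<le> (y - x) \<bullet> \<nu>0"
          then have "(y - x) \<bullet> \<nu> (\<sigma> j) > q" using d p unfolding q_def[symmetric] abs_less_iff by linarith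
          then show "y \<notin> S" using g(1) unfolding q_def by blast
        next
          assume "(y - x) \<bullet> \<nu>0 \<le> - 3 * q"
          then have "(y - x) \<bullet> \<nu> (\<sigma> j) < - q" using d p unfolding q_def[symmetric] abs_less_iff by linarith
          then show "y \<in> S" using g(2) unfolding q_def by blast
        qed
      qed
      then show "\<exists>\<delta>>0. \<forall>y\<in>ball x \<delta> - {x}. ((y - x) \<bullet> \<nu>0 \<ge> \<epsilon> * norm (y - x) \<longrightarrow> y \<notin> S) \<and>
          ((y - x) \<bullet> \<nu>0 \<le> - \<epsilon> * norm (y - x) \<longrightarrow> y \<in> S)"
        by (intro exI[of _ ?\<delta>]) auto
    qed
    then show "\<exists>\<nu>\<in>T. is_outer_normal S x \<nu>" using \<nu>0(1) by blast
  qed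
  have A_borel: "A T \<in> sets borel" if T: "closed T" for T
  proof -
    have "closed (fst ` (G \<epsilon> \<delta> \<inter> (UNIV \<times> (T \<inter> sphere 0 1))))" for \<epsilon> \<delta>
    proof -
      have "closed (G \<epsilon> \<delta>)" unfolding G_def by (rule closed_cone_condition)
      moreover have K: "compact (T \<inter> sphere 0 1 :: (real^'n) set)" using T by (intro closed_Int_compact compact_sphere)
      ultimately have "closed {x. \<exists>y. y \<in> T \<inter> sphere 0 1 \<and> (y, x) \<in> (\<lambda>p. (snd p, fst p)) -` G \<epsilon> \<delta>}"
        by (intro closed_compact_projection closed_vimage continuous_intros)
      also have "{x. \<exists>y. y \<in> T \<inter> sphere 0 1 \<and> (y, x) \<in> (\<lambda>p. (snd p, fst p)) -` G \<epsilon> \<delta>} = fst ` (G \<epsilon> \<delta> \<inter> (UNIV \<times> (T \<inter> sphere 0 1)))"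
        by force
      finally show ?thesis .
    qed
    then show ?thesis unfolding A_def by (intro sets.countable_INT sets.countable_UN) auto
  qed
  have ex: "outer_normal S x = \<nu>" if "is_outer_normal S x \<nu>" for x \<nu>
  proof -
    have "(THE \<nu>. is_outer_normal S x \<nu>) = \<nu>" using that is_outer_normal_unique by (intro the_equality) blast+
    then show ?thesis using that unfolding outer_normal_def by auto
  qed
  \<comment> \<open>A point without a normal is sent to 0, so it belongs to the preimage exactly
    when \<open>0 \<in> T\<close>.\<close>
  have "outer_normal S -` T = A T \<union> (if 0 \<in> T then - A UNIV else {})" if "closed T" for T
  proof -
    have "outer_normal S x \<in> T \<longleftrightarrow> x \<in> A T \<or> (0 \<in> T \<and> x \<notin> A UNIV)" for x
    proof (cases "\<exists>\<nu>. is_outer_normal S x \<nu>")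
      case True
      then obtain \<nu> where \<nu>: "is_outer_normal S x \<nu>" by blast
      have "x \<in> A T \<longleftrightarrow> \<nu> \<in> T" using A_iff[OF that, of x] \<nu> is_outer_normal_unique[OF \<nu>] by blast
      moreover have "x \<in> A UNIV" using A_iff[OF closed_UNIV, of x] \<nu> by blast
      ultimately show ?thesis using ex[OF \<nu>] by simp
    next
      case False
      then show ?thesis
        using A_iff[OF that, of x] A_iff[OF closed_UNIV, of x] by (auto simp: outer_normal_def)
    qed
    then show ?thesis by auto
  qed
  then have closed_pre: "outer_normal S -` T \<in> sets borel" if "closed T" for T
    using that A_borel[OF that] A_borel[OF closed_UNIV] by simp
  show ?thesis
  proof (rule borel_measurableI)
    fix U :: "(real^'n) set" assume "open U"
    then have "UNIV - outer_normal S -` (- U) \<in> sets borel"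
      using closed_pre[of "- U"] sets.compl_sets[of _ "borel :: (real^'n) measure"] by (simp add: closed_Compl)
    also have "UNIV - outer_normal S -` (- U) = outer_normal S -` U" by auto
    finally show "outer_normal S -` U \<inter> space borel \<in> sets borel" by simp
  qed
qed

lemma norm_outer_normal_le: "norm (outer_normal S x) \<le> 1"
proof (cases "\<exists>\<nu>. is_outer_normal S x \<nu>")
  case True
  then have "\<exists>!\<nu>. is_outer_normal S x \<nu>" using is_outer_normal_unique by blast
  from theI'[OF this] have "is_outer_normal S x (outer_normal S x)" using True by (simp add: outer_normal_def)
  then show ?thesis by (simp add: is_outer_normal_def)
qed (simp add: outer_normal_def)


section \<open>Continuously differentiable functions\<close>

definition C1 :: "(real^'n \<Rightarrow> real) \<Rightarrow> bool" where
  "C1 f \<longleftrightarrow> (\<forall>x. f differentiable at x) \<and> continuous_on UNIV (grad f)"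

lemma grad_eq:
  assumes "(f has_derivative (\<lambda>h. h \<bullet> v)) (at x)"
  shows "grad f x = v"
  using frechet_derivative_at[OF assms]
  by (simp add: grad_def vec_eq_iff fun_eq_iff inner_axis' flip: frechet_derivative_at[OF assms])

lemma has_derivative_grad:
  fixes f :: "real^'n \<Rightarrow> real"
  assumes "f differentiable at x"
  shows "(f has_derivative (\<lambda>h. h \<bullet> grad f x)) (at x)"
proof -
  let ?D = "frechet_derivative f (at x)"
  have D: "(f has_derivative ?D) (at x)" using assms by (simp add: frechet_derivative_works)
  then interpret D: linear ?D by (rule has_derivative_linear)
  have "?D h = h \<bullet> grad f x" for h
  proof -
    have "?D h = ?D (\<Sum>i\<in>UNIV. h $ i *\<^sub>R axis i 1)" by (simp add: basis_expansion scalar_mult_eq_scaleR[symmetric])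
    also have "\<dots> = (\<Sum>i\<in>UNIV. h $ i * ?D (axis i 1))" by (simp add: D.sum D.scaleR)
    finally show ?thesis by (simp add: grad_def inner_vec_def)
  qed
  then have "?D = (\<lambda>h. h \<bullet> grad f x)" by auto
  with D show ?thesis by simp
qed

lemma grad_lincomb:
  assumes "f differentiable at x" "h differentiable at x"
  shows "grad (\<lambda>x. a * f x + b * h x) x = a *\<^sub>R grad f x + b *\<^sub>R grad h x"
  by (rule grad_eq) (auto intro!: derivative_eq_intros has_derivative_grad[OF assms(1)] has_derivative_grad[OF assms(2)]
      simp: inner_add_right)

lemma grad_mult:
  assumes "f differentiable at x" "h differentiable at x"
  shows "grad (\<lambda>x. f x * h x) x = h x *\<^sub>R grad f x + f x *\<^sub>R grad h x"
  by (rule grad_eq) (auto intro!: derivative_eq_intros has_derivative_grad[OF assms(1)] has_derivative_grad[OF assms(2)]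
      simp: inner_add_right mult.commute add.commute)

lemma C1_const: "C1 (\<lambda>x :: real^'n. c)"
proof -
  have "grad (\<lambda>x. c) = (\<lambda>x :: real^'n. 0)" by (intro ext grad_eq) simp
  then show ?thesis unfolding C1_def by simp
qed

lemma C1_nth: "C1 (\<lambda>x :: real^'n. x $ i)"
proof -
  have d: "((\<lambda>x :: real^'n. x $ i) has_derivative (\<lambda>h. h \<bullet> axis i 1)) (at x)" for x
    by (simp add: inner_axis bounded_linear_imp_has_derivative bounded_linear_vec_nth)
  then have "grad (\<lambda>x :: real^'n. x $ i) = (\<lambda>x :: real^'n. axis i 1)" by (intro ext grad_eq)
  then show ?thesis using d by (auto simp: C1_def differentiable_def)
qed

lemma C1_continuous: "C1 f \<Longrightarrow> continuous_on A f"
  by (auto simp: C1_def intro!: continuous_at_imp_continuous_on differentiable_imp_continuous_within)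

lemma C1_mult: "C1 f \<Longrightarrow> C1 h \<Longrightarrow> C1 (\<lambda>x. f x * h x)"
proof -
  assume a: "C1 f" "C1 h"
  then have "grad (\<lambda>x. f x * h x) = (\<lambda>x. h x *\<^sub>R grad f x + f x *\<^sub>R grad h x)"
    by (intro ext grad_mult) (auto simp: C1_def)
  then show ?thesis using a C1_continuous[OF a(1)] C1_continuous[OF a(2)]
    by (auto simp: C1_def intro!: continuous_intros)
qed

lemma C1_add: "C1 f \<Longrightarrow> C1 h \<Longrightarrow> C1 (\<lambda>x. f x + h x)"
proof -
  assume a: "C1 f" "C1 h"
  then have "grad (\<lambda>x. f x + h x) = (\<lambda>x. grad f x + grad h x)"
    using grad_lincomb[of f _ h 1 1] by (intro ext) (auto simp: C1_def)
  then show ?thesis using a by (auto simp: C1_def intro!: continuous_intros)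
qed

lemma C1_sum: "(\<And>i. i \<in> I \<Longrightarrow> C1 (f i)) \<Longrightarrow> C1 (\<lambda>x. \<Sum>i\<in>I. f i x)"
  by (induction I rule: infinite_finite_induct) (auto intro: C1_const C1_add)

lemma C1_prod: "(\<And>i. i \<in> I \<Longrightarrow> C1 (f i)) \<Longrightarrow> C1 (\<lambda>x. \<Prod>i\<in>I. f i x)"
  by (induction I rule: infinite_finite_induct) (auto intro: C1_const C1_mult)

lemma C1_power: "C1 f \<Longrightarrow> C1 (\<lambda>x. f x ^ k)"
  by (induction k) (auto intro: C1_const C1_mult)

lemma polyQ_C1: "q \<in> polyQ r \<Longrightarrow> C1 q"
proof -
  assume "q \<in> polyQ r"
  then obtain c where "\<forall>x. q x = (\<Sum>m | \<forall>i. m i \<le> r. c m * (\<Prod>i\<in>UNIV. x $ i ^ m i))"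
    unfolding polyQ_def by blast
  then have "q = (\<lambda>x. \<Sum>m | \<forall>i. m i \<le> r. c m * (\<Prod>i\<in>UNIV. x $ i ^ m i))" by blast
  then show ?thesis by (auto intro!: C1_sum C1_mult C1_const C1_prod C1_power C1_nth)
qed

lemma finite_multi_indices: "finite {m :: 'n::finite \<Rightarrow> nat. \<forall>i. m i \<le> r}"
proof -
  have "{m :: 'n \<Rightarrow> nat. \<forall>i. m i \<le> r} = (\<Pi>\<^sub>E i\<in>UNIV. {..r})" by (auto simp: PiE_def)
  then show ?thesis by (auto intro: finite_PiE)
qed

lemma polyP_subset_polyQ: "polyP r \<subseteq> (polyQ r :: (real^'n \<Rightarrow> real) set)"
proof
  fix q :: "real^'n \<Rightarrow> real" assume "q \<in> polyP r"
  then obtain c where c: "\<And>x. q x = (\<Sum>m | (\<Sum>i\<in>(UNIV::'n set). m i) \<le> r. c m * (\<Prod>i\<in>UNIV. x $ i ^ m i))"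
    unfolding polyP_def by blast
  define c' where "c' m = (if (\<Sum>i\<in>(UNIV::'n set). m i) \<le> r then c m else 0)" for m
  have sub: "{m. (\<Sum>i\<in>(UNIV::'n set). m i) \<le> r} \<subseteq> {m. \<forall>i. m i \<le> r}"
    using member_le_sum[of _ "UNIV :: 'n set"] by (auto intro: order_trans)
  have "q x = (\<Sum>m | \<forall>i::'n. m i \<le> r. c' m * (\<Prod>i\<in>UNIV. x $ i ^ m i))" for x
    unfolding c by (rule sum.mono_neutral_cong_left[OF finite_multi_indices sub]) (auto simp: c'_def)
  then show "q \<in> polyQ r" by (auto simp: polyQ_def)
qed

text \<open>Mean value inequality for each component, with the gradient bounded by compactness. It
  supplies the constant in the estimate for the measure of a face.\<close>

lemma lipschitz_on_C1:
  fixes g :: "real^'n \<Rightarrow> real^'n"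
  assumes g: "\<And>j. C1 (\<lambda>x. g x $ j)" and S: "compact S" "convex S"
  obtains L where "L-lipschitz_on S g"
proof -
  have "\<exists>B\<ge>0. \<forall>x\<in>S. \<forall>y\<in>S. \<bar>g x $ j - g y $ j\<bar> \<le> B * norm (x - y)" for j
  proof -
    have "continuous_on S (grad (\<lambda>x. g x $ j))"
      using g[of j] continuous_on_subset[OF _ subset_UNIV] unfolding C1_def by blast
    then have "bounded (grad (\<lambda>x. g x $ j) ` S)"
      using S(1) by (intro compact_imp_bounded compact_continuous_image)
    then obtain B where B: "\<And>x. x \<in> S \<Longrightarrow> norm (grad (\<lambda>x. g x $ j) x) \<le> B"
      unfolding bounded_iff by blast
    have "\<bar>g x $ j - g y $ j\<bar> \<le> max B 0 * norm (x - y)" if "x \<in> S" "y \<in> S" for x y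
    proof -
      have "norm (g x $ j - g y $ j) \<le> max B 0 * norm (x - y)"
      proof (rule differentiable_bound[OF S(2) _ _ that(1) that(2), where f' = "\<lambda>z h. h \<bullet> grad (\<lambda>x. g x $ j) z"])
        fix z assume "z \<in> S"
        show "((\<lambda>x. g x $ j) has_derivative (\<lambda>h. h \<bullet> grad (\<lambda>x. g x $ j) z)) (at z within S)"
          using has_derivative_at_withinI[OF has_derivative_grad] g[of j] by (auto simp: C1_def)
        show "onorm (\<lambda>h. h \<bullet> grad (\<lambda>x. g x $ j) z) \<le> max B 0"
        proof (rule onorm_bound)
          fix h
          have "\<bar>h \<bullet> grad (\<lambda>x. g x $ j) z\<bar> \<le> norm h * norm (grad (\<lambda>x. g x $ j) z)" by (rule Cauchy_Schwarz_ineq2)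
          also have "\<dots> \<le> norm h * max B 0" using B[OF \<open>z \<in> S\<close>] by (intro mult_left_mono) auto
          finally show "norm (h \<bullet> grad (\<lambda>x. g x $ j) z) \<le> max B 0 * norm h" by (simp add: mult.commute)
        qed simp
      qed
      then show ?thesis by simp
    qed
    then show ?thesis by (intro exI[of _ "max B 0"]) auto
  qed
  then obtain B where B: "\<And>j. B j \<ge> 0" "\<And>j x y. x \<in> S \<Longrightarrow> y \<in> S \<Longrightarrow> \<bar>g x $ j - g y $ j\<bar> \<le> B j * norm (x - y)" by metis
  have "dist (g x) (g y) \<le> (\<Sum>j\<in>UNIV. B j) * dist x y" if "x \<in> S" "y \<in> S" for x y
  proof -
    have "dist (g x) (g y) \<le> (\<Sum>j\<in>UNIV. \<bar>(g x - g y) $ j\<bar>)" unfolding dist_norm by (rule norm_le_l1_cart)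
    also have "\<dots> \<le> (\<Sum>j\<in>UNIV. B j * norm (x - y))" using B(2)[OF that] by (intro sum_mono) simp
    finally show ?thesis by (simp add: sum_distrib_right dist_norm)
  qed
  then have "(\<Sum>j\<in>UNIV. B j)-lipschitz_on S g" using B(1) by (intro lipschitz_onI sum_nonneg) auto
  then show ?thesis by (rule that)
qed


section \<open>Extension to the closure and traces\<close>

text \<open>Continuous extension to the closure is what makes the limit in \<open>tr\<close> exist
  at boundary points; only the values of \<open>w\<close> inside \<open>K\<close> matter.\<close>

definition cext :: "(real^'n) set \<Rightarrow> (real^'n \<Rightarrow> 'b::real_normed_vector) \<Rightarrow> bool" where
  "cext K w \<longleftrightarrow> (\<exists>W. continuous_on (closure K) W \<and> (\<forall>x\<in>K. W x = w x))"

lemma cextI: "continuous_on (closure K) W \<Longrightarrow> (\<And>x. x \<in> K \<Longrightarrow> W x = w x) \<Longrightarrow> cext K w"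
  by (auto simp: cext_def)

lemma cext_cong: "cext K w \<Longrightarrow> (\<And>x. x \<in> K \<Longrightarrow> w x = w' x) \<Longrightarrow> cext K w'"
  by (auto simp: cext_def)

lemma cext_compose: "cext K w \<Longrightarrow> continuous_on UNIV \<phi> \<Longrightarrow> cext K (\<lambda>x. \<phi> (w x))"
  unfolding cext_def by (metis (no_types, lifting) continuous_on_compose2 subset_UNIV)

lemma cext_Pair: "cext K v \<Longrightarrow> cext K w \<Longrightarrow> cext K (\<lambda>x. (v x, w x))"
  unfolding cext_def by (metis (no_types, lifting) continuous_on_Pair)

lemma cext_compose2:
  assumes "cext K v" "cext K w" "continuous_on UNIV (\<lambda>p. \<phi> (fst p) (snd p))"
  shows "cext K (\<lambda>x. \<phi> (v x) (w x))"
  using cext_compose[OF cext_Pair[OF assms(1,2)] assms(3)] by simp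

lemma cext_lincomb: "cext K v \<Longrightarrow> cext K w \<Longrightarrow> cext K (\<lambda>x. a *\<^sub>R v x + b *\<^sub>R w x)"
  by (rule cext_compose2[of K v w "\<lambda>v w. a *\<^sub>R v + b *\<^sub>R w"]) (auto intro!: continuous_intros)

lemma cext_vec:
  fixes w :: "real^'n \<Rightarrow> 'm::finite \<Rightarrow> 'b::real_normed_vector"
  assumes "\<And>i. cext K (\<lambda>x. w x i)"
  shows "cext K (\<lambda>x. \<chi> i. w x i)"
proof -
  obtain W where "\<And>i. continuous_on (closure K) (W i)" "\<And>i x. x \<in> K \<Longrightarrow> W i x = w x i"
    using assms unfolding cext_def by metis
  then show ?thesis by (intro cextI[of K "\<lambda>x. \<chi> i. W i x"]) (auto intro!: continuous_on_vec_lambda)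
qed

locale opn = fixes K :: "(real^'n) set" assumes openK: "open K"
begin

lemma nontrivial: "x \<in> closure K \<Longrightarrow> at x within K \<noteq> bot"
  using openK by (auto simp: closure_def trivial_limit_within interior_open intro: interior_limit_point)

lemma tr_eqI:
  assumes "continuous_on (closure K) W" "\<And>x. x \<in> K \<Longrightarrow> W x = w x" "x \<in> closure K"
  shows "tr K w x = W x"
proof -
  have "(W \<longlongrightarrow> W x) (at x within closure K)" using assms(1,3) by (auto simp: continuous_on_def)
  then have "(W \<longlongrightarrow> W x) (at x within K)" using closure_subset by (rule tendsto_within_subset)
  then have "(w \<longlongrightarrow> W x) (at x within K)"
    by (rule Lim_transform_eventually) (auto simp: eventually_at_filter assms(2))
  then show ?thesis unfolding tr_def by (intro tendsto_Lim nontrivial assms(3))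
qed

lemma tr_cong: "(\<And>x. x \<in> K \<Longrightarrow> w x = w' x) \<Longrightarrow> tr K w x = tr K w' x"
proof -
  assume "\<And>x. x \<in> K \<Longrightarrow> w x = w' x"
  then have "(w \<longlongrightarrow> l) (at x within K) \<longleftrightarrow> (w' \<longlongrightarrow> l) (at x within K)" for l
    by (intro filterlim_cong) (auto simp: eventually_at_filter)
  then show ?thesis by (simp add: tr_def t2_space_class.Lim_def)
qed

lemma tr_eq_self:
  assumes "cext K w" "x \<in> K"
  shows "tr K w x = w x"
  using assms tr_eqI[of _ w x] closure_subset[of K] unfolding cext_def by (metis subsetD)

lemma continuous_on_tr:
  assumes "cext K w"
  shows "continuous_on (closure K) (tr K w)"
proof -
  obtain W where W: "continuous_on (closure K) W" "\<And>x. x \<in> K \<Longrightarrow> W x = w x" using assms by (auto simp: cext_def)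
  have "tr K w x = W x" if "x \<in> closure K" for x by (rule tr_eqI[OF W that])
  then show ?thesis using W(1) continuous_on_cong[of "closure K" "closure K" "tr K w" W] by simp
qed

lemma tr_compose2:
  assumes "cext K v" "cext K w" "continuous_on UNIV (\<lambda>p. \<phi> (fst p) (snd p))" "x \<in> closure K"
  shows "tr K (\<lambda>x. \<phi> (v x) (w x)) x = \<phi> (tr K v x) (tr K w x)"
proof (rule tr_eqI)
  show "continuous_on (closure K) (\<lambda>x. \<phi> (tr K v x) (tr K w x))"
    using continuous_on_compose2[OF assms(3) continuous_on_Pair[OF continuous_on_tr[OF assms(1)] continuous_on_tr[OF assms(2)]]]
    by simp
qed (simp_all add: tr_eq_self[OF assms(1)] tr_eq_self[OF assms(2)] assms(4))

lemma tr_lincomb: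
  assumes "cext K v" "cext K w" "x \<in> closure K"
  shows "tr K (\<lambda>x. a *\<^sub>R v x + b *\<^sub>R w x) x = a *\<^sub>R tr K v x + b *\<^sub>R tr K w x"
  by (rule tr_compose2[OF assms(1,2) _ assms(3)]) (auto intro!: continuous_intros)

lemma tr_zero: "(\<And>x. x \<in> K \<Longrightarrow> w x = 0) \<Longrightarrow> x \<in> closure K \<Longrightarrow> tr K w x = 0"
  by (rule tr_eqI[of "\<lambda>_. 0"]) auto

end

text \<open>Differentiable inside, with value and gradient continuous up to the boundary: the
  regularity of a finite element function on one cell.\<close>

definition creg :: "(real^'n) set \<Rightarrow> (real^'n \<Rightarrow> real) \<Rightarrow> bool" where
  "creg K f \<longleftrightarrow> (\<forall>x\<in>K. f differentiable at x) \<and> cext K f \<and> cext K (grad f)"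


lemma jacobian_eq:
  fixes v :: "real^'n \<Rightarrow> real^'m"
  assumes "\<And>j. (\<lambda>x. v x $ j) differentiable at x"
  shows "v differentiable at x" "jacobian v (at x) = (\<chi> i. grad (\<lambda>x. v x $ i) x)"
proof -
  have "(v has_derivative (\<lambda>h. (\<chi> i. grad (\<lambda>x. v x $ i) x) *v h)) (at x)"
  proof (rule has_derivative_componentwise_within[THEN iffD2], intro ballI)
    fix b :: "real^'m" assume "b \<in> Basis"
    then obtain j where b: "b = axis j 1" by (auto simp: Basis_vec_def)
    show "((\<lambda>x. v x \<bullet> b) has_derivative (\<lambda>h. ((\<chi> i. grad (\<lambda>x. v x $ i) x) *v h) \<bullet> b)) (at x)"
      using has_derivative_grad[OF assms[of j]]
      by (simp add: b inner_axis matrix_vector_mul_component inner_commute[of "grad f x" for f x])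
  qed
  then show "v differentiable at x" "jacobian v (at x) = (\<chi> i. grad (\<lambda>x. v x $ i) x)"
    by (auto simp: differentiable_def jacobian_def frechet_derivative_at[symmetric])
qed

section \<open>Cells\<close>

locale cell =
  fixes g :: "real^'n \<Rightarrow> real^'n"
  assumes g: "\<And>j. C1 (\<lambda>x. g x $ j)" and inj: "inj_on g (cbox 0 1)"
    and det: "\<And>x. x \<in> cbox 0 1 \<Longrightarrow> det (jacobian g (at x)) \<noteq> 0"
begin

definition "K = g ` box 0 1"

lemma continuous_g: "continuous_on A g"
  using C1_continuous[OF g] by (subst continuous_on_componentwise) (auto simp: Basis_vec_def inner_axis)

lemma closure_K: "closure K = g ` cbox 0 1"
proof
  have "compact (g ` cbox 0 1)" by (intro compact_continuous_image continuous_g compact_cbox)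
  then show "closure K \<subseteq> g ` cbox 0 1"
    unfolding K_def by (intro closure_minimal compact_imp_closed) (auto intro!: image_mono box_subset_cbox)
  have "(\<chi> i. 1/2) \<in> box 0 (1 :: real^'n)" by (simp add: mem_box_cart)
  then have "box 0 1 \<noteq> ({} :: (real^'n) set)" by blast
  then have "closure (box 0 1) = (cbox 0 1 :: (real^'n) set)" by (rule closure_box)
  then show "g ` cbox 0 1 \<subseteq> closure K"
    using image_closure_subset[of "box 0 1" g "closure K"] continuous_g closure_subset[of K] by (simp add: K_def)
qed

lemma open_K: "open K"
  unfolding K_def
  by (intro invariance_of_domain continuous_g inj_on_subset[OF inj] box_subset_cbox open_box)

sublocale opn K by standard (rule open_K)

lemma K_nonempty: "K \<noteq> {}"
proof -
  have "(\<chi> i. 1/2) \<in> box 0 (1 :: real^'n)" by (simp add: mem_box_cart)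
  then have "box 0 1 \<noteq> ({} :: (real^'n) set)" by blast
  then show ?thesis by (simp add: K_def)
qed

lemma compact_closure_K: "compact (closure K)"
  unfolding closure_K by (intro compact_continuous_image continuous_g compact_cbox)

lemma bounded_K: "bounded K"
  using bounded_subset[OF compact_imp_bounded[OF compact_closure_K] closure_subset] .

lemma negligible_boundary: "negligible (closure K - K)"
proof -
  have "g differentiable at x" for x using g by (intro jacobian_eq(1)) (simp add: C1_def)
  then have "g differentiable_on (cbox 0 1 - box 0 1)"
    by (simp add: differentiable_on_def differentiable_at_withinI)
  then have "negligible (g ` (cbox 0 1 - box 0 1))"
    by (intro negligible_differentiable_image_negligible negligible_frontier_interval) auto
  moreover have "closure K - K \<subseteq> g ` (cbox 0 1 - box 0 1)" by (subst closure_K) (auto simp: K_def)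
  ultimately show ?thesis by (rule negligible_subset)
qed

definition ginv where "ginv = the_inv_into (cbox 0 1) g"

lemma ginv: "y \<in> cbox 0 1 \<Longrightarrow> ginv (g y) = y"
  unfolding ginv_def by (rule the_inv_into_f_f[OF inj])

lemma continuous_ginv: "continuous_on (closure K) ginv"
  unfolding closure_K using ginv by (intro continuous_on_inv continuous_g compact_cbox ballI)

lemma ginv_mem: "x \<in> closure K \<Longrightarrow> ginv x \<in> cbox 0 1" "x \<in> K \<Longrightarrow> ginv x \<in> box 0 1"
proof -
  show "x \<in> closure K \<Longrightarrow> ginv x \<in> cbox 0 1" using ginv by (auto simp: closure_K)
  show "x \<in> K \<Longrightarrow> ginv x \<in> box 0 1"
    using ginv box_subset_cbox[of 0 "1 :: real^'n"] by (auto simp: K_def subset_iff)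
qed

text \<open>The chain rule gives \<open>(D g)\<^sup>T \<nabla>f = \<nabla>q\<close>, which is solved by Cramer's rule to see that the
  gradient depends continuously on the point up to the boundary of the cell.\<close>

lemma cregI:
  assumes q: "C1 q" and f: "\<And>y. y \<in> box 0 1 \<Longrightarrow> f (g y) = q y"
  shows "creg K f"
proof -
  define J where "J y = transpose (jacobian g (at y))" for y
  define G where "G y = (\<chi> k. det (\<chi> i j. if j = k then grad q y $ i else J y $ i $ j) / det (J y))" for y
  have Jij: "J y $ i $ j = grad (\<lambda>x. g x $ j) y $ i" for y i j
    using jacobian_eq(2)[of g y] g by (simp add: J_def transpose_def C1_def)
  have cJ: "continuous_on A (\<lambda>y. J y $ i $ j)" for A i j
    unfolding Jij using g[of j] unfolding C1_def by (auto intro!: continuous_intros intro: continuous_on_subset)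
  have cq: "continuous_on A (\<lambda>y. grad q y $ i)" for A i
    using q unfolding C1_def by (auto intro!: continuous_intros intro: continuous_on_subset)
  have cdet: "continuous_on A (\<lambda>y. det (M y))" if "\<And>i j. continuous_on A (\<lambda>y. M y $ i $ j)"
    for A and M :: "real^'n \<Rightarrow> real^'n^'n"
    unfolding det_def by (intro continuous_intros that)
  have detJ: "det (J y) \<noteq> 0" if "y \<in> cbox 0 1" for y using det[OF that] by (simp add: J_def det_transpose)
  have cG: "continuous_on (cbox 0 1) G"
  proof -
    have "continuous_on (cbox 0 1) (\<lambda>y. det (\<chi> i j. if j = k then grad q y $ i else J y $ i $ j))" for k
    proof (rule cdet)
      show "continuous_on (cbox 0 1) (\<lambda>y. (\<chi> i j. if j = k then grad q y $ i else J y $ i $ j) $ i $ j)" for i j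
        using cq cJ by (cases "j = k") auto
    qed
    moreover have "continuous_on (cbox 0 1) (\<lambda>y. det (J y))" by (rule cdet[OF cJ])
    ultimately show ?thesis unfolding G_def using detJ by (intro continuous_intros) auto
  qed
  have der: "(f has_derivative (\<lambda>h. h \<bullet> G (ginv x))) (at x)" if x: "x \<in> K" for x
  proof -
    define y where "y = ginv x"
    have y: "y \<in> box 0 1" "g y = x" using x ginv box_subset_cbox[of 0 "1 :: real^'n"] by (auto simp: y_def K_def subset_iff)
    then have yc: "y \<in> cbox 0 1" using box_subset_cbox by blast
    obtain B where B: "jacobian g (at y) ** B = mat 1" "B ** jacobian g (at y) = mat 1"
      using det[OF yc] unfolding invertible_det_nz[symmetric] invertible_def by blast
    have "g differentiable at y" using jacobian_eq(1)[of g y] g by (simp add: C1_def)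
    then have dg: "(g has_derivative (\<lambda>h. jacobian g (at y) *v h)) (at y)" by (simp add: jacobian_works)
    have dginv: "(ginv has_derivative (\<lambda>h. B *v h)) (at (g y))"
      using ginv box_subset_cbox[of 0 "1 :: real^'n"]
      by (intro has_derivative_inverse_strong[OF open_box y(1) continuous_g _ dg])
         (auto simp: fun_eq_iff matrix_vector_mul_assoc B subset_iff)
    have dq: "(q has_derivative (\<lambda>h. h \<bullet> grad q y)) (at y)"
      using q by (intro has_derivative_grad) (simp add: C1_def)
    have "((\<lambda>x. q (ginv x)) has_derivative (\<lambda>h. (B *v h) \<bullet> grad q y)) (at x)"
      using has_derivative_compose[OF dginv] dq ginv[OF yc] unfolding y(2) by simp
    then have df: "(f has_derivative (\<lambda>h. (B *v h) \<bullet> grad q y)) (at x)"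
    proof (rule has_derivative_transform_within_open[OF _ open_K x])
      fix z assume "z \<in> K"
      then obtain w where "w \<in> box 0 1" "z = g w" by (auto simp: K_def)
      then show "q (ginv z) = f z" using f ginv box_subset_cbox[of 0 "1 :: real^'n"] by (auto simp: subset_iff)
    qed
    have "transpose (jacobian g (at y)) ** transpose B = mat 1"
      unfolding matrix_transpose_mul[symmetric] B by (rule transpose_mat)
    then have "J y *v (transpose B *v grad q y) = grad q y"
      by (simp only: J_def matrix_vector_mul_assoc matrix_vector_mul_lid)
    then have "transpose B *v grad q y = G y"
      unfolding G_def cramer[OF detJ[OF yc]] .
    then have "grad q y v* B = G y" by (simp only: transpose_matrix_vector)
    then have "(B *v h) \<bullet> grad q y = h \<bullet> G y" for h
      using dot_lmul_matrix[of "grad q y" B h] by (simp add: inner_commute)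
    then show ?thesis using df unfolding y_def by simp
  qed
  have "cext K (grad f)"
  proof (rule cextI)
    show "continuous_on (closure K) (\<lambda>x. G (ginv x))"
      by (rule continuous_on_compose2[OF cG continuous_ginv]) (use ginv_mem(1) in blast)
    show "G (ginv x) = grad f x" if "x \<in> K" for x using grad_eq[OF der[OF that]] by simp
  qed
  moreover have "cext K f"
  proof (rule cextI)
    show "continuous_on (closure K) (\<lambda>x. q (ginv x))"
      using C1_continuous[OF q, of UNIV] continuous_ginv by (rule continuous_on_compose2) auto
    show "q (ginv x) = f x" if "x \<in> K" for x
      using that f ginv box_subset_cbox[of 0 "1 :: real^'n"] by (auto simp: K_def subset_iff)
  qed
  moreover have "f differentiable at x" if "x \<in> K" for x
    using der[OF that] unfolding differentiable_def by blast
  ultimately show ?thesis by (simp add: creg_def)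
qed

end


section \<open>Integrals of linearly parametrised functions\<close>

text \<open>The parameter \<open>v\<close> is a finite element function and \<open>f v\<close> a
  field computed from it. Linearity is asked on \<open>A\<close> only, since derivatives and traces
  are arbitrary elsewhere.\<close>

definition pw_lin :: "'a set \<Rightarrow> 'v::real_vector set \<Rightarrow> ('v \<Rightarrow> 'a \<Rightarrow> 'b::real_vector) \<Rightarrow> bool" where
  "pw_lin A V f \<longleftrightarrow> (\<forall>v\<in>V. \<forall>w\<in>V. \<forall>a b. \<forall>x\<in>A. f (a *\<^sub>R v + b *\<^sub>R w) x = a *\<^sub>R f v x + b *\<^sub>R f w x)"

text \<open>Measurability is relative to \<open>A\<close> because traces have a meaning only there.
  The class contains traces and the normal field and is closed under continuous operations.\<close>

definition fb :: "'a::topological_space set \<Rightarrow> ('a \<Rightarrow> 'b::euclidean_space) \<Rightarrow> bool" where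
  "fb A f \<longleftrightarrow> f \<in> borel_measurable (restrict_space borel A) \<and> bounded (f ` A)"

text \<open>The inclusion of the Borel sets covers both the completed Lebesgue measure on cells and
  the Borel surface measure on faces.\<close>

definition finite_borel :: "'a::topological_space measure \<Rightarrow> 'a set \<Rightarrow> bool" where
  "finite_borel M A \<longleftrightarrow> sets borel \<subseteq> sets M \<and> space M = UNIV \<and> A \<in> sets borel \<and> emeasure M A < \<infinity>"

lemma pw_linD: "pw_lin A V f \<Longrightarrow> v \<in> V \<Longrightarrow> w \<in> V \<Longrightarrow> x \<in> A \<Longrightarrow> f (a *\<^sub>R v + b *\<^sub>R w) x = a *\<^sub>R f v x + b *\<^sub>R f w x"
  by (simp add: pw_lin_def)

text \<open>Boundedness: \<phi> is continuous on the closure of the product of the two ranges, which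
  is compact.\<close>

lemma fb_compose2:
  assumes "fb A f" "fb A h" "continuous_on UNIV (\<lambda>p. \<phi> (fst p) (snd p))"
  shows "fb A (\<lambda>x. \<phi> (f x) (h x))"
  unfolding fb_def
proof
  have "(\<lambda>x. (\<lambda>p. \<phi> (fst p) (snd p)) (f x, h x)) \<in> borel_measurable (restrict_space borel A)"
    using assms(1,2) unfolding fb_def
    by (intro measurable_compose[OF borel_measurable_Pair borel_measurable_continuous_onI[OF assms(3)]]) auto
  then show "(\<lambda>x. \<phi> (f x) (h x)) \<in> borel_measurable (restrict_space borel A)" by simp
  have "bounded (f ` A \<times> h ` A)" using assms(1,2) by (intro bounded_Times) (auto simp: fb_def)
  then have "compact (closure (f ` A \<times> h ` A))" by (simp add: compact_closure)
  then have "bounded ((\<lambda>p. \<phi> (fst p) (snd p)) ` closure (f ` A \<times> h ` A))"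
    using continuous_on_subset[OF assms(3)] by (intro compact_imp_bounded compact_continuous_image) auto
  moreover have "(\<lambda>x. \<phi> (f x) (h x)) ` A \<subseteq> (\<lambda>p. \<phi> (fst p) (snd p)) ` closure (f ` A \<times> h ` A)"
  proof
    fix y assume "y \<in> (\<lambda>x. \<phi> (f x) (h x)) ` A"
    then obtain x where x: "x \<in> A" "y = \<phi> (f x) (h x)" by blast
    then have "(f x, h x) \<in> closure (f ` A \<times> h ` A)" by (intro subsetD[OF closure_subset]) simp
    then show "y \<in> (\<lambda>p. \<phi> (fst p) (snd p)) ` closure (f ` A \<times> h ` A)"
      by (rule rev_image_eqI) (simp add: x)
  qed
  ultimately show "bounded ((\<lambda>x. \<phi> (f x) (h x)) ` A)" by (rule bounded_subset)
qed

lemma fb_inner: "fb A f \<Longrightarrow> fb A h \<Longrightarrow> fb A (\<lambda>x. f x \<bullet> h x)"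
  by (rule fb_compose2) (auto intro!: continuous_intros)

lemma fb_lincomb: "fb A f \<Longrightarrow> fb A h \<Longrightarrow> fb A (\<lambda>x. a *\<^sub>R f x + b *\<^sub>R h x)"
  by (rule fb_compose2[of A f h "\<lambda>x y. a *\<^sub>R x + b *\<^sub>R y"]) (auto intro!: continuous_intros)

lemma continuous_on_matrix_vector:
  "continuous_on A M \<Longrightarrow> continuous_on A v \<Longrightarrow> continuous_on A (\<lambda>x. (M x :: real^'n^'m) *v v x)"
  unfolding matrix_vector_mult_def by (intro continuous_intros)

lemma fb_matrix_vector: "fb A f \<Longrightarrow> fb A h \<Longrightarrow> fb A (\<lambda>x. (f x :: real^'n^'m) *v h x)"
  by (rule fb_compose2) (auto intro!: continuous_on_matrix_vector continuous_intros)

lemma fb_continuous: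
  assumes "continuous_on C f" "compact C" "A \<subseteq> C"
  shows "fb A f"
  unfolding fb_def
proof
  show "f \<in> borel_measurable (restrict_space borel A)"
    using continuous_on_subset[OF assms(1,3)] by (rule borel_measurable_continuous_on_restrict)
  show "bounded (f ` A)"
    using bounded_subset[OF compact_imp_bounded[OF compact_continuous_image[OF assms(1,2)]]] assms(3) by blast
qed

lemma fb_measurable: "f \<in> borel_measurable borel \<Longrightarrow> (\<And>x. norm (f x) \<le> B) \<Longrightarrow> fb A f"
  by (auto simp: fb_def bounded_iff intro: measurable_restrict_space1)

lemma fb_indicator:
  assumes "fb A f" "A \<in> sets borel"
  shows "(\<lambda>x. indicator A x *\<^sub>R f x) \<in> borel_measurable borel"
  using assms by (simp add: fb_def borel_measurable_restrict_space_iff)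

lemma finite_borel_measurable: "finite_borel M A \<Longrightarrow> f \<in> borel_measurable borel \<Longrightarrow> f \<in> borel_measurable M"
  by (auto simp: finite_borel_def measurable_def)

lemma set_integrable_fb_mult:
  fixes w f :: "'a::topological_space \<Rightarrow> 'b::euclidean_space"
  assumes A: "finite_borel M A" and w: "set_integrable M A w" and f: "fb A f"
  shows "set_integrable M A (\<lambda>x. w x \<bullet> f x)"
proof -
  have AB: "A \<in> sets borel" using A by (simp add: finite_borel_def)
  obtain B where B: "\<And>x. x \<in> A \<Longrightarrow> norm (f x) \<le> B" using f unfolding fb_def bounded_iff by blast
  have fm: "(\<lambda>x. indicator A x *\<^sub>R f x) \<in> borel_measurable M"
    by (rule finite_borel_measurable[OF A fb_indicator[OF f AB]])
  have wm: "(\<lambda>x. indicator A x *\<^sub>R w x) \<in> borel_measurable M"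
    using w unfolding set_integrable_def by (rule borel_measurable_integrable)
  have "integrable M (\<lambda>x. (indicator A x *\<^sub>R w x) \<bullet> (indicator A x *\<^sub>R f x))"
  proof (rule Bochner_Integration.integrable_bound)
    show "integrable M (\<lambda>x. B * norm (indicator A x *\<^sub>R w x))"
      by (intro integrable_mult_right integrable_norm w[unfolded set_integrable_def])
    show "AE x in M. norm ((indicator A x *\<^sub>R w x) \<bullet> (indicator A x *\<^sub>R f x)) \<le> norm (B * norm (indicator A x *\<^sub>R w x))"
    proof (rule AE_I2)
      fix x
      show "norm ((indicator A x *\<^sub>R w x) \<bullet> (indicator A x *\<^sub>R f x)) \<le> norm (B * norm (indicator A x *\<^sub>R w x))"
      proof (cases "x \<in> A")
        case True
        have "\<bar>w x \<bullet> f x\<bar> \<le> norm (w x) * norm (f x)" by (rule Cauchy_Schwarz_ineq2)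
        also have "\<dots> \<le> norm (w x) * \<bar>B\<bar>" using B[OF True] by (intro mult_left_mono) auto
        finally show ?thesis using True by (simp add: abs_mult mult.commute)
      qed simp
    qed
  qed (rule borel_measurable_inner[OF wm fm])
  moreover have "(\<lambda>x. (indicator A x *\<^sub>R w x) \<bullet> (indicator A x *\<^sub>R f x)) = (\<lambda>x. indicator A x *\<^sub>R (w x \<bullet> f x))"
    by (auto simp: indicator_def)
  ultimately show ?thesis by (simp add: set_integrable_def)
qed

lemma set_integrable_fb:
  fixes f :: "'a::topological_space \<Rightarrow> real"
  assumes A: "finite_borel M A" and f: "fb A f"
  shows "set_integrable M A f"
proof -
  have "A \<in> sets M" using A by (auto simp: finite_borel_def)
  then have "set_integrable M A (\<lambda>x. 1 :: real)"
    using A by (simp add: set_integrable_def finite_borel_def integrable_real_indicator)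
  from set_integrable_fb_mult[OF A this f] show ?thesis by simp
qed

text \<open>On a set of finite measure the estimate
  \<open>norm (w x) \<le> 1 + (norm (w x))\<^sup>2\<close> suffices.\<close>

lemma set_integrable_L2:
  fixes w :: "'a::topological_space \<Rightarrow> 'b::euclidean_space"
  assumes A: "finite_borel M A" and w: "L2_on M \<Gamma> w" and sub: "A \<subseteq> \<Gamma>"
  shows "set_integrable M A w"
  unfolding set_integrable_def
proof (rule integrableI_bounded)
  have AM: "A \<in> sets M" using A by (auto simp: finite_borel_def)
  have wm: "(\<lambda>x. indicator \<Gamma> x *\<^sub>R w x) \<in> borel_measurable M" using w by (simp add: L2_on_def set_borel_measurable_def)
  have "(\<lambda>x. indicat_real A x *\<^sub>R (indicator \<Gamma> x *\<^sub>R w x)) \<in> borel_measurable M"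
    using AM wm by measurable
  moreover have "(\<lambda>x. indicat_real A x *\<^sub>R (indicator \<Gamma> x *\<^sub>R w x)) = (\<lambda>x. indicator A x *\<^sub>R w x)"
    using sub by (auto simp: indicator_def fun_eq_iff)
  ultimately show wA: "(\<lambda>x. indicat_real A x *\<^sub>R w x) \<in> borel_measurable M" by simp
  have nm: "(\<lambda>x. ennreal ((norm (indicat_real \<Gamma> x *\<^sub>R w x))\<^sup>2)) \<in> borel_measurable M"
    using wm by measurable
  have "(\<integral>\<^sup>+x. ennreal (norm (indicat_real A x *\<^sub>R w x)) \<partial>M)
      \<le> (\<integral>\<^sup>+x. indicator A x + ennreal ((norm (indicat_real \<Gamma> x *\<^sub>R w x))\<^sup>2) \<partial>M)"
  proof (rule nn_integral_mono)
    fix x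
    show "ennreal (norm (indicat_real A x *\<^sub>R w x)) \<le> indicator A x + ennreal ((norm (indicat_real \<Gamma> x *\<^sub>R w x))\<^sup>2)"
    proof (cases "x \<in> A")
      case True
      have "2 * norm (w x) \<le> 1 + (norm (w x))\<^sup>2"
        using sum_squares_bound[of 1 "norm (w x)"] by (simp add: power2_eq_square)
      then have "norm (w x) \<le> 1 + (norm (w x))\<^sup>2" using norm_ge_zero[of "w x"] by linarith
      then have "ennreal (norm (w x)) \<le> ennreal (1 + (norm (w x))\<^sup>2)" by (rule ennreal_leI)
      then show ?thesis using True sub by (auto simp: indicator_def ennreal_plus)
    qed simp
  qed
  also have "\<dots> = emeasure M A + (\<integral>\<^sup>+x. ennreal ((norm (indicat_real \<Gamma> x *\<^sub>R w x))\<^sup>2) \<partial>M)"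
    using AM by (subst nn_integral_add[OF _ nm]) simp_all
  also have "(\<integral>\<^sup>+x. ennreal ((norm (indicat_real \<Gamma> x *\<^sub>R w x))\<^sup>2) \<partial>M) = (\<integral>\<^sup>+x\<in>\<Gamma>. ennreal ((norm (w x))\<^sup>2) \<partial>M)"
    by (intro nn_integral_cong) (auto simp: indicator_def)
  also have "emeasure M A + \<dots> < \<infinity>"
    using A w by (simp add: finite_borel_def L2_on_def)
  finally show "(\<integral>\<^sup>+x. ennreal (norm (indicat_real A x *\<^sub>R w x)) \<partial>M) < \<infinity>" .
qed

lemma lin_on_set_integral:
  assumes "\<And>v. v \<in> V \<Longrightarrow> set_integrable M A (f v)" and lin: "pw_lin A V f"
  shows "lin_on V (\<lambda>v. LINT x:A|M. f v x :: real)"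
proof (rule lin_onI)
  fix v w a b assume vw: "v \<in> V" "w \<in> V"
  have "(LINT x:A|M. f (a *\<^sub>R v + b *\<^sub>R w) x) = (LINT x:A|M. a * f v x + b * f w x)"
    unfolding set_lebesgue_integral_def
    using pw_linD[OF lin vw, of _ a b] by (intro Bochner_Integration.integral_cong) (auto simp: indicator_def)
  also have "\<dots> = a * (LINT x:A|M. f v x) + b * (LINT x:A|M. f w x)"
    using assms(1) vw by simp
  finally show "(LINT x:A|M. f (a *\<^sub>R v + b *\<^sub>R w) x) = a * (LINT x:A|M. f v x) + b * (LINT x:A|M. f w x)" .
qed

lemma lin_on_integral_data:
  fixes w :: "'a::topological_space \<Rightarrow> 'b::euclidean_space"
  assumes A: "finite_borel M A" and w: "set_integrable M A w"
    and f: "\<And>v. v \<in> V \<Longrightarrow> fb A (f v)" and lin: "pw_lin A V f"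
  shows "lin_on V (\<lambda>v. LINT x:A|M. w x \<bullet> f v x)"
  using set_integrable_fb_mult[OF A w f] lin
  by (intro lin_on_set_integral) (auto simp: pw_lin_def inner_add_right)

lemma bilin_on_integral:
  fixes f :: "'v::real_vector \<Rightarrow> 'a::topological_space \<Rightarrow> 'b::euclidean_space" and h :: "'w::real_vector \<Rightarrow> 'a \<Rightarrow> 'b"
  assumes A: "finite_borel M A" and f: "\<And>v. v \<in> V \<Longrightarrow> fb A (f v)" "pw_lin A V f"
    and h: "\<And>w. w \<in> W \<Longrightarrow> fb A (h w)" "pw_lin A W h"
  shows "bilin_on V W (\<lambda>v w. LINT x:A|M. f v x \<bullet> h w x)"
  unfolding bilin_on_def
proof (intro conjI ballI)
  fix w assume w: "w \<in> W"
  show "lin_on V (\<lambda>v. LINT x:A|M. f v x \<bullet> h w x)"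
    using set_integrable_fb[OF A fb_inner[OF f(1) h(1)[OF w]]] f(2)
    by (intro lin_on_set_integral) (auto simp: pw_lin_def inner_add_left)
next
  fix v assume v: "v \<in> V"
  show "lin_on W (\<lambda>w. LINT x:A|M. f v x \<bullet> h w x)"
    using set_integrable_fb[OF A fb_inner[OF f(1)[OF v] h(1)]] h(2)
    by (intro lin_on_set_integral) (auto simp: pw_lin_def inner_add_right)
qed

lemma set_integral_cong':
  "(\<And>x. x \<in> A \<Longrightarrow> f x = h x) \<Longrightarrow> (LINT x:A|M. f x) = (LINT x:A|M. h x)"
  unfolding set_lebesgue_integral_def by (intro Bochner_Integration.integral_cong) (auto simp: indicator_def)

lemma set_integral_nonneg':
  "(\<And>x. x \<in> A \<Longrightarrow> 0 \<le> f x) \<Longrightarrow> 0 \<le> (LINT x:A|M. f x :: real)"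
  unfolding set_lebesgue_integral_def by (intro Bochner_Integration.integral_nonneg) (auto simp: indicator_def)


section \<open>Nonnegativity of symmetric Nitsche forms\<close>

text \<open>The consistency terms are absorbed by the energy and the penalty through a discrete trace inequality,
  which on a finite dimensional space only requires that the fluxes vanish on the kernel of the energy.\<close>

lemma nitsche_nonneg:
  fixes x y :: "'f \<Rightarrow> 'v::real_vector \<Rightarrow> 'a::topological_space \<Rightarrow> 'b::euclidean_space"
  assumes V: "findim V" and e: "psd_on V e" and I: "finite I"
    and A: "\<And>F. F \<in> I \<Longrightarrow> finite_borel M (A F)" and h: "\<And>F. F \<in> I \<Longrightarrow> h F > 0"
    and x: "\<And>F v. F \<in> I \<Longrightarrow> v \<in> V \<Longrightarrow> fb (A F) (x F v)" "\<And>F. F \<in> I \<Longrightarrow> pw_lin (A F) V (x F)"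
    and y: "\<And>F v. F \<in> I \<Longrightarrow> v \<in> V \<Longrightarrow> fb (A F) (y F v)"
    and ker: "\<And>v F z. v \<in> V \<Longrightarrow> e v v = 0 \<Longrightarrow> F \<in> I \<Longrightarrow> z \<in> A F \<Longrightarrow> x F v z = 0"
  shows "\<exists>\<gamma>0. \<forall>\<gamma>>\<gamma>0. \<forall>v\<in>V. e v v - 2 * (\<Sum>F\<in>I. LINT z:A F|M. x F v z \<bullet> y F v z)
    + (\<Sum>F\<in>I. \<gamma> / h F * (LINT z:A F|M. y F v z \<bullet> y F v z)) \<ge> 0"
proof -
  define t where "t v w = (\<Sum>F\<in>I. LINT z:A F|M. x F v z \<bullet> x F w z)" for v w
  have "psd_on V t" unfolding psd_on_def
  proof (intro conjI ballI)
    show "bilin_on V V t" unfolding t_def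
      by (intro bilin_on_intros bilin_on_integral A x)
    show "t v w = t w v" for v w by (simp add: t_def inner_commute)
    show "t v v \<ge> 0" for v unfolding t_def by (intro sum_nonneg set_integral_nonneg') simp
  qed
  moreover have "t v v = 0" if "v \<in> V" "e v v = 0" for v
    unfolding t_def using ker[OF that] by (intro sum.neutral ballI) (simp cong: set_integral_cong')
  ultimately obtain c where c: "c > 0" "\<And>v. v \<in> V \<Longrightarrow> t v v \<le> c * e v v"
    using psd_dominated[OF V e] by blast
  have "e v v - 2 * (\<Sum>F\<in>I. LINT z:A F|M. x F v z \<bullet> y F v z)
      + (\<Sum>F\<in>I. \<gamma> / h F * (LINT z:A F|M. y F v z \<bullet> y F v z)) \<ge> 0" if \<gamma>: "\<gamma> > c * (\<Sum>F\<in>I. h F)" and v: "v \<in> V" for \<gamma> v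
  proof -
    have F: "2 * (LINT z:A F|M. x F v z \<bullet> y F v z)
        \<le> 1 / c * (LINT z:A F|M. x F v z \<bullet> x F v z) + \<gamma> / h F * (LINT z:A F|M. y F v z \<bullet> y F v z)" if F: "F \<in> I" for F
    proof -
      note i = set_integrable_fb[OF A[OF F] fb_inner[OF x(1)[OF F v] y[OF F v]]]
        set_integrable_fb[OF A[OF F] fb_inner[OF x(1)[OF F v] x(1)[OF F v]]]
        set_integrable_fb[OF A[OF F] fb_inner[OF y[OF F v] y[OF F v]]]
      \<comment> \<open>The sum serves as a bound for the largest \<open>h F\<close>, so that one
        threshold gives \<open>c \<le> \<gamma> / h F\<close> on every face.\<close>
      have "h F \<le> (\<Sum>F\<in>I. h F)" using F h I by (intro member_le_sum) (auto intro: less_imp_le)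
      then have "c * h F \<le> \<gamma>" using \<gamma> c(1) by (meson less_imp_le mult_left_mono order_trans)
      then have cg: "c \<le> \<gamma> / h F" using h[OF F] by (simp add: pos_le_divide_eq)
      have "2 * (LINT z:A F|M. x F v z \<bullet> y F v z) = (LINT z:A F|M. 2 * (x F v z \<bullet> y F v z))" by simp
      also have "\<dots> \<le> (LINT z:A F|M. 1 / c * (x F v z \<bullet> x F v z) + c * (y F v z \<bullet> y F v z))"
      proof (rule set_integral_mono)
        fix z
        \<comment> \<open>Young's inequality with weight \<open>c\<close>, chosen so that
          \<open>t v v \<le> c * e v v\<close> lets the energy absorb the flux part.\<close>
        have "0 \<le> 1 / c * ((x F v z - c *\<^sub>R y F v z) \<bullet> (x F v z - c *\<^sub>R y F v z))" using c(1) by simp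
        also have "\<dots> = 1 / c * (x F v z \<bullet> x F v z) - 2 * (x F v z \<bullet> y F v z) + c * (y F v z \<bullet> y F v z)"
          using c(1) by (simp add: inner_diff inner_commute field_simps)
        finally show "2 * (x F v z \<bullet> y F v z) \<le> 1 / c * (x F v z \<bullet> x F v z) + c * (y F v z \<bullet> y F v z)" by simp
      qed (use i in \<open>auto intro!: set_integral_add\<close>)
      also have "\<dots> = 1 / c * (LINT z:A F|M. x F v z \<bullet> x F v z) + c * (LINT z:A F|M. y F v z \<bullet> y F v z)"
        using i by (subst set_integral_add) auto
      also have "\<dots> \<le> 1 / c * (LINT z:A F|M. x F v z \<bullet> x F v z) + \<gamma> / h F * (LINT z:A F|M. y F v z \<bullet> y F v z)"
        using cg by (intro add_left_mono mult_right_mono set_integral_nonneg') auto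
      finally show ?thesis .
    qed
    have "2 * (\<Sum>F\<in>I. LINT z:A F|M. x F v z \<bullet> y F v z)
        \<le> (\<Sum>F\<in>I. 1 / c * (LINT z:A F|M. x F v z \<bullet> x F v z) + \<gamma> / h F * (LINT z:A F|M. y F v z \<bullet> y F v z))"
      unfolding sum_distrib_left by (intro sum_mono F)
    also have "\<dots> = 1 / c * t v v + (\<Sum>F\<in>I. \<gamma> / h F * (LINT z:A F|M. y F v z \<bullet> y F v z))"
      by (simp add: t_def sum.distrib sum_distrib_left)
    also have "1 / c * t v v \<le> e v v" using c(2)[OF v] c(1) by (simp add: field_simps)
    finally show ?thesis by simp
  qed
  then show ?thesis by blast
qed

section \<open>Volume integrals over open sets\<close>

lemma (in opn) finite_borel_K: "bounded K \<Longrightarrow> finite_borel lebesgue K"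
  using lmeasurable_open[OF _ openK] openK by (auto simp: finite_borel_def fmeasurable_def)

lemma (in opn) fb_cext:
  assumes "cext K w" "compact (closure K)"
  shows "fb K w"
proof -
  obtain W where W: "continuous_on (closure K) W" "\<And>x. x \<in> K \<Longrightarrow> W x = w x" using assms(1) by (auto simp: cext_def)
  have "fb K W" by (rule fb_continuous[OF W(1) assms(2) closure_subset])
  then show ?thesis
    using W(2) measurable_cong[of "restrict_space borel K" W w borel] image_cong[of K K W w]
    by (simp add: fb_def space_restrict_space)
qed

text \<open>The set where \<phi> is nonzero is open by continuity and negligible by the vanishing
  integral, hence empty.\<close>

lemma (in opn) set_integral_zero:
  fixes \<phi> :: "real^'n \<Rightarrow> real"
  assumes \<phi>: "cext K \<phi>" "compact (closure K)" and nonneg: "\<And>x. x \<in> K \<Longrightarrow> \<phi> x \<ge> 0"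
    and 0: "(LINT x:K|lebesgue. \<phi> x) = 0" and x: "x \<in> K"
  shows "\<phi> x = 0"
proof (rule ccontr)
  assume ne: "\<phi> x \<noteq> 0"
  have bK: "bounded K" using assms(2) bounded_subset[OF compact_imp_bounded closure_subset] by blast
  have int: "set_integrable lebesgue K \<phi>"
    by (intro set_integrable_fb finite_borel_K bK fb_cext \<phi>)
  have "AE x in lebesgue. indicator K x *\<^sub>R \<phi> x = 0"
    using 0 int nonneg unfolding set_lebesgue_integral_def set_integrable_def
    by (subst integral_nonneg_eq_0_iff_AE[symmetric]) (auto simp: indicator_def)
  then have "{x. indicator K x *\<^sub>R \<phi> x \<noteq> 0} \<in> null_sets lebesgue"
    using AE_iff_null_sets[of "{x. indicator K x *\<^sub>R \<phi> x \<noteq> 0}" lebesgue] int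
    unfolding set_integrable_def by (auto simp: eventually_ae_filter elim!: null_sets_completion_subset)
  moreover have "{x. indicator K x *\<^sub>R \<phi> x \<noteq> 0} = {x \<in> K. \<phi> x \<noteq> 0}" by (auto simp: indicator_def)
  ultimately have "negligible {x \<in> K. \<phi> x \<noteq> 0}" by (simp add: negligible_iff_null_sets)
  moreover have "open {x \<in> K. \<phi> x \<noteq> 0}"
  proof -
    obtain W where W: "continuous_on (closure K) W" "\<And>x. x \<in> K \<Longrightarrow> W x = \<phi> x" using \<phi>(1) by (auto simp: cext_def)
    have "continuous_on K \<phi>"
      using continuous_on_subset[OF W(1) closure_subset] W(2) continuous_on_cong[of K K W \<phi>] by simp
    then have "open (\<phi> -` (- {0}) \<inter> K)"
      using openK continuous_on_open_vimage by blast
    moreover have "\<phi> -` (- {0}) \<inter> K = {x \<in> K. \<phi> x \<noteq> 0}" by auto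
    ultimately show ?thesis by simp
  qed
  ultimately show False using open_not_negligible x ne by blast
qed


section \<open>Operators evaluated on cells and faces\<close>

text \<open>Here \<open>f\<close> is the identity or a differential operator on the functions of
  \<open>V\<close>; continuous extension of its values guarantees traces on the faces of the
  cell.\<close>

definition vop :: "(real^'n) set \<Rightarrow> 'v::real_vector set \<Rightarrow> ('v \<Rightarrow> real^'n \<Rightarrow> 'b::euclidean_space) \<Rightarrow> bool" where
  "vop K V f \<longleftrightarrow> (\<forall>v\<in>V. cext K (f v)) \<and> pw_lin K V f"

definition fop :: "(real^'n) set \<Rightarrow> 'v::real_vector set \<Rightarrow> ('v \<Rightarrow> real^'n \<Rightarrow> 'b::euclidean_space) \<Rightarrow> bool" where
  "fop A V f \<longleftrightarrow> (\<forall>v\<in>V. fb A (f v)) \<and> pw_lin A V f"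

lemma fop_lincomb: "fop A V f \<Longrightarrow> fop A V h \<Longrightarrow> fop A V (\<lambda>v x. a *\<^sub>R f v x + b *\<^sub>R h v x)"
  by (auto simp: fop_def pw_lin_def fb_lincomb algebra_simps)

lemma fop_inner: "fop A V f \<Longrightarrow> fb A c \<Longrightarrow> fop A V (\<lambda>v x. f v x \<bullet> c x)"
  by (auto simp: fop_def pw_lin_def fb_inner inner_add_left)

lemma fop_matrix_vector: "fop A V f \<Longrightarrow> fb A c \<Longrightarrow> fop A V (\<lambda>v x. (f v x :: real^'n^'m) *v c x)"
  by (auto simp: fop_def pw_lin_def fb_matrix_vector matrix_vector_mult_add_rdistrib scaleR_matrix_vector_assoc)

lemma bilin_on_cong:
  assumes "bilin_on V W b" "subspace V" "subspace W" "\<And>v w. v \<in> V \<Longrightarrow> w \<in> W \<Longrightarrow> b v w = c v w"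
  shows "bilin_on V W c"
  using assms unfolding bilin_on_def lin_on_def by (simp add: subspace_add subspace_scale)

lemma polyQ_lincomb:
  assumes "p \<in> polyQ r" "q \<in> polyQ r"
  shows "(\<lambda>x. a * p x + b * q x) \<in> polyQ r"
proof -
  obtain c d where "\<forall>x. p x = (\<Sum>m | \<forall>i. m i \<le> r. c m * (\<Prod>i\<in>UNIV. x $ i ^ m i))"
    "\<forall>x. q x = (\<Sum>m | \<forall>i. m i \<le> r. d m * (\<Prod>i\<in>UNIV. x $ i ^ m i))"
    using assms unfolding polyQ_def by blast
  then have "\<forall>x. a * p x + b * q x = (\<Sum>m | \<forall>i. m i \<le> r. (a * c m + b * d m) * (\<Prod>i\<in>UNIV. x $ i ^ m i))"
    by (simp add: sum_distrib_left sum.distrib[symmetric] algebra_simps)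
  then show ?thesis unfolding polyQ_def mem_Collect_eq by (rule exI[of _ "\<lambda>m. a * c m + b * d m"])
qed

lemma polyP_lincomb:
  assumes "p \<in> polyP r" "q \<in> polyP r"
  shows "(\<lambda>x. a * p x + b * q x) \<in> polyP r"
proof -
  obtain c d where "\<forall>x. p x = (\<Sum>m | (\<Sum>i\<in>UNIV. m i) \<le> r. c m * (\<Prod>i\<in>UNIV. x $ i ^ m i))"
    "\<forall>x. q x = (\<Sum>m | (\<Sum>i\<in>UNIV. m i) \<le> r. d m * (\<Prod>i\<in>UNIV. x $ i ^ m i))"
    using assms unfolding polyP_def by blast
  then have "\<forall>x. a * p x + b * q x = (\<Sum>m | (\<Sum>i\<in>UNIV. m i) \<le> r. (a * c m + b * d m) * (\<Prod>i\<in>UNIV. x $ i ^ m i))"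
    by (simp add: sum_distrib_left sum.distrib[symmetric] algebra_simps)
  then show ?thesis unfolding polyP_def mem_Collect_eq by (rule exI[of _ "\<lambda>m. a * c m + b * d m"])
qed

lemma L2_on_lincomb:
  fixes f h :: "'a::topological_space \<Rightarrow> 'b::{real_normed_vector,second_countable_topology}"
  assumes f: "L2_on M A f" and h: "L2_on M A h"
  shows "L2_on M A (\<lambda>x. a *\<^sub>R f x + b *\<^sub>R h x)"
proof -
  have fm: "(\<lambda>x. indicat_real A x *\<^sub>R f x) \<in> borel_measurable M" and hm: "(\<lambda>x. indicat_real A x *\<^sub>R h x) \<in> borel_measurable M"
    using f h by (auto simp: L2_on_def set_borel_measurable_def)
  have "(\<lambda>x. a *\<^sub>R (indicat_real A x *\<^sub>R f x) + b *\<^sub>R (indicat_real A x *\<^sub>R h x)) \<in> borel_measurable M"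
    using fm hm by measurable
  then have m: "set_borel_measurable M A (\<lambda>x. a *\<^sub>R f x + b *\<^sub>R h x)"
    by (simp add: set_borel_measurable_def algebra_simps)
  define F where "F x = ennreal ((norm (indicat_real A x *\<^sub>R f x))\<^sup>2)" for x
  define H where "H x = ennreal ((norm (indicat_real A x *\<^sub>R h x))\<^sup>2)" for x
  have Fm: "F \<in> borel_measurable M" "H \<in> borel_measurable M" unfolding F_def H_def using fm hm by measurable
  have fin: "(\<integral>\<^sup>+x. F x \<partial>M) < \<infinity>" "(\<integral>\<^sup>+x. H x \<partial>M) < \<infinity>"
  proof -
    have "(\<integral>\<^sup>+x. F x \<partial>M) = (\<integral>\<^sup>+x\<in>A. ennreal ((norm (f x))\<^sup>2) \<partial>M)" "(\<integral>\<^sup>+x. H x \<partial>M) = (\<integral>\<^sup>+x\<in>A. ennreal ((norm (h x))\<^sup>2) \<partial>M)"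
      unfolding F_def H_def by (intro nn_integral_cong; auto simp: indicator_def)+
    then show "(\<integral>\<^sup>+x. F x \<partial>M) < \<infinity>" "(\<integral>\<^sup>+x. H x \<partial>M) < \<infinity>" using f h by (auto simp: L2_on_def)
  qed
  have "(\<integral>\<^sup>+x\<in>A. ennreal ((norm (a *\<^sub>R f x + b *\<^sub>R h x))\<^sup>2) \<partial>M) \<le> (\<integral>\<^sup>+x. ennreal (2 * a\<^sup>2) * F x + ennreal (2 * b\<^sup>2) * H x \<partial>M)"
  proof (rule nn_integral_mono)
    fix x
    show "ennreal ((norm (a *\<^sub>R f x + b *\<^sub>R h x))\<^sup>2) * indicator A x \<le> ennreal (2 * a\<^sup>2) * F x + ennreal (2 * b\<^sup>2) * H x"
    proof (cases "x \<in> A")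
      case True
      have "(norm (a *\<^sub>R f x + b *\<^sub>R h x))\<^sup>2 \<le> (norm (a *\<^sub>R f x) + norm (b *\<^sub>R h x))\<^sup>2"
        by (intro power_mono norm_triangle_ineq) auto
      also have "\<dots> \<le> 2 * (norm (a *\<^sub>R f x))\<^sup>2 + 2 * (norm (b *\<^sub>R h x))\<^sup>2"
        using sum_squares_bound[of "norm (a *\<^sub>R f x)" "norm (b *\<^sub>R h x)"] by (simp add: power2_sum)
      also have "\<dots> = 2 * a\<^sup>2 * (norm (f x))\<^sup>2 + 2 * b\<^sup>2 * (norm (h x))\<^sup>2" by (simp add: power_mult_distrib)
      finally have "ennreal ((norm (a *\<^sub>R f x + b *\<^sub>R h x))\<^sup>2) \<le> ennreal (2 * a\<^sup>2 * (norm (f x))\<^sup>2 + 2 * b\<^sup>2 * (norm (h x))\<^sup>2)"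
        by (rule ennreal_leI)
      then show ?thesis using True by (simp add: F_def H_def ennreal_plus ennreal_mult)
    qed simp
  qed
  also have "\<dots> = ennreal (2 * a\<^sup>2) * (\<integral>\<^sup>+x. F x \<partial>M) + ennreal (2 * b\<^sup>2) * (\<integral>\<^sup>+x. H x \<partial>M)"
    using Fm by (simp add: nn_integral_add nn_integral_cmult)
  also have "\<dots> < \<infinity>" using fin by (simp add: ennreal_mult_less_top)
  finally show ?thesis using m by (simp add: L2_on_def)
qed


section \<open>The finite element setting\<close>

text \<open>The bound \<open>dim\<close> makes faces at least one-dimensional, the case in which
  \<open>emeasure_hausdorff\<close> applies.\<close>

locale fe =
  fixes S :: "('n::finite) setting" and Th :: "'n mesh"
  assumes dim: "CARD('n) \<ge> 2" and S: "valid_setting S" and Th: "valid_mesh S Th"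
begin

lemma finite_cells: "finite (cells Th)" and disjoint_cells: "disjoint (cells Th)"
  and closures: "(\<Union>K\<in>cells Th. closure K) = closure (dom S)"
  using Th by (auto simp: valid_mesh_def)

lemma cell:
  assumes "K \<in> cells Th"
  shows "cell (cmap Th K)" "cell.K (cmap Th K) = K" "K \<subseteq> dom S"
proof -
  have a: "K \<subseteq> dom S" "\<And>j. (\<lambda>x. cmap Th K x $ j) \<in> polyQ 1" "inj_on (cmap Th K) (cbox 0 1)"
    "\<And>x. x\<in>cbox 0 1 \<Longrightarrow> det (jacobian (cmap Th K) (at x)) \<noteq> 0" "cmap Th K ` box 0 1 = K"
  proof -
    have "\<forall>K\<in>cells Th. K \<subseteq> dom S \<and> (\<forall>j. (\<lambda>x. cmap Th K x $ j) \<in> polyQ 1) \<and>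
        inj_on (cmap Th K) (cbox 0 1) \<and>
        (\<forall>x\<in>cbox 0 1. det (jacobian (cmap Th K) (at x)) \<noteq> 0) \<and>
        cmap Th K ` box 0 1 = K"
      using Th unfolding valid_mesh_def by (elim conjE)
    from bspec[OF this assms] show "K \<subseteq> dom S" "\<And>j. (\<lambda>x. cmap Th K x $ j) \<in> polyQ 1" "inj_on (cmap Th K) (cbox 0 1)"
      "\<And>x. x\<in>cbox 0 1 \<Longrightarrow> det (jacobian (cmap Th K) (at x)) \<noteq> 0" "cmap Th K ` box 0 1 = K"
      by simp_all
  qed
  show c: "cell (cmap Th K)" by (rule cell.intro[OF polyQ_C1[OF a(2)] a(3,4)])
  show "cell.K (cmap Th K) = K" using a(5) by (simp add: cell.K_def[OF c])
  show "K \<subseteq> dom S" by (rule a)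
qed

lemma cell_props:
  assumes "K \<in> cells Th"
  shows "opn K" "open K" "compact (closure K)" "bounded K" "K \<noteq> {}" "negligible (closure K - K)"
    "closure K = cmap Th K ` cbox 0 1" "K = cmap Th K ` box 0 1"
proof -
  note c = cell[OF assms]
  show "open K" using cell.open_K[OF c(1)] c(2) by simp
  then show "opn K" by (rule opn.intro)
  show "compact (closure K)" using cell.compact_closure_K[OF c(1)] c(2) by simp
  show "bounded K" using cell.bounded_K[OF c(1)] c(2) by simp
  show "K \<noteq> {}" using cell.K_nonempty[OF c(1)] c(2) by simp
  show "negligible (closure K - K)" using cell.negligible_boundary[OF c(1)] c(2) by simp
  show "closure K = cmap Th K ` cbox 0 1" using cell.closure_K[OF c(1)] c(2) by simp
  show "K = cmap Th K ` box 0 1" using cell.K_def[OF c(1)] c(2) by simp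
qed

lemma cell_creg:
  assumes "K \<in> cells Th" "\<exists>q\<in>polyQ r. \<forall>y\<in>box 0 1. f (cmap Th K y) = q y"
  shows "creg K f"
proof -
  obtain q where q: "q \<in> polyQ r" "\<And>y. y \<in> box 0 1 \<Longrightarrow> f (cmap Th K y) = q y" using assms(2) by blast
  show ?thesis using cell.cregI[OF cell(1)[OF assms(1)] polyQ_C1[OF q(1)] q(2)] cell(2)[OF assms(1)] by simp
qed

lemma finite_borel_cell: "K \<in> cells Th \<Longrightarrow> finite_borel lebesgue K"
  using opn.finite_borel_K cell_props by blast

lemma fb_cell: "K \<in> cells Th \<Longrightarrow> cext K w \<Longrightarrow> fb K w"
  using opn.fb_cext cell_props by blast

lemma open_dom: "open (dom S)" and compact_closure_dom: "compact (closure (dom S))"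
  and bounded_dom: "bounded (dom S)"
  using S by (auto simp: valid_setting_def lipschitz_domain_def opn_def compact_closure)

lemma closure_cell_subset: "K \<in> cells Th \<Longrightarrow> closure K \<subseteq> closure (dom S)"
  using closures by blast

lemma negligible_skeleton: "negligible (dom S - \<Union>(cells Th))"
proof -
  have "negligible (\<Union>K\<in>cells Th. closure K - K)"
    using finite_cells cell_props(6) by (intro negligible_Union) auto
  moreover have "dom S - \<Union>(cells Th) \<subseteq> (\<Union>K\<in>cells Th. closure K - K)"
    using closures closure_subset[of "dom S"] by blast
  ultimately show ?thesis by (rule negligible_subset)
qed

text \<open>Derivatives of finite element functions are controlled inside the cells only, but the
  cells are disjoint and miss just a negligible part of the domain.\<close>

lemma ip_dom:
  fixes f h :: "real^'n \<Rightarrow> 'b::euclidean_space"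
  assumes "\<And>K. K \<in> cells Th \<Longrightarrow> cext K f" "\<And>K. K \<in> cells Th \<Longrightarrow> cext K h"
  shows "ip (dom S) f h = (\<Sum>K\<in>cells Th. ip K f h)"
proof -
  define \<phi> where "\<phi> x = f x \<bullet> h x" for x
  have int: "set_integrable lebesgue K \<phi>" if "K \<in> cells Th" for K
    unfolding \<phi>_def by (intro set_integrable_fb finite_borel_cell fb_inner fb_cell assms that)
  have sets: "K \<in> sets lebesgue" if "K \<in> cells Th" for K
    using cell_props(2)[OF that] by (simp add: lmeasurable_open borel_open sets_completionI_sets)
  have intU: "set_integrable lebesgue (\<Union>K\<in>cells Th. K) \<phi>"
    using finite_cells int sets by (intro set_integrable_UN) auto
  have sub: "\<Union>(cells Th) \<subseteq> dom S" using cell(3) by blast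
  have n1: "negligible {x \<in> \<Union>(cells Th) - dom S. \<phi> x \<noteq> 0}" using sub by (intro negligible_subset[OF negligible_empty]) blast
  have n2: "negligible {x \<in> dom S - \<Union>(cells Th). \<phi> x \<noteq> 0}" by (rule negligible_subset[OF negligible_skeleton]) blast
  have intD: "set_integrable lebesgue (dom S) \<phi>"
    using intU by (intro absolutely_integrable_spike_set[OF _ n1 n2]) simp
  have "(LINT x:dom S|lebesgue. \<phi> x) = integral (dom S) \<phi>" by (rule set_lebesgue_integral_eq_integral(2)[OF intD])
  also have "\<dots> = integral (\<Union>(cells Th)) \<phi>" by (rule integral_spike_set[OF n2 n1])
  also have "\<dots> = (LINT x:(\<Union>K\<in>cells Th. K)|lebesgue. \<phi> x)" using set_lebesgue_integral_eq_integral(2)[OF intU] by simp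
  also have "\<dots> = (\<Sum>K\<in>cells Th. LINT x:K|lebesgue. \<phi> x)"
    using disjoint_cells by (intro set_integral_finite_Union finite_cells int sets)
      (auto simp: disjoint_family_on_def pairwise_def disjnt_def)
  finally show ?thesis by (simp add: ip_def \<phi>_def)
qed

lemma ip_cell_bilin:
  fixes f :: "'v::real_vector \<Rightarrow> real^'n \<Rightarrow> 'b::euclidean_space"
  assumes "K \<in> cells Th" "vop K V f" "vop K W h"
  shows "bilin_on V W (\<lambda>v w. ip K (f v) (h w))"
  unfolding ip_def using assms
  by (intro bilin_on_integral finite_borel_cell fb_cell) (auto simp: vop_def)

lemma ip_dom_bilin:
  fixes f :: "'v::real_vector \<Rightarrow> real^'n \<Rightarrow> 'b::euclidean_space"
  assumes "subspace V" "subspace W" "\<And>K. K \<in> cells Th \<Longrightarrow> vop K V f" "\<And>K. K \<in> cells Th \<Longrightarrow> vop K W h"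
  shows "bilin_on V W (\<lambda>v w. ip (dom S) (f v) (h w))"
proof (rule bilin_on_cong[OF _ assms(1,2)])
  show "bilin_on V W (\<lambda>v w. \<Sum>K\<in>cells Th. ip K (f v) (h w))"
    by (intro bilin_on_intros ip_cell_bilin assms)
  show "(\<Sum>K\<in>cells Th. ip K (f v) (h w)) = ip (dom S) (f v) (h w)" if "v \<in> V" "w \<in> W" for v w
    using that assms(3,4) by (intro ip_dom[symmetric]) (auto simp: vop_def)
qed

text \<open>A nonnegative integrand with zero integral over the domain has zero integral over every
  cell, where it is continuous.\<close>

lemma ip_cell_zero:
  fixes f h :: "real^'n \<Rightarrow> 'b::euclidean_space"
  assumes f: "\<And>K. K \<in> cells Th \<Longrightarrow> cext K f" and h: "\<And>K. K \<in> cells Th \<Longrightarrow> cext K h"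
    and nonneg: "\<And>x. f x \<bullet> h x \<ge> 0" and 0: "ip (dom S) f h = 0" and K: "K \<in> cells Th" and x: "x \<in> K"
  shows "f x \<bullet> h x = 0"
proof -
  have "(\<Sum>K\<in>cells Th. ip K f h) = 0" using 0 ip_dom[OF f h] by simp
  moreover have "ip K f h \<ge> 0" for K unfolding ip_def using nonneg by (intro set_integral_nonneg')
  ultimately have "ip K f h = 0" using K finite_cells by (simp add: sum_nonneg_eq_0_iff)
  moreover have "cext K (\<lambda>x. f x \<bullet> h x)"
    by (rule cext_compose2[OF f[OF K] h[OF K]]) (intro continuous_intros)
  ultimately show ?thesis
    using opn.set_integral_zero[OF cell_props(1)[OF K] _ cell_props(3)[OF K], of "\<lambda>x. f x \<bullet> h x" x] nonneg x
    by (simp add: ip_def)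
qed

lemma fop_tr:
  assumes K: "K \<in> cells Th" and f: "vop K V f" and A: "A \<subseteq> closure K"
  shows "fop A V (\<lambda>v. tr K (f v))"
  unfolding fop_def
proof (intro conjI ballI)
  interpret opn K by (rule cell_props(1)[OF K])
  have ce: "cext K (f v)" if "v \<in> V" for v using f that by (auto simp: vop_def)
  show "fb A (tr K (f v))" if "v \<in> V" for v
    by (rule fb_continuous[OF continuous_on_tr[OF ce[OF that]] cell_props(3)[OF K] A])
  show "pw_lin A V (\<lambda>v. tr K (f v))"
    unfolding pw_lin_def
  proof (intro ballI allI)
    fix v w a b x assume vw: "v \<in> V" "w \<in> V" and x: "x \<in> A"
    have "tr K (f (a *\<^sub>R v + b *\<^sub>R w)) x = tr K (\<lambda>x. a *\<^sub>R f v x + b *\<^sub>R f w x) x"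
      using f vw by (intro tr_cong) (auto simp: vop_def pw_lin_def)
    also have "\<dots> = a *\<^sub>R tr K (f v) x + b *\<^sub>R tr K (f w) x"
      using x A by (intro tr_lincomb ce vw) auto
    finally show "tr K (f (a *\<^sub>R v + b *\<^sub>R w)) x = a *\<^sub>R tr K (f v) x + b *\<^sub>R tr K (f w) x" .
  qed
qed

subsection \<open>Faces\<close>

lemma facet:
  assumes K: "K \<in> cells Th" and F: "F \<in> facets Th K"
  shows "finite_borel surf F" "F \<subseteq> closure K"
proof -
  let ?g = "cmap Th K"
  interpret cell ?g by (rule cell(1)[OF K])
  obtain i s where s01: "s \<in> {0, 1}" and Fe: "F = ?g ` {x. x$i = s \<and> (\<forall>j. j \<noteq> i \<longrightarrow> 0 < x$j \<and> x$j < 1)}"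
    using F by (auto simp: facets_def ref_facets_def)
  define E where "E = {x :: real^'n. x$i = s \<and> (\<forall>j. j \<noteq> i \<longrightarrow> 0 < x$j \<and> x$j < 1)}"
  have EC: "E \<subseteq> cbox 0 1"
  proof
    fix x assume "x \<in> E"
    then have "0 \<le> x$j \<and> x$j \<le> 1" for j using s01 by (cases "j = i") (auto simp: E_def less_imp_le)
    then show "x \<in> cbox 0 1" by (simp add: mem_box_cart)
  qed
  show "F \<subseteq> closure K" unfolding cell_props(7)[OF K] Fe using EC by (auto simp: E_def)
  obtain L where L: "L-lipschitz_on (cbox 0 1) ?g" using lipschitz_on_C1[OF g compact_cbox convex_box(1)] .
  have fin: "hausdorff_outer (CARD('n) - 1) F < \<infinity>"
    unfolding Fe by (rule hausdorff_outer_facet_image[OF dim L s01])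
  \<comment> \<open>\<open>E1\<close> is the closed facet and \<open>E2\<close> its relative
    boundary, both compact. Injectivity of the cell map carries their difference over to the images,
    which makes the face a Borel set.\<close>
  define E1 where "E1 = cbox 0 1 \<inter> {x :: real^'n. x$i = s}"
  define E2 where "E2 = E1 \<inter> (\<Union>j\<in>-{i}. {x. x$j = 0} \<union> {x. x$j = 1})"
  have cl: "closed {x :: real^'n. x$j = t}" for j t by (intro closed_Collect_eq continuous_intros)
  have "compact E1" unfolding E1_def by (intro compact_Int_closed compact_cbox cl)
  moreover have "compact E2" unfolding E2_def by (intro compact_Int_closed \<open>compact E1\<close> closed_UN ballI closed_Un cl) auto
  ultimately have "compact (?g ` E1)" "compact (?g ` E2)"
    by (auto intro!: compact_continuous_image continuous_g)
  then have b: "?g ` E1 \<in> sets borel" "?g ` E2 \<in> sets borel" by (auto intro: borel_closed compact_imp_closed)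
  have E: "E = E1 - E2"
  proof
    show "E \<subseteq> E1 - E2" using EC by (auto simp: E_def E1_def E2_def)
    show "E1 - E2 \<subseteq> E"
      by (auto simp: E_def E1_def E2_def mem_box_cart order_less_le)
  qed
  have "F = ?g ` E1 - ?g ` E2"
    unfolding Fe E_def[symmetric] E
    by (rule inj_on_image_set_diff[OF inj]) (auto simp: E1_def E2_def)
  then have F: "F \<in> sets borel" using b by auto
  have "1 \<le> CARD('n) - 1" using dim by simp
  then have "emeasure surf F = hausdorff_outer (CARD('n) - 1) F"
    unfolding surf_def using F by (rule emeasure_hausdorff)
  then show "finite_borel surf F" using fin F by (simp add: finite_borel_def)
qed

lemma finite_faces: "finite (faces Th)"
proof -
  have eq: "ref_facets = (\<lambda>(i, s). {x :: real^'n. x$i = s \<and> (\<forall>j. j \<noteq> i \<longrightarrow> 0 < x$j \<and> x$j < 1)}) ` (UNIV \<times> {0, 1})"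
    by (auto simp: ref_facets_def)
  have "finite (UNIV \<times> {0, 1} :: ('n \<times> real) set)" by simp
  then have "finite (ref_facets :: (real^'n) set set)" unfolding eq by (rule finite_imageI)
  then show ?thesis using finite_cells by (auto simp: faces_def facets_def)
qed

lemma bfaces_subset: "bfaces S Th \<subseteq> faces Th"
  by (auto simp: bfaces_def)

lemma finite_bfaces: "finite (bfaces S Th)"
  using finite_subset[OF bfaces_subset finite_faces] .

lemma face_plus: "F \<in> faces Th \<Longrightarrow> fplus Th F \<in> cells Th \<and> F \<in> facets Th (fplus Th F)"
  and face_minus: "F \<in> faces Th \<Longrightarrow> F \<notin> bfaces S Th \<Longrightarrow> fminus Th F \<in> cells Th \<and> F \<in> facets Th (fminus Th F)"
  using Th by (auto simp: valid_mesh_def)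

lemma face_borel: "F \<in> faces Th \<Longrightarrow> finite_borel surf F"
  and face_closure_plus: "F \<in> faces Th \<Longrightarrow> F \<subseteq> closure (fplus Th F)"
  and face_closure_minus: "F \<in> faces Th \<Longrightarrow> F \<notin> bfaces S Th \<Longrightarrow> F \<subseteq> closure (fminus Th F)"
  using facet face_plus face_minus by blast+

lemma face_Int_borel:
  assumes "F \<in> faces Th" "closed \<Gamma>"
  shows "finite_borel surf (F \<inter> \<Gamma>)"
proof -
  have F: "finite_borel surf F" by (rule face_borel[OF assms(1)])
  have "emeasure surf (F \<inter> \<Gamma>) \<le> emeasure surf F"
    using F by (intro emeasure_mono) (auto simp: finite_borel_def)
  then show ?thesis using F assms(2) by (auto simp: finite_borel_def borel_closed intro: order_le_less_trans)
qed

lemma hF_pos: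
  assumes "F \<in> faces Th"
  shows "hF S Th F > 0"
proof -
  have pos: "measure lebesgue K > 0" if "K \<in> cells Th" for K
  proof -
    have l: "K \<in> lmeasurable" using cell_props(2,4)[OF that] by (intro lmeasurable_open)
    have "\<not> negligible K" using cell_props(2,5)[OF that] by (intro open_not_negligible)
    then have "measure lebesgue K \<noteq> 0" using l by (simp add: negligible_iff_measure0)
    then show ?thesis using measure_nonneg[of lebesgue K] by linarith
  qed
  show ?thesis
    using pos face_plus[OF assms] face_minus[OF assms] by (auto simp: hF_def intro!: add_pos_pos divide_pos_pos)
qed

lemma fb_outer_normal: "fb A (outer_normal U)" and fb_nrm: "fb A (nrm S)"
  unfolding nrm_def by (rule fb_measurable[OF outer_normal_measurable norm_outer_normal_le])+

subsection \<open>The finite element spaces\<close>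

text \<open>The values on the cells, recorded by \<open>T\<close> in reference coordinates,
  determine the function; there it is a combination of the finitely many monomials \<open>e\<close>,
  one for each cell, component and exponent.\<close>

lemma finite_dimensional:
  fixes V :: "(real^'n \<Rightarrow> 'b::euclidean_space) set"
  assumes V: "subspace V"
    and poly: "\<And>v K b. v \<in> V \<Longrightarrow> K \<in> cells Th \<Longrightarrow> b \<in> Basis \<Longrightarrow> \<exists>q\<in>polyQ r. \<forall>y\<in>box 0 1. v (cmap Th K y) \<bullet> b = q y"
    and zero: "\<And>v. v \<in> V \<Longrightarrow> (\<And>K x. K \<in> cells Th \<Longrightarrow> x \<in> K \<Longrightarrow> v x = 0) \<Longrightarrow> v = 0"
  shows "findim V"
proof -
  define T :: "(real^'n \<Rightarrow> 'b) \<Rightarrow> (real^'n) set \<times> 'b \<times> (real^'n) \<Rightarrow> real"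
    where "T v = (\<lambda>(K, b, y). if K \<in> cells Th \<and> b \<in> Basis \<and> y \<in> box 0 1 then v (cmap Th K y) \<bullet> b else 0)" for v
  define e :: "(real^'n) set \<times> 'b \<times> ('n \<Rightarrow> nat) \<Rightarrow> (real^'n) set \<times> 'b \<times> (real^'n) \<Rightarrow> real"
    where "e = (\<lambda>(K', b', m) (K, b, y). if K = K' \<and> b = b' \<and> y \<in> box 0 1 then \<Prod>i\<in>UNIV. y $ i ^ m i else 0)"
  define I where "I = cells Th \<times> (Basis :: 'b set) \<times> {m :: 'n \<Rightarrow> nat. \<forall>i. m i \<le> r}"
  have T: "linear T" by (intro linearI) (auto simp: T_def fun_eq_iff inner_add_left)
  have inj: "inj_on T V"
  proof (rule inj_onI)
    fix v w assume vw: "v \<in> V" "w \<in> V" "T v = T w"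
    have "v - w = 0"
    proof (rule zero)
      show "v - w \<in> V" using vw V by (simp add: subspace_diff)
      fix K x assume K: "K \<in> cells Th" "x \<in> K"
      then obtain y where y: "y \<in> box 0 1" "x = cmap Th K y" using cell_props(8)[OF K(1)] by blast
      have "v x \<bullet> b = w x \<bullet> b" if "b \<in> Basis" for b
        using fun_cong[OF vw(3), of "(K, b, y)"] K y that by (simp add: T_def)
      then have "v x = w x" by (rule euclidean_eqI)
      then show "(v - w) x = 0" by simp
    qed
    then show "v = w" by simp
  qed
  have "T v \<in> span (e ` I)" if v: "v \<in> V" for v
  proof -
    have ex: "\<exists>c. \<forall>y\<in>box 0 1. v (cmap Th K y) \<bullet> b = (\<Sum>m | \<forall>i. m i \<le> r. c m * (\<Prod>i\<in>UNIV. y $ i ^ m i))"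
      if "K \<in> cells Th" "b \<in> Basis" for K b
    proof -
      obtain q where q: "q \<in> polyQ r" "\<forall>y\<in>box 0 1. v (cmap Th K y) \<bullet> b = q y" 
        using poly[OF v \<open>K \<in> cells Th\<close> \<open>b \<in> Basis\<close>] by blast
      then obtain c where "\<forall>y. q y = (\<Sum>m | \<forall>i. m i \<le> r. c m * (\<Prod>i\<in>UNIV. y $ i ^ m i))"
        unfolding polyQ_def by blast
      then show ?thesis using q(2) by (intro exI[of _ c]) simp
    qed
    define c where "c K b = (SOME c. \<forall>y\<in>box 0 1. v (cmap Th K y) \<bullet> b
        = (\<Sum>m | \<forall>i. m i \<le> r. c m * (\<Prod>i\<in>UNIV. y $ i ^ m i)))" for K b
    have c: "v (cmap Th K y) \<bullet> b = (\<Sum>m | \<forall>i. m i \<le> r. c K b m * (\<Prod>i\<in>UNIV. y $ i ^ m i))"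
      if "K \<in> cells Th" "b \<in> Basis" "y \<in> box 0 1" for K b y
      using someI_ex[OF ex[OF that(1,2)]] that(3) unfolding c_def by blast
    have "T v = (\<Sum>K\<in>cells Th. \<Sum>b\<in>Basis. \<Sum>m | \<forall>i. m i \<le> r. c K b m *\<^sub>R e (K, b, m))"
    proof (rule ext, clarify)
      fix K b y
      let ?s = "\<lambda>K' b'. \<Sum>m | \<forall>i. m i \<le> r. c K' b' m * e (K', b', m) (K, b, y)"
      \<comment> \<open>At a given argument only the monomials of its own cell and component
        contribute.\<close>
      have e0: "e (K', b', m) (K, b, y) = 0" if "K' \<noteq> K \<or> b' \<noteq> b" for K' b' m
        using that by (cases "K = K'") (simp_all add: e_def)
      have s0: "?s K' b' = 0" if "K' \<noteq> K \<or> b' \<noteq> b" for K' b'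
        using e0[OF that] by simp
      have "(\<Sum>K'\<in>cells Th. \<Sum>b'\<in>Basis. ?s K' b') = (if K \<in> cells Th \<and> b \<in> Basis then ?s K b else 0)"
      proof -
        have 1: "(\<Sum>b'\<in>Basis. ?s K' b') = (if b \<in> Basis then ?s K' b else 0)" for K'
        proof -
          have "(\<Sum>b'\<in>Basis. ?s K' b') = (\<Sum>b'\<in>Basis. if b' = b then ?s K' b' else 0)"
            by (intro sum.cong refl) (simp add: s0)
          then show ?thesis by (simp add: sum.delta)
        qed
        have "(\<Sum>K'\<in>cells Th. if b \<in> Basis then ?s K' b else 0)
            = (\<Sum>K'\<in>cells Th. if K' = K then (if b \<in> Basis then ?s K' b else 0) else 0)"
          by (intro sum.cong refl) (simp add: s0)
        then show ?thesis unfolding 1 using finite_cells by (simp add: sum.delta)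
      qed
      also have "\<dots> = T v (K, b, y)" using c[of K b y] by (auto simp: T_def e_def)
      finally show "T v (K, b, y) = (\<Sum>K\<in>cells Th. \<Sum>b\<in>Basis. \<Sum>m | \<forall>i. m i \<le> r. c K b m *\<^sub>R e (K, b, m)) (K, b, y)"
        by simp
    qed
    also have "\<dots> \<in> span (e ` I)"
      by (intro span_sum span_scale span_base) (auto simp: I_def)
    finally show ?thesis .
  qed
  moreover have "finite (e ` I)" 
    unfolding I_def by (intro finite_imageI finite_SigmaI finite_cells finite_Basis finite_multi_indices)
  ultimately show ?thesis by (intro findim_linear_inj[OF V T inj]) auto
qed

end


lemma H1_lincomb:
  fixes v w :: "real^'n \<Rightarrow> real"
  assumes \<Omega>: "open \<Omega>" "bounded \<Omega>" and v: "H1 \<Omega> v" and w: "H1 \<Omega> w"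
  shows "H1 \<Omega> (\<lambda>x. a * v x + b * w x)"
proof -
  obtain g where v2: "L2_on lebesgue \<Omega> v" and g: "L2_on lebesgue \<Omega> g"
    and vg: "\<And>\<phi> i. test_function \<Omega> \<phi> \<Longrightarrow> (LINT x:\<Omega>|lebesgue. v x * grad \<phi> x $ i) = - (LINT x:\<Omega>|lebesgue. g x $ i * \<phi> x)"
    using v unfolding H1_def by blast
  obtain h where w2: "L2_on lebesgue \<Omega> w" and h: "L2_on lebesgue \<Omega> h"
    and wh: "\<And>\<phi> i. test_function \<Omega> \<phi> \<Longrightarrow> (LINT x:\<Omega>|lebesgue. w x * grad \<phi> x $ i) = - (LINT x:\<Omega>|lebesgue. h x $ i * \<phi> x)"
    using w unfolding H1_def by blast
  have fin: "finite_borel lebesgue \<Omega>" by (intro opn.finite_borel_K opn.intro \<Omega>)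
  have "(LINT x:\<Omega>|lebesgue. (a * v x + b * w x) * grad \<phi> x $ i) = - (LINT x:\<Omega>|lebesgue. (a *\<^sub>R g x + b *\<^sub>R h x) $ i * \<phi> x)"
    if \<phi>: "test_function \<Omega> \<phi>" for \<phi> i
  proof -
    have cl: "compact (closure \<Omega>)" using \<Omega>(2) by simp
    have "continuous_on UNIV (\<lambda>x. grad \<phi> x $ i)" using \<phi> by (auto simp: test_function_def intro!: continuous_intros)
    then have fg: "fb \<Omega> (\<lambda>x. grad \<phi> x $ i)"
      using fb_continuous[OF continuous_on_subset cl closure_subset] by blast
    have "continuous_on UNIV \<phi>"
      using \<phi> by (auto simp: test_function_def intro!: continuous_at_imp_continuous_on differentiable_imp_continuous_within)
    \<comment> \<open>The test function is placed in the direction \<open>axis i 1\<close>, so that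
      its inner product with a vector field picks out component \<open>i\<close>.\<close>
    then have "continuous_on (closure \<Omega>) (\<lambda>x. \<phi> x *\<^sub>R axis i (1::real))"
      by (intro continuous_intros) (auto intro: continuous_on_subset)
    then have f\<phi>: "fb \<Omega> (\<lambda>x. \<phi> x *\<^sub>R axis i (1::real))"
      by (rule fb_continuous[OF _ cl closure_subset])
    have i1: "set_integrable lebesgue \<Omega> (\<lambda>x. v x * grad \<phi> x $ i)" "set_integrable lebesgue \<Omega> (\<lambda>x. w x * grad \<phi> x $ i)"
      using set_integrable_fb_mult[OF fin set_integrable_L2[OF fin v2 order_refl] fg]
        set_integrable_fb_mult[OF fin set_integrable_L2[OF fin w2 order_refl] fg] by simp_all
    have i2: "set_integrable lebesgue \<Omega> (\<lambda>x. g x $ i * \<phi> x)" "set_integrable lebesgue \<Omega> (\<lambda>x. h x $ i * \<phi> x)"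
      using set_integrable_fb_mult[OF fin set_integrable_L2[OF fin g order_refl] f\<phi>]
        set_integrable_fb_mult[OF fin set_integrable_L2[OF fin h order_refl] f\<phi>] by (simp_all add: inner_axis mult.commute)
    have "(LINT x:\<Omega>|lebesgue. (a * v x + b * w x) * grad \<phi> x $ i)
        = (LINT x:\<Omega>|lebesgue. a * (v x * grad \<phi> x $ i) + b * (w x * grad \<phi> x $ i))"
      by (intro set_integral_cong') (simp add: algebra_simps)
    also have "\<dots> = a * (LINT x:\<Omega>|lebesgue. v x * grad \<phi> x $ i) + b * (LINT x:\<Omega>|lebesgue. w x * grad \<phi> x $ i)"
      using i1 by simp
    also have "\<dots> = - (a * (LINT x:\<Omega>|lebesgue. g x $ i * \<phi> x) + b * (LINT x:\<Omega>|lebesgue. h x $ i * \<phi> x))"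
      by (simp add: vg[OF \<phi>] wh[OF \<phi>])
    also have "a * (LINT x:\<Omega>|lebesgue. g x $ i * \<phi> x) + b * (LINT x:\<Omega>|lebesgue. h x $ i * \<phi> x)
        = (LINT x:\<Omega>|lebesgue. a * (g x $ i * \<phi> x) + b * (h x $ i * \<phi> x))"
      using i2 by simp
    also have "\<dots> = (LINT x:\<Omega>|lebesgue. (a *\<^sub>R g x + b *\<^sub>R h x) $ i * \<phi> x)"
      by (intro set_integral_cong') (simp add: algebra_simps)
    finally show ?thesis .
  qed
  then show ?thesis
    using L2_on_lincomb[OF v2 w2, of a b] L2_on_lincomb[OF g h, of a b] unfolding H1_def
    by (auto intro!: exI[of _ "\<lambda>x. a *\<^sub>R g x + b *\<^sub>R h x"])
qed

lemma L2_on_0: "L2_on M A (\<lambda>x. 0)"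
  by (simp add: L2_on_def set_borel_measurable_def)

lemma H1_0: "H1 \<Omega> (\<lambda>x. 0)"
  unfolding H1_def by (auto intro!: exI[of _ "\<lambda>x. 0"] L2_on_0 simp: set_lebesgue_integral_def)

lemma polyQ_0: "(\<lambda>x. 0) \<in> polyQ r"
  unfolding polyQ_def by (auto intro!: exI[of _ "\<lambda>m. 0"])

lemma polyP_0: "(\<lambda>x. 0) \<in> polyP r"
  unfolding polyP_def by (auto intro!: exI[of _ "\<lambda>m. 0"])

lemma subspace_lincombI:
  assumes "0 \<in> V" "\<And>v w a b. v \<in> V \<Longrightarrow> w \<in> V \<Longrightarrow> a *\<^sub>R v + b *\<^sub>R w \<in> V"
  shows "subspace V"
  using assms(1) assms(2)[of _ _ 1 1] assms(2)[of _ 0 _ 0] by (intro subspaceI) auto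

text \<open>Brings strain, stress and divergence back to the Jacobian, and the flux back to the
  gradient.\<close>

lemma vop_linear:
  assumes "vop K V f" "linear \<phi>"
  shows "vop K V (\<lambda>v x. \<phi> (f v x))"
proof -
  have "continuous_on UNIV \<phi>" using assms(2) by (simp add: linear_continuous_on linear_conv_bounded_linear)
  then show ?thesis
    using assms by (auto simp: vop_def pw_lin_def cext_compose linear_add linear_scale)
qed

context fe
begin

section \<open>Linear structure and finite dimension of the discrete spaces\<close>

lemma Vh_poly: "v \<in> Vh S Th r \<Longrightarrow> K \<in> cells Th \<Longrightarrow> \<exists>q\<in>polyQ r. \<forall>y\<in>box 0 1. v (cmap Th K y) $ j = q y"
  by (simp add: Vh_def)

lemma Vh_lincomb:
  assumes v: "v \<in> Vh S Th r" and w: "w \<in> Vh S Th r"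
  shows "a *\<^sub>R v + b *\<^sub>R w \<in> Vh S Th r"
proof -
  have "H1 (dom S) (\<lambda>x. (a *\<^sub>R v + b *\<^sub>R w) x $ j)" for j
    using H1_lincomb[OF open_dom bounded_dom, of "\<lambda>x. v x $ j" "\<lambda>x. w x $ j" a b] v w by (simp add: Vh_def)
  moreover have "continuous_on (closure (dom S)) (a *\<^sub>R v + b *\<^sub>R w)"
    unfolding plus_fun_def scaleR_fun_def using v w by (intro continuous_intros) (auto simp: Vh_def)
  moreover have "\<exists>q\<in>polyQ r. \<forall>y\<in>box 0 1. (a *\<^sub>R v + b *\<^sub>R w) (cmap Th K y) $ j = q y" if K: "K \<in> cells Th" for K j
  proof -
    obtain p where p: "p \<in> polyQ r" "\<forall>y\<in>box 0 1. v (cmap Th K y) $ j = p y" using Vh_poly[OF v K] by blast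
    obtain q where q: "q \<in> polyQ r" "\<forall>y\<in>box 0 1. w (cmap Th K y) $ j = q y" using Vh_poly[OF w K] by blast
    show ?thesis using p(2) q(2) by (intro bexI[OF _ polyQ_lincomb[OF p(1) q(1), of a b]]) simp
  qed
  ultimately show ?thesis using v w by (simp add: Vh_def)
qed

lemma subspace_Vh: "subspace (Vh S Th r)"
proof (rule subspace_lincombI)
  show "0 \<in> Vh S Th r"
    using H1_0 polyQ_0 by (auto simp: Vh_def zero_fun_def intro!: bexI[of _ "\<lambda>x. 0"])
qed (rule Vh_lincomb)

lemma Qh_poly:
  assumes "q \<in> Qh S Th r ch" "K \<in> cells Th"
  shows "\<exists>p\<in>polyQ (r - 1). \<forall>y\<in>box 0 1. q (cmap Th K y) = p y"
  using assms polyP_subset_polyQ by (cases ch) (auto simp: subset_iff, blast)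

lemma Qh_lincomb:
  assumes v: "v \<in> Qh S Th r ch" and w: "w \<in> Qh S Th r ch"
  shows "a *\<^sub>R v + b *\<^sub>R w \<in> Qh S Th r ch"
proof (cases ch)
  case Continuous
  have "continuous_on (closure (dom S)) (a *\<^sub>R v + b *\<^sub>R w)"
    unfolding plus_fun_def scaleR_fun_def using v w Continuous by (intro continuous_intros) auto
  moreover have "\<exists>q\<in>polyQ (r - 1). \<forall>y\<in>box 0 1. (a *\<^sub>R v + b *\<^sub>R w) (cmap Th K y) = q y" if K: "K \<in> cells Th" for K
  proof -
    obtain p where p: "p \<in> polyQ (r - 1)" "\<forall>y\<in>box 0 1. v (cmap Th K y) = p y" using v K Continuous by auto
    obtain q where q: "q \<in> polyQ (r - 1)" "\<forall>y\<in>box 0 1. w (cmap Th K y) = q y" using w K Continuous by auto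
    show ?thesis using p(2) q(2) by (intro bexI[OF _ polyQ_lincomb[OF p(1) q(1), of a b]]) simp
  qed
  ultimately show ?thesis using v w Continuous by simp
next
  case Discontinuous
  have "L2_on lebesgue (dom S) (a *\<^sub>R v + b *\<^sub>R w)"
    unfolding plus_fun_def scaleR_fun_def using v w Discontinuous by (intro L2_on_lincomb) auto
  moreover have "\<exists>q\<in>polyP (r - 1). \<forall>y\<in>box 0 1. (a *\<^sub>R v + b *\<^sub>R w) (cmap Th K y) = q y" if K: "K \<in> cells Th" for K
  proof -
    obtain p where p: "p \<in> polyP (r - 1)" "\<forall>y\<in>box 0 1. v (cmap Th K y) = p y" using v K Discontinuous by auto
    obtain q where q: "q \<in> polyP (r - 1)" "\<forall>y\<in>box 0 1. w (cmap Th K y) = q y" using w K Discontinuous by auto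
    show ?thesis using p(2) q(2) by (intro bexI[OF _ polyP_lincomb[OF p(1) q(1), of a b]]) simp
  qed
  ultimately show ?thesis using v w Discontinuous by simp
qed

lemma subspace_Qh: "subspace (Qh S Th r ch)"
proof (rule subspace_lincombI)
  show "0 \<in> Qh S Th r ch"
    using L2_on_0 polyQ_0 polyP_0 by (cases ch) (auto simp: zero_fun_def intro!: bexI[of _ "\<lambda>x. 0"])
qed (rule Qh_lincomb)

text \<open>The closures of the cells cover the closed domain, so continuity carries the value 0
  from the cells to all of it.\<close>

lemma continuous_zero:
  fixes v :: "real^'n \<Rightarrow> 'b::real_normed_vector"
  assumes "continuous_on (closure (dom S)) v" "\<And>x. x \<notin> closure (dom S) \<Longrightarrow> v x = 0"
    "\<And>K x. K \<in> cells Th \<Longrightarrow> x \<in> K \<Longrightarrow> v x = 0"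
  shows "v = 0"
proof
  fix x
  show "v x = 0 x"
  proof (cases "x \<in> closure (dom S)")
    case True
    then obtain K where K: "K \<in> cells Th" "x \<in> closure K" using closures by blast
    have "continuous_on (closure K) v" by (rule continuous_on_subset[OF assms(1) closure_cell_subset[OF K(1)]])
    then show ?thesis using continuous_constant_on_closure[of K v 0 x] assms(3)[OF K(1)] K(2) by simp
  qed (use assms(2) in simp)
qed

lemma Vh_zero: "v \<in> Vh S Th r \<Longrightarrow> (\<And>K x. K \<in> cells Th \<Longrightarrow> x \<in> K \<Longrightarrow> v x = 0) \<Longrightarrow> v = 0"
  by (rule continuous_zero) (auto simp: Vh_def)

text \<open>For discontinuous pressures, the normalisation outside the open cells takes the place of
  continuity.\<close>

lemma Qh_zero:
  assumes "q \<in> Qh S Th r ch" "\<And>K x. K \<in> cells Th \<Longrightarrow> x \<in> K \<Longrightarrow> q x = 0"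
  shows "q = 0"
proof (cases ch)
  case Continuous
  then show ?thesis using assms by (intro continuous_zero) auto
next
  case Discontinuous
  have "q x = 0" for x
    by (cases "x \<in> \<Union>(cells Th)") (use assms Discontinuous in auto)
  then show ?thesis by (simp add: fun_eq_iff)
qed

lemma findim_Vh: "findim (Vh S Th r)"
proof (rule finite_dimensional[OF subspace_Vh])
  fix v K and b :: "real^'n" assume "v \<in> Vh S Th r" "K \<in> cells Th" "b \<in> Basis"
  then show "\<exists>q\<in>polyQ r. \<forall>y\<in>box 0 1. v (cmap Th K y) \<bullet> b = q y"
    by (auto simp: Vh_def Basis_vec_def inner_axis)
qed (rule Vh_zero)

lemma findim_Qh: "findim (Qh S Th r ch)"
proof (rule finite_dimensional[OF subspace_Qh])
  fix q K and b :: real assume "q \<in> Qh S Th r ch" "K \<in> cells Th" "b \<in> Basis"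
  then show "\<exists>p\<in>polyQ (r - 1). \<forall>y\<in>box 0 1. q (cmap Th K y) \<bullet> b = p y"
    using Qh_poly[of q r ch K] by simp
qed (rule Qh_zero)

section \<open>Differential operators on cells\<close>

lemma Vh_creg: "v \<in> Vh S Th r \<Longrightarrow> K \<in> cells Th \<Longrightarrow> creg K (\<lambda>x. v x $ j)"
  by (rule cell_creg[OF _ Vh_poly])

lemma Qh_creg: "q \<in> Qh S Th r ch \<Longrightarrow> K \<in> cells Th \<Longrightarrow> creg K q"
  by (rule cell_creg[OF _ Qh_poly])

lemma vop_Vh: assumes K: "K \<in> cells Th" shows "vop K (Vh S Th r) (\<lambda>v. v)"
proof -
  have "cext K v" if v: "v \<in> Vh S Th r" for v
    using cext_vec[of K "\<lambda>x j. v x $ j"] Vh_creg[OF v K] by (simp add: creg_def)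
  then show ?thesis by (auto simp: vop_def pw_lin_def)
qed

lemma vop_Qh: assumes K: "K \<in> cells Th" shows "vop K (Qh S Th r ch) (\<lambda>q. q)"
  using Qh_creg[OF _ K] by (auto simp: vop_def pw_lin_def creg_def)

lemma vop_jacobian: assumes K: "K \<in> cells Th" shows "vop K (Vh S Th r) (\<lambda>v x. jacobian v (at x))"
proof -
  have j: "jacobian v (at x) = (\<chi> i. grad (\<lambda>x. v x $ i) x)" if "v \<in> Vh S Th r" "x \<in> K" for v x
    using Vh_creg[OF that(1) K] that(2) by (intro jacobian_eq(2)) (auto simp: creg_def)
  have "cext K (\<lambda>x. jacobian v (at x))" if v: "v \<in> Vh S Th r" for v
    by (rule cext_cong[OF cext_vec[of K "\<lambda>x i. grad (\<lambda>x. v x $ i) x"]])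
      (use Vh_creg[OF v K] j[OF v] in \<open>auto simp: creg_def\<close>)
  moreover have "jacobian (a *\<^sub>R v + b *\<^sub>R w) (at x) = a *\<^sub>R jacobian v (at x) + b *\<^sub>R jacobian w (at x)"
    if vw: "v \<in> Vh S Th r" "w \<in> Vh S Th r" "x \<in> K" for a b v w x
  proof -
    have "grad (\<lambda>x. a * v x $ i + b * w x $ i) x = a *\<^sub>R grad (\<lambda>x. v x $ i) x + b *\<^sub>R grad (\<lambda>x. w x $ i) x" for i
      using Vh_creg[OF vw(1) K] Vh_creg[OF vw(2) K] vw(3) by (intro grad_lincomb) (auto simp: creg_def)
    then show ?thesis
      unfolding j[OF vw(1,3)] j[OF vw(2,3)] j[OF Vh_lincomb[OF vw(1,2)] vw(3)] by (simp add: vec_eq_iff)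
  qed
  ultimately show ?thesis by (simp add: vop_def pw_lin_def)
qed

lemma vop_strain: "K \<in> cells Th \<Longrightarrow> vop K (Vh S Th r) strain"
proof -
  assume K: "K \<in> cells Th"
  have "linear (\<lambda>J :: real^'n^'n. (1/2) *\<^sub>R (J + transpose J))"
    by (intro linearI) (simp_all add: vec_eq_iff transpose_def algebra_simps)
  from vop_linear[OF vop_jacobian[OF K] this] show ?thesis by (simp add: strain_def[abs_def])
qed

lemma vop_stress: "K \<in> cells Th \<Longrightarrow> vop K (Vh S Th r) (stress S)"
proof -
  assume K: "K \<in> cells Th"
  have "linear (\<lambda>E :: real^'n^'n. (\<chi> i j. \<Sum>k\<in>UNIV. \<Sum>l\<in>UNIV. Ct S i j k l * E$k$l) :: real^'n^'n)"
    by (intro linearI) (simp_all add: vec_eq_iff algebra_simps sum.distrib sum_distrib_left)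
  from vop_linear[OF vop_strain[OF K] this] show ?thesis by (simp add: stress_def[abs_def])
qed

lemma vop_div: "K \<in> cells Th \<Longrightarrow> vop K (Vh S Th r) div_of"
proof -
  assume K: "K \<in> cells Th"
  have "linear (trace :: real^'n^'n \<Rightarrow> real)"
    by (intro linearI) (simp_all add: trace_def sum.distrib sum_distrib_left)
  from vop_linear[OF vop_jacobian[OF K] this] show ?thesis by (simp add: div_of_def[abs_def])
qed

lemma vop_grad: assumes K: "K \<in> cells Th" shows "vop K (Qh S Th r ch) grad"
proof -
  have "grad (a *\<^sub>R v + b *\<^sub>R w) x = a *\<^sub>R grad v x + b *\<^sub>R grad w x"
    if vw: "v \<in> Qh S Th r ch" "w \<in> Qh S Th r ch" "x \<in> K" for a b v w x
    using grad_lincomb[of v x w a b] Qh_creg[OF vw(1) K] Qh_creg[OF vw(2) K] vw(3)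
    by (simp add: creg_def plus_fun_def scaleR_fun_def)
  then show ?thesis using Qh_creg[OF _ K] by (simp add: vop_def pw_lin_def creg_def)
qed

lemma vop_flux: "K \<in> cells Th \<Longrightarrow> vop K (Qh S Th r ch) (flux S)"
  using vop_linear[OF vop_grad matrix_vector_mul_linear[of "Kp S"]] by (simp add: flux_def[abs_def])

text \<open>Continuous functions enter the boundary terms by value rather than by trace; they are
  bounded because the closed domain is compact.\<close>

lemma fop_Vh: "A \<subseteq> closure (dom S) \<Longrightarrow> fop A (Vh S Th r) (\<lambda>v. v)"
  using fb_continuous[OF _ compact_closure_dom] by (auto simp: fop_def pw_lin_def Vh_def)

lemma fop_Qh: "A \<subseteq> closure (dom S) \<Longrightarrow> fop A (Qh S Th r Continuous) (\<lambda>q. q)"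
  using fb_continuous[OF _ compact_closure_dom] by (auto simp: fop_def pw_lin_def)

section \<open>Inner products over the domain\<close>

lemma ip_dom_lincomb:
  fixes f1 f2 h :: "real^'n \<Rightarrow> 'b::euclidean_space"
  assumes "\<And>K. K \<in> cells Th \<Longrightarrow> cext K f1" "\<And>K. K \<in> cells Th \<Longrightarrow> cext K f2" "\<And>K. K \<in> cells Th \<Longrightarrow> cext K h"
  shows "ip (dom S) (\<lambda>x. a *\<^sub>R f1 x + b *\<^sub>R f2 x) h = a * ip (dom S) f1 h + b * ip (dom S) f2 h"
proof -
  have "ip K (\<lambda>x. a *\<^sub>R f1 x + b *\<^sub>R f2 x) h = a * ip K f1 h + b * ip K f2 h" if K: "K \<in> cells Th" for K
    using set_integrable_fb[OF finite_borel_cell[OF K] fb_inner[OF fb_cell[OF K assms(1)[OF K]] fb_cell[OF K assms(3)[OF K]]]]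
      set_integrable_fb[OF finite_borel_cell[OF K] fb_inner[OF fb_cell[OF K assms(2)[OF K]] fb_cell[OF K assms(3)[OF K]]]]
    by (simp add: ip_def inner_add_left)
  then show ?thesis
    using ip_dom[OF cext_lincomb[OF assms(1,2)] assms(3), of a b] ip_dom[OF assms(1,3)] ip_dom[OF assms(2,3)]
    by (simp add: sum.distrib sum_distrib_left)
qed

lemma ip_dom_lin:
  fixes f :: "real^'n \<Rightarrow> 'b::euclidean_space"
  assumes "subspace W" "\<And>K. K \<in> cells Th \<Longrightarrow> cext K f" "\<And>K. K \<in> cells Th \<Longrightarrow> vop K W h"
  shows "lin_on W (\<lambda>w. ip (dom S) f (h w))"
proof (rule lin_onI)
  fix v w a b assume vw: "v \<in> W" "w \<in> W"
  have c: "cext K (h u)" if "K \<in> cells Th" "u \<in> W" for K u using assms(3) that by (auto simp: vop_def)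
  have W: "a *\<^sub>R v + b *\<^sub>R w \<in> W" using vw assms(1) by (simp add: subspace_add subspace_scale)
  have "ip K f (h (a *\<^sub>R v + b *\<^sub>R w)) = a * ip K f (h v) + b * ip K f (h w)" if K: "K \<in> cells Th" for K
  proof -
    have "ip K f (h (a *\<^sub>R v + b *\<^sub>R w)) = (LINT x:K|lebesgue. a * (f x \<bullet> h v x) + b * (f x \<bullet> h w x))"
      unfolding ip_def using assms(3)[OF K] vw
      by (intro set_integral_cong') (simp add: vop_def pw_lin_def inner_add_right)
    also have "\<dots> = a * ip K f (h v) + b * ip K f (h w)"
      using set_integrable_fb[OF finite_borel_cell[OF K] fb_inner[OF fb_cell[OF K assms(2)[OF K]] fb_cell[OF K c[OF K vw(1)]]]]
        set_integrable_fb[OF finite_borel_cell[OF K] fb_inner[OF fb_cell[OF K assms(2)[OF K]] fb_cell[OF K c[OF K vw(2)]]]]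
      by (simp add: ip_def)
    finally show ?thesis .
  qed
  then show "ip (dom S) f (h (a *\<^sub>R v + b *\<^sub>R w)) = a * ip (dom S) f (h v) + b * ip (dom S) f (h w)"
    using ip_dom[OF assms(2) c[OF _ W]] ip_dom[OF assms(2) c[OF _ vw(1)]] ip_dom[OF assms(2) c[OF _ vw(2)]]
    by (simp add: sum.distrib sum_distrib_left)
qed

lemma psd_ip:
  fixes V :: "(real^'n \<Rightarrow> 'b::euclidean_space) set"
  assumes V: "subspace V" and "\<And>K. K \<in> cells Th \<Longrightarrow> vop K V (\<lambda>v. v)"
  shows "psd_on V (ip (dom S))"
  unfolding psd_on_def
proof (intro conjI ballI)
  show "bilin_on V V (ip (dom S))" by (rule ip_dom_bilin[OF V V assms(2) assms(2)])
  show "ip (dom S) v w = ip (dom S) w v" for v w :: "real^'n \<Rightarrow> 'b" by (simp add: ip_def inner_commute)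
  show "ip (dom S) v v \<ge> 0" for v :: "real^'n \<Rightarrow> 'b" unfolding ip_def by (intro set_integral_nonneg') simp
qed

lemma ip_definite:
  fixes V :: "(real^'n \<Rightarrow> 'b::euclidean_space) set"
  assumes "\<And>K. K \<in> cells Th \<Longrightarrow> vop K V (\<lambda>v. v)" "v \<in> V" "ip (dom S) v v = 0" "K \<in> cells Th" "x \<in> K"
  shows "v x = 0"
  using ip_cell_zero[of v v K x] assms by (auto simp: vop_def)

end


section \<open>The forms and functionals of the scheme\<close>

lemma inner_matrix: "(A :: real^'n^'m) \<bullet> B = (\<Sum>i\<in>UNIV. \<Sum>j\<in>UNIV. A$i$j * B$i$j)"
  by (simp add: inner_vec_def)

lemma vop_cext: "vop K V f \<Longrightarrow> v \<in> V \<Longrightarrow> cext K (f v)"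
  by (simp add: vop_def)

context fe
begin

lemma closed_GDu: "closed (GDu S)" and closed_GDp: "closed (GDp S)"
  and \<rho>_pos: "rho S > 0" and c0_pos: "c0 S > 0"
  using S by (auto simp: valid_setting_def)

lemma bface: "F \<in> bfaces S Th \<Longrightarrow> F \<in> faces Th"
  by (simp add: bfaces_def)

section \<open>Traces, averages, jumps and normal fluxes on faces\<close>

lemma face_Int_closure: "F \<in> faces Th \<Longrightarrow> F \<inter> \<Gamma> \<subseteq> closure (dom S)"
  using face_closure_plus closure_cell_subset face_plus by blast

lemma fop_btr:
  assumes "F \<in> faces Th" "A \<subseteq> F" "\<And>K. K \<in> cells Th \<Longrightarrow> vop K V f"
  shows "fop A V (\<lambda>v. btr Th F (f v))"
  unfolding btr_def using assms face_plus face_closure_plus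
  by (intro fop_tr) blast+

lemma fop_traction: "F \<in> faces Th \<Longrightarrow> A \<subseteq> F \<Longrightarrow> fop A (Vh S Th r) (\<lambda>v x. btr Th F (stress S v) x *v nrm S x)"
  by (intro fop_matrix_vector fop_btr vop_stress fb_nrm)

lemma fop_normal_flux: "F \<in> faces Th \<Longrightarrow> A \<subseteq> F \<Longrightarrow> fop A (Qh S Th r ch) (\<lambda>q x. btr Th F (flux S q) x \<bullet> nrm S x)"
  by (intro fop_inner fop_btr vop_flux fb_nrm)

lemma fop_avg:
  assumes F: "F \<in> faces Th" and A: "A \<subseteq> F" and f: "\<And>K. K \<in> cells Th \<Longrightarrow> vop K V f"
  shows "fop A V (\<lambda>v. avg S Th F (f v))"
proof (cases "F \<in> bfaces S Th")
  case True
  then show ?thesis using fop_btr[OF F A f] by (simp add: avg_def[abs_def] btr_def)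
next
  case False
  have "fop A V (\<lambda>v. tr (fplus Th F) (f v))" "fop A V (\<lambda>v. tr (fminus Th F) (f v))"
    using face_plus[OF F] face_minus[OF F False] face_closure_plus[OF F] face_closure_minus[OF F False] A f
    by (intro fop_tr; blast)+
  from fop_lincomb[OF this, of "1/2" "1/2"] show ?thesis
    using False by (simp add: avg_def[abs_def] scaleR_add_right)
qed

lemma fop_jump:
  assumes F: "F \<in> faces Th" and A: "A \<subseteq> F" and f: "\<And>K. K \<in> cells Th \<Longrightarrow> vop K V f"
  shows "fop A V (\<lambda>v. jump S Th F (f v))"
proof (cases "F \<in> bfaces S Th")
  case True
  then show ?thesis using fop_btr[OF F A f] by (simp add: jump_def[abs_def] btr_def)
next
  case False
  have "fop A V (\<lambda>v. tr (fplus Th F) (f v))" "fop A V (\<lambda>v. tr (fminus Th F) (f v))"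
    using face_plus[OF F] face_minus[OF F False] face_closure_plus[OF F] face_closure_minus[OF F False] A f
    by (intro fop_tr; blast)+
  from fop_lincomb[OF this, of 1 "-1"] show ?thesis
    using False by (simp add: jump_def[abs_def])
qed

lemma fb_fnormal: "fb A (fnormal S Th F)"
  using fb_nrm[of A] fb_outer_normal[of A "fplus Th F"] by (cases "F \<in> bfaces S Th") (simp_all add: fnormal_def[abs_def])

lemma fop_avg_flux:
  "F \<in> faces Th \<Longrightarrow> A \<subseteq> F \<Longrightarrow> fop A (Qh S Th r ch) (\<lambda>q x. avg S Th F (flux S q) x \<bullet> fnormal S Th F x)"
  by (intro fop_inner fop_avg vop_flux fb_fnormal)

lemma bilin_on_surf:
  fixes f :: "'v::real_vector \<Rightarrow> real^'n \<Rightarrow> 'b::euclidean_space" and h :: "'w::real_vector \<Rightarrow> real^'n \<Rightarrow> 'b"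
  assumes "finite_borel surf A" "fop A V f" "fop A W h"
  shows "bilin_on V W (\<lambda>v w. LINT x:A|surf. f v x \<bullet> h w x)"
  using assms by (intro bilin_on_integral) (auto simp: fop_def)

lemma lin_on_surf:
  fixes w :: "real^'n \<Rightarrow> 'b::euclidean_space"
  assumes "finite_borel surf A" "set_integrable surf A w" "fop A V f"
  shows "lin_on V (\<lambda>v. LINT x:A|surf. w x \<bullet> f v x)"
  using assms by (intro lin_on_integral_data) (auto simp: fop_def)

text \<open>Products of scalars are written as inner products in the face terms, so that the lemmas on
  integrals of inner products apply uniformly.\<close>

lemma A_form_eq: "A_form S Th \<gamma> v w = ip (dom S) (stress S v) (strain w)
    - (\<Sum>F\<in>bfaces S Th. LINT x:(F \<inter> GDu S)|surf. (btr Th F (stress S v) x *v nrm S x) \<bullet> w x)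
    - (\<Sum>F\<in>bfaces S Th. LINT x:(F \<inter> GDu S)|surf. v x \<bullet> (btr Th F (stress S w) x *v nrm S x))
    + (\<Sum>F\<in>bfaces S Th. \<gamma> / hF S Th F * (LINT x:(F \<inter> GDu S)|surf. v x \<bullet> w x))"
  by (simp add: A_form_def a_form_def bint_def)

lemma B_form_Continuous_eq: "B_form S Th Continuous \<gamma> p q = ip (dom S) (flux S p) (grad q)
    - (\<Sum>F\<in>bfaces S Th. LINT x:(F \<inter> GDp S)|surf. (btr Th F (flux S p) x \<bullet> nrm S x) \<bullet> q x)
    - (\<Sum>F\<in>bfaces S Th. LINT x:(F \<inter> GDp S)|surf. p x \<bullet> (btr Th F (flux S q) x \<bullet> nrm S x))
    + (\<Sum>F\<in>bfaces S Th. \<gamma> / hF S Th F * (LINT x:(F \<inter> GDp S)|surf. p x \<bullet> q x))"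
  by (simp add: b_form_def bint_def)

lemma B_form_Discontinuous_eq: "B_form S Th Discontinuous \<gamma> p q = (\<Sum>K\<in>cells Th. ip K (flux S p) (grad q))
    - (\<Sum>F\<in>faces Th. LINT x:F|surf. (avg S Th F (flux S p) x \<bullet> fnormal S Th F x) \<bullet> jump S Th F q x)
    - (\<Sum>F\<in>faces Th. LINT x:F|surf. jump S Th F p x \<bullet> (avg S Th F (flux S q) x \<bullet> fnormal S Th F x))
    + (\<Sum>F\<in>faces Th. \<gamma> / hF S Th F * (LINT x:F|surf. jump S Th F p x \<bullet> jump S Th F q x))"
  by (simp add: sum.distrib)

section \<open>Bilinearity, symmetry and nonnegativity of the forms\<close>

lemma bilin_A_form: "bilin_on (Vh S Th r) (Vh S Th r) (A_form S Th \<gamma>)"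
  unfolding A_form_eq[abs_def]
  by (intro bilin_on_intros ip_dom_bilin subspace_Vh vop_stress vop_strain bilin_on_surf
      face_Int_borel closed_GDu fop_traction fop_Vh face_Int_closure bface Int_lower1)

lemma bilin_C_form: "bilin_on (Vh S Th r) (Qh S Th r ch) (C_form S Th)"
proof -
  have C: "C_form S Th v q = - alpha S * ip (dom S) (div_of v) q
      + alpha S * (\<Sum>F\<in>bfaces S Th. LINT x:(F \<inter> GDu S)|surf. (v x \<bullet> nrm S x) \<bullet> btr Th F q x)" for v q
    by (simp add: C_form_def bint_def)
  show ?thesis
    unfolding C[abs_def]
    by (intro bilin_on_intros ip_dom_bilin subspace_Vh subspace_Qh vop_div vop_Qh bilin_on_surf fop_inner fb_nrm
        face_Int_borel closed_GDu fop_btr fop_Vh face_Int_closure bface Int_lower1)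
qed

lemma bilin_B_form: "bilin_on (Qh S Th r ch) (Qh S Th r ch) (B_form S Th ch \<gamma>)"
proof (cases ch)
  case Continuous
  show ?thesis
    unfolding Continuous B_form_Continuous_eq[abs_def]
    by (intro bilin_on_intros ip_dom_bilin subspace_Qh vop_flux vop_grad bilin_on_surf
      face_Int_borel closed_GDp fop_normal_flux fop_Qh face_Int_closure bface Int_lower1)
next
  case Discontinuous
  show ?thesis
    unfolding Discontinuous B_form_Discontinuous_eq[abs_def]
    by (intro bilin_on_intros ip_cell_bilin vop_flux vop_grad bilin_on_surf
      face_borel fop_avg_flux fop_jump vop_Qh order_refl)
qed

text \<open>The symmetry \<open>Ct S i j k l = Ct S k l i j\<close> exchanges the two pairs of
  summation indices. The local fact \<open>swap\<close> moves the innermost of three sums to the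
  front and is applied once for \<open>k\<close> and once for \<open>l\<close>.\<close>

lemma stress_strain_sym: "stress S v x \<bullet> strain w x = stress S w x \<bullet> strain v x"
proof -
  have C: "Ct S i j k l = Ct S k l i j" for i j k l using S by (simp add: valid_setting_def)
  have swap: "(\<Sum>i\<in>UNIV. \<Sum>j\<in>UNIV. \<Sum>k\<in>UNIV. g i j k) = (\<Sum>k\<in>UNIV. \<Sum>i\<in>UNIV. \<Sum>j\<in>UNIV. g i j k)"
    for g :: "'n \<Rightarrow> 'n \<Rightarrow> 'n \<Rightarrow> real"
  proof -
    have "(\<Sum>i\<in>UNIV. \<Sum>j\<in>UNIV. \<Sum>k\<in>UNIV. g i j k) = (\<Sum>i\<in>UNIV. \<Sum>k\<in>UNIV. \<Sum>j\<in>UNIV. g i j k)"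
      by (intro sum.cong refl sum.swap)
    also have "\<dots> = (\<Sum>k\<in>UNIV. \<Sum>i\<in>UNIV. \<Sum>j\<in>UNIV. g i j k)" by (rule sum.swap)
    finally show ?thesis .
  qed
  have "stress S v x \<bullet> strain w x
      = (\<Sum>i\<in>UNIV. \<Sum>j\<in>UNIV. \<Sum>k\<in>UNIV. \<Sum>l\<in>UNIV. Ct S i j k l * strain v x $k$l * strain w x $i$j)"
    by (simp add: inner_matrix stress_def sum_distrib_right)
  also have "\<dots> = (\<Sum>k\<in>UNIV. \<Sum>i\<in>UNIV. \<Sum>j\<in>UNIV. \<Sum>l\<in>UNIV. Ct S i j k l * strain v x $k$l * strain w x $i$j)"
    by (rule swap)
  also have "\<dots> = (\<Sum>k\<in>UNIV. \<Sum>l\<in>UNIV. \<Sum>i\<in>UNIV. \<Sum>j\<in>UNIV. Ct S i j k l * strain v x $k$l * strain w x $i$j)"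
    by (intro sum.cong refl swap)
  also have "\<dots> = (\<Sum>k\<in>UNIV. \<Sum>l\<in>UNIV. \<Sum>i\<in>UNIV. \<Sum>j\<in>UNIV. Ct S k l i j * strain w x $i$j * strain v x $k$l)"
    by (intro sum.cong refl, subst C) (simp add: mult_ac)
  also have "\<dots> = stress S w x \<bullet> strain v x"
    by (simp add: inner_matrix stress_def sum_distrib_right)
  finally show ?thesis .
qed

lemma ip_stress_strain_sym: "ip (dom S) (stress S v) (strain w) = ip (dom S) (stress S w) (strain v)"
  unfolding ip_def by (intro set_integral_cong' stress_strain_sym)

lemma stress_strain_coercive:
  obtains k0 where "k0 > 0" "\<And>v x. stress S v x \<bullet> strain v x \<ge> k0 * (strain v x \<bullet> strain v x)"
proof -
  obtain k0 where k0: "k0 > 0" "\<And>\<xi> :: real^'n^'n. transpose \<xi> = \<xi> \<Longrightarrow>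
        (\<Sum>i\<in>UNIV. \<Sum>j\<in>UNIV. \<Sum>k\<in>UNIV. \<Sum>l\<in>UNIV. \<xi>$i$j * Ct S i j k l * \<xi>$k$l)
          \<ge> k0 * (\<Sum>j\<in>UNIV. \<Sum>k\<in>UNIV. \<bar>\<xi>$j$k\<bar>\<^sup>2)"
    using S unfolding valid_setting_def by blast
  have "stress S v x \<bullet> strain v x \<ge> k0 * (strain v x \<bullet> strain v x)" for v x
  proof -
    have "transpose (strain v x) = strain v x" by (simp add: strain_def transpose_def vec_eq_iff add.commute)
    from k0(2)[OF this] show ?thesis
      by (simp add: inner_matrix stress_def sum_distrib_right sum_distrib_left power2_eq_square mult_ac)
  qed
  with k0(1) show ?thesis by (rule that)
qed

lemma A_form_sym: "A_form S Th \<gamma> v w = A_form S Th \<gamma> w v"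
  unfolding A_form_eq by (simp add: ip_stress_strain_sym[of v w] inner_commute)

text \<open>\<open>nitsche_nonneg\<close> with the elastic energy, and with traction and
  displacement on the Dirichlet part. Its kernel condition holds because zero energy forces the
  strain to vanish inside each cell, hence also the stress and its trace.\<close>

lemma A_form_nonneg: "\<exists>\<gamma>0. \<forall>\<gamma>>\<gamma>0. \<forall>v\<in>Vh S Th r. A_form S Th \<gamma> v v \<ge> 0"
proof -
  obtain k0 where k0: "k0 > 0" "\<And>v x. stress S v x \<bullet> strain v x \<ge> k0 * (strain v x \<bullet> strain v x)"
    by (rule stress_strain_coercive) blast
  have nn: "stress S v x \<bullet> strain v x \<ge> 0" for v x
    using k0(1) by (intro order_trans[OF _ k0(2)]) simp
  define e where "e v w = ip (dom S) (stress S v) (strain w)" for v w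
  define x where "x F v z = btr Th F (stress S v) z *v nrm S z" for F v z
  have fx: "fop (F \<inter> GDu S) (Vh S Th r) (x F)" if "F \<in> bfaces S Th" for F
    unfolding x_def[abs_def] by (intro fop_traction bface that Int_lower1)
  have fy: "fop (F \<inter> GDu S) (Vh S Th r) (\<lambda>v. v)" if "F \<in> bfaces S Th" for F
    by (intro fop_Vh face_Int_closure bface that)
  have ex: "\<exists>\<gamma>0. \<forall>\<gamma>>\<gamma>0. \<forall>v\<in>Vh S Th r. e v v - 2 * (\<Sum>F\<in>bfaces S Th. LINT z:(F \<inter> GDu S)|surf. x F v z \<bullet> v z)
    + (\<Sum>F\<in>bfaces S Th. \<gamma> / hF S Th F * (LINT z:(F \<inter> GDu S)|surf. v z \<bullet> v z)) \<ge> 0"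
  proof (rule nitsche_nonneg[where e = e, OF findim_Vh _ finite_bfaces])
    show "psd_on (Vh S Th r) e"
      unfolding psd_on_def
    proof (intro conjI ballI)
      show "bilin_on (Vh S Th r) (Vh S Th r) e"
        unfolding e_def[abs_def] by (intro ip_dom_bilin subspace_Vh vop_stress vop_strain)
      show "e v w = e w v" for v w unfolding e_def by (rule ip_stress_strain_sym)
      show "e v v \<ge> 0" for v unfolding e_def ip_def by (intro set_integral_nonneg' nn)
    qed
    show "x F v z = 0" if v: "v \<in> Vh S Th r" and e0: "e v v = 0" and F: "F \<in> bfaces S Th" and z: "z \<in> F \<inter> GDu S" for v F z
    proof -
      have K: "fplus Th F \<in> cells Th" "z \<in> closure (fplus Th F)"
        using face_plus[OF bface[OF F]] face_closure_plus[OF bface[OF F]] z by auto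
      have "strain v y = 0" if y: "y \<in> fplus Th F" for y
      proof -
        have "stress S v y \<bullet> strain v y = 0"
          using ip_cell_zero[of "stress S v" "strain v" "fplus Th F" y] vop_stress vop_strain v e0 nn K y
          by (auto simp: vop_def e_def)
        then have "k0 * (strain v y \<bullet> strain v y) \<le> 0" using k0(2)[of v y] by simp
        then have "strain v y \<bullet> strain v y \<le> 0" using k0(1) by (simp add: mult_le_0_iff)
        then have "strain v y \<bullet> strain v y = 0" using inner_ge_zero[of "strain v y"] by (rule antisym)
        then show ?thesis by (simp only: inner_eq_zero_iff)
      qed
      then have "stress S v y = 0" if "y \<in> fplus Th F" for y using that by (simp add: stress_def vec_eq_iff)
      then have "btr Th F (stress S v) z = 0"
        unfolding btr_def using K by (intro opn.tr_zero cell_props(1))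
      then show ?thesis by (simp add: x_def)
    qed
  qed (use fx fy in \<open>auto simp: fop_def intro: face_Int_borel bface closed_GDu hF_pos\<close>)
  have eq: "A_form S Th \<gamma> v v = e v v - 2 * (\<Sum>F\<in>bfaces S Th. LINT z:(F \<inter> GDu S)|surf. x F v z \<bullet> v z)
    + (\<Sum>F\<in>bfaces S Th. \<gamma> / hF S Th F * (LINT z:(F \<inter> GDu S)|surf. v z \<bullet> v z))" for \<gamma> v
    by (simp add: A_form_eq e_def x_def inner_commute)
  show ?thesis unfolding eq by (rule ex)
qed

lemma flux_grad_coercive:
  obtains k1 where "k1 > 0" "\<And>q x. flux S q x \<bullet> grad q x \<ge> k1 * (grad q x \<bullet> grad q x)"
proof -
  obtain k1 where k1: "k1 > 0" "\<And>\<xi> :: real^'n. (\<Sum>i\<in>UNIV. \<Sum>j\<in>UNIV. \<xi>$i * Kp S $i$j * \<xi>$j) \<ge> k1 * (\<Sum>i\<in>UNIV. \<bar>\<xi>$i\<bar>\<^sup>2)"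
    using S unfolding valid_setting_def by blast
  have "flux S q x \<bullet> grad q x \<ge> k1 * (grad q x \<bullet> grad q x)" for q x
    using k1(2)[of "grad q x"]
    by (simp add: flux_def matrix_vector_mult_def inner_vec_def sum_distrib_right sum_distrib_left power2_eq_square mult_ac)
  with k1(1) show ?thesis by (rule that)
qed

lemma flux_grad_sym: "flux S p x \<bullet> grad q x = flux S q x \<bullet> grad p x"
proof -
  have "transpose (Kp S) = Kp S" using S by (simp add: valid_setting_def)
  then show ?thesis unfolding flux_def by (metis dot_lmul_matrix inner_commute transpose_matrix_vector)
qed

lemma psd_flux: "psd_on (Qh S Th r ch) (\<lambda>p q. ip (dom S) (flux S p) (grad q))"
  unfolding psd_on_def
proof (intro conjI ballI)
  show "bilin_on (Qh S Th r ch) (Qh S Th r ch) (\<lambda>p q. ip (dom S) (flux S p) (grad q))"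
    by (intro ip_dom_bilin subspace_Qh vop_flux vop_grad)
  show "ip (dom S) (flux S p) (grad q) = ip (dom S) (flux S q) (grad p)" for p q
    by (simp add: ip_def flux_grad_sym[of p _ q])
  obtain k1 where k1: "k1 > 0" "\<And>q x. flux S q x \<bullet> grad q x \<ge> k1 * (grad q x \<bullet> grad q x)"
    by (rule flux_grad_coercive) blast
  show "ip (dom S) (flux S q) (grad q) \<ge> 0" for q
    unfolding ip_def using k1(1) by (intro set_integral_nonneg' order_trans[OF _ k1(2)]) simp
qed

lemma flux_zero:
  assumes q: "q \<in> Qh S Th r ch" and 0: "ip (dom S) (flux S q) (grad q) = 0" and K: "K \<in> cells Th" and x: "x \<in> closure K"
  shows "tr K (flux S q) x = 0"
proof -
  obtain k1 where k1: "k1 > 0" "\<And>q x. flux S q x \<bullet> grad q x \<ge> k1 * (grad q x \<bullet> grad q x)"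
    by (rule flux_grad_coercive) blast
  have nn: "flux S q y \<bullet> grad q y \<ge> 0" for y using k1(1) by (intro order_trans[OF _ k1(2)]) simp
  have "flux S q y = 0" if y: "y \<in> K" for y
  proof -
    have "flux S q y \<bullet> grad q y = 0"
      using ip_cell_zero[of "flux S q" "grad q" K y] vop_flux vop_grad q 0 nn K y by (auto simp: vop_def)
    then have "k1 * (grad q y \<bullet> grad q y) \<le> 0" using k1(2)[of q y] by simp
    then have "grad q y \<bullet> grad q y \<le> 0" using k1(1) by (simp add: mult_le_0_iff)
    then have "grad q y \<bullet> grad q y = 0" using inner_ge_zero[of "grad q y"] by (rule antisym)
    then have "grad q y = 0" by (simp only: inner_eq_zero_iff)
    then show ?thesis by (simp add: flux_def)
  qed
  then show ?thesis using K x by (intro opn.tr_zero cell_props(1))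
qed

text \<open>Both choices are instances of \<open>nitsche_nonneg\<close> with the same energy: normal
  flux and value on the Dirichlet part for continuous pressures, averaged normal flux and jump on
  all faces for discontinuous ones.\<close>

lemma B_form_nonneg: "\<exists>\<gamma>0. \<forall>\<gamma>>\<gamma>0. \<forall>q\<in>Qh S Th r ch. B_form S Th ch \<gamma> q q \<ge> 0"
proof (cases ch)
  case Continuous
  define x where "x F q z = btr Th F (flux S q) z \<bullet> nrm S z" for F q z
  have fx: "fop (F \<inter> GDp S) (Qh S Th r Continuous) (x F)" if "F \<in> bfaces S Th" for F
    unfolding x_def[abs_def] by (intro fop_normal_flux bface that Int_lower1)
  have fy: "fop (F \<inter> GDp S) (Qh S Th r Continuous) (\<lambda>v. v)" if "F \<in> bfaces S Th" for F
    by (intro fop_Qh face_Int_closure bface that)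
  have ex: "\<exists>\<gamma>0. \<forall>\<gamma>>\<gamma>0. \<forall>q\<in>Qh S Th r Continuous. ip (dom S) (flux S q) (grad q)
    - 2 * (\<Sum>F\<in>bfaces S Th. LINT z:(F \<inter> GDp S)|surf. x F q z \<bullet> q z)
    + (\<Sum>F\<in>bfaces S Th. \<gamma> / hF S Th F * (LINT z:(F \<inter> GDp S)|surf. q z \<bullet> q z)) \<ge> 0"
  proof (rule nitsche_nonneg[OF findim_Qh psd_flux finite_bfaces])
    show "x F q z = 0" if q: "q \<in> Qh S Th r Continuous" and e0: "ip (dom S) (flux S q) (grad q) = 0"
      and F: "F \<in> bfaces S Th" and z: "z \<in> F \<inter> GDp S" for q F z
      using flux_zero[OF q e0, of "fplus Th F" z] face_plus[OF bface[OF F]] face_closure_plus[OF bface[OF F]] z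
      by (auto simp: x_def btr_def)
  qed (use fx fy in \<open>auto simp: fop_def intro: face_Int_borel bface closed_GDp hF_pos\<close>)
  have eq: "B_form S Th Continuous \<gamma> q q = ip (dom S) (flux S q) (grad q)
    - 2 * (\<Sum>F\<in>bfaces S Th. LINT z:(F \<inter> GDp S)|surf. x F q z \<bullet> q z)
    + (\<Sum>F\<in>bfaces S Th. \<gamma> / hF S Th F * (LINT z:(F \<inter> GDp S)|surf. q z \<bullet> q z))" for \<gamma> q
    unfolding B_form_Continuous_eq by (simp add: x_def mult.commute)
  show ?thesis unfolding Continuous eq by (rule ex)
next
  case Discontinuous
  define x where "x F q z = avg S Th F (flux S q) z \<bullet> fnormal S Th F z" for F q z
  have fx: "fop F (Qh S Th r Discontinuous) (x F)" if "F \<in> faces Th" for F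
    unfolding x_def[abs_def] by (intro fop_avg_flux that order_refl)
  have fy: "fop F (Qh S Th r Discontinuous) (jump S Th F)" if "F \<in> faces Th" for F
    by (rule fop_jump[OF that order_refl vop_Qh])
  have ex: "\<exists>\<gamma>0. \<forall>\<gamma>>\<gamma>0. \<forall>q\<in>Qh S Th r Discontinuous. ip (dom S) (flux S q) (grad q)
    - 2 * (\<Sum>F\<in>faces Th. LINT z:F|surf. x F q z \<bullet> jump S Th F q z)
    + (\<Sum>F\<in>faces Th. \<gamma> / hF S Th F * (LINT z:F|surf. jump S Th F q z \<bullet> jump S Th F q z)) \<ge> 0"
  proof (rule nitsche_nonneg[OF findim_Qh psd_flux finite_faces])
    show "x F q z = 0" if q: "q \<in> Qh S Th r Discontinuous" and e0: "ip (dom S) (flux S q) (grad q) = 0"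
      and F: "F \<in> faces Th" and z: "z \<in> F" for q F z
    proof -
      have 1: "tr (fplus Th F) (flux S q) z = 0"
        using face_plus[OF F] face_closure_plus[OF F] z by (intro flux_zero[OF q e0]) auto
      have 2: "tr (fminus Th F) (flux S q) z = 0" if "F \<notin> bfaces S Th"
        using face_minus[OF F that] face_closure_minus[OF F that] z by (intro flux_zero[OF q e0]) auto
      show ?thesis using 1 2 by (simp add: x_def avg_def)
    qed
  qed (use fx fy in \<open>auto simp: fop_def intro: face_borel hF_pos\<close>)
  have eq: "B_form S Th Discontinuous \<gamma> q q = ip (dom S) (flux S q) (grad q)
    - 2 * (\<Sum>F\<in>faces Th. LINT z:F|surf. x F q z \<bullet> jump S Th F q z)
    + (\<Sum>F\<in>faces Th. \<gamma> / hF S Th F * (LINT z:F|surf. jump S Th F q z \<bullet> jump S Th F q z))"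
    if q: "q \<in> Qh S Th r Discontinuous" for \<gamma> q
  proof -
    \<comment> \<open>The form is written with a sum over cells, the energy with an integral over
      the domain.\<close>
    have "ip (dom S) (flux S q) (grad q) = (\<Sum>K\<in>cells Th. ip K (flux S q) (grad q))"
      by (intro ip_dom vop_cext[OF vop_flux q] vop_cext[OF vop_grad q])
    then show ?thesis unfolding B_form_Discontinuous_eq by (simp add: x_def mult.commute)
  qed
  show ?thesis unfolding Discontinuous using ex by (simp only: eq cong: ball_cong)
qed

section \<open>Linearity of the functionals given by the data\<close>

lemma set_integrable_L2_face:
  fixes w :: "real^'n \<Rightarrow> 'b::euclidean_space"
  assumes "F \<in> faces Th" "closed \<Gamma>" "L2_on surf \<Gamma> w"
  shows "set_integrable surf (F \<inter> \<Gamma>) w"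
  by (rule set_integrable_L2[OF face_Int_borel[OF assms(1,2)] assms(3)]) blast

lemma lin_F_fun:
  assumes f: "linear_functional_on (Vh S Th r) (df D t)"
    and tN: "linear_functional_on (Vh S Th r) (\<lambda>\<eta>. dtN D t (restr (GNu S) \<eta>))"
    and uD: "L2_on surf (GDu S) (duD D t)"
  shows "lin_on (Vh S Th r) (F_fun S Th \<gamma> D t)"
proof -
  have F: "F_fun S Th \<gamma> D t \<eta> = df D t \<eta> - dtN D t (restr (GNu S) \<eta>)
      - (\<Sum>F\<in>bfaces S Th. LINT x:(F \<inter> GDu S)|surf. duD D t x \<bullet> (btr Th F (stress S \<eta>) x *v nrm S x))
      + (\<Sum>F\<in>bfaces S Th. \<gamma> / hF S Th F * (LINT x:(F \<inter> GDu S)|surf. duD D t x \<bullet> \<eta> x))" for \<eta>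
    by (simp add: F_fun_def a_form_def bint_def)
  show ?thesis
    unfolding F[abs_def]
    by (intro lin_on_intros f[folded lin_on_eq_linear_functional_on] tN[folded lin_on_eq_linear_functional_on]
        lin_on_surf set_integrable_L2_face uD face_Int_borel closed_GDu fop_traction fop_Vh face_Int_closure bface Int_lower1)
qed

lemma set_integrable_normal_data:
  assumes "F \<in> faces Th" "L2_on surf (GDu S) w"
  shows "set_integrable surf (F \<inter> GDu S) (\<lambda>x. w x \<bullet> nrm S x)"
  by (rule set_integrable_fb_mult[OF face_Int_borel[OF assms(1) closed_GDu] set_integrable_L2_face[OF assms(1) closed_GDu assms(2)] fb_nrm])

lemma faces_onD: "F \<in> faces_on S Th \<Gamma> \<Longrightarrow> F \<in> faces Th" "F \<in> faces_on S Th \<Gamma> \<Longrightarrow> F \<inter> \<Gamma> = F"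
  by (auto simp: faces_on_def bfaces_def)

lemma lin_G_fun:
  assumes g: "linear_functional_on (Qh S Th r ch) (dg D t)" and pN: "pN_ok S Th r ch D t"
    and vD: "L2_on surf (GDu S) (dvD D t)" and pD: "L2_on surf (GDp S) (dpD D t)"
  shows "lin_on (Qh S Th r ch) (G_fun S Th ch \<gamma> D t)"
proof (cases ch)
  case Continuous
  have G: "G_fun S Th Continuous \<gamma> D t \<psi> = dg D t \<psi>
      - alpha S * (\<Sum>F\<in>bfaces S Th. LINT x:(F \<inter> GDu S)|surf. (dvD D t x \<bullet> nrm S x) \<bullet> \<psi> x)
      - dpN D t (GNp S) (restr (GNp S) \<psi>)
      - (\<Sum>F\<in>bfaces S Th. LINT x:(F \<inter> GDp S)|surf. dpD D t x \<bullet> (btr Th F (flux S \<psi>) x \<bullet> nrm S x))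
      + (\<Sum>F\<in>bfaces S Th. \<gamma> / hF S Th F * (LINT x:(F \<inter> GDp S)|surf. dpD D t x \<bullet> \<psi> x))" for \<psi>
    by (simp add: b_form_def bint_def)
  show ?thesis
    unfolding Continuous G[abs_def]
    by (intro lin_on_intros g[unfolded Continuous, folded lin_on_eq_linear_functional_on]
        pN[unfolded Continuous pN_ok.simps, folded lin_on_eq_linear_functional_on]
        lin_on_surf set_integrable_normal_data set_integrable_L2_face vD pD face_Int_borel closed_GDu closed_GDp
        fop_normal_flux fop_Qh face_Int_closure bface Int_lower1)
next
  case Discontinuous
  have G: "G_fun S Th Discontinuous \<gamma> D t \<psi> = dg D t \<psi>
      - (\<Sum>F\<in>faces_on S Th (GDu S). alpha S * (LINT x:F|surf. (dvD D t x \<bullet> nrm S x) \<bullet> btr Th F \<psi> x))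
      - (\<Sum>F\<in>faces_on S Th (GDp S). LINT x:F|surf. dpD D t x \<bullet> (avg S Th F (flux S \<psi>) x \<bullet> nrm S x))
      + (\<Sum>F\<in>faces_on S Th (GDp S). \<gamma> / hF S Th F * (LINT x:F|surf. dpD D t x \<bullet> jump S Th F \<psi> x))
      - (\<Sum>F\<in>faces_on S Th (GNp S). dpN D t F (restr F (jump S Th F \<psi>)))" for \<psi>
    by simp
  have i1: "set_integrable surf F (\<lambda>x. dvD D t x \<bullet> nrm S x)" if "F \<in> faces_on S Th (GDu S)" for F
    using set_integrable_normal_data[OF faces_onD(1)[OF that] vD] faces_onD(2)[OF that] by simp
  have i2: "set_integrable surf F (dpD D t)" if "F \<in> faces_on S Th (GDp S)" for F
    using set_integrable_L2_face[OF faces_onD(1)[OF that] closed_GDp pD] faces_onD(2)[OF that] by simp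
  have i3: "lin_on (Qh S Th r Discontinuous) (\<lambda>\<psi>. dpN D t F (restr F (jump S Th F \<psi>)))" if "F \<in> faces_on S Th (GNp S)" for F
    using pN that unfolding Discontinuous by (simp add: lin_on_eq_linear_functional_on)
  show ?thesis
    unfolding Discontinuous G[abs_def]
    by (intro lin_on_intros g[unfolded Discontinuous, folded lin_on_eq_linear_functional_on]
        lin_on_surf i1 i2 i3 face_borel faces_onD(1) fop_inner fop_btr fop_avg fop_jump fb_nrm vop_flux vop_Qh order_refl; assumption)
qed

text \<open>The right side of the third equation at the left end point; \<open>w\<close> will be the
  Dirichlet displacement at that time.\<close>

lemma lin_initial:
  assumes u0: "u0 \<in> Vh S Th r" and p0: "p0 \<in> Qh S Th r ch" and uD: "L2_on surf (GDu S) w"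
  shows "lin_on (Qh S Th r ch) (\<lambda>\<psi>. ip (dom S) (\<lambda>x. c0 S * p0 x + alpha S * div_of u0 x) \<psi>
    - alpha S * bint S Th (GDu S) (\<lambda>F x. (w x \<bullet> nrm S x) * btr Th F \<psi> x))"
proof -
  have "cext K (\<lambda>x. c0 S * p0 x + alpha S * div_of u0 x)" if "K \<in> cells Th" for K
    using cext_lincomb[of K p0 "div_of u0" "c0 S" "alpha S"] vop_div[OF that] vop_Qh[OF that] u0 p0 by (auto simp: vop_def)
  then have "lin_on (Qh S Th r ch) (ip (dom S) (\<lambda>x. c0 S * p0 x + alpha S * div_of u0 x))"
    by (intro ip_dom_lin[of "Qh S Th r ch" _ "\<lambda>q. q"] subspace_Qh vop_Qh)
  moreover have "lin_on (Qh S Th r ch) (\<lambda>\<psi>. \<Sum>F\<in>bfaces S Th. LINT x:(F \<inter> GDu S)|surf. (w x \<bullet> nrm S x) \<bullet> btr Th F \<psi> x)"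
    by (intro lin_on_intros lin_on_surf set_integrable_normal_data uD face_Int_borel closed_GDu fop_btr vop_Qh bface Int_lower1)
  ultimately show ?thesis
    unfolding bint_def inner_real_def by (rule lin_on_diff[OF _ lin_on_cmult])
qed

end

section \<open>Unique solvability\<close>

lemma ip_scaleR: "ip A (\<lambda>x. c *\<^sub>R f x) h = c * ip A f h"
  by (simp add: ip_def)

lemma time_mesh_mono:
  assumes "time_mesh N T t" "i \<le> j" "j \<le> N"
  shows "t i \<le> t j"
  using assms(2,3)
proof (induction j rule: dec_induct)
  case (step j)
  then have "t j < t (Suc j)" using assms(1) by (auto simp: time_mesh_def)
  then show ?case using step by auto
qed simp

context fe
begin

text \<open>The passage from the concrete scheme to \<open>dg_system\<close>: the inner products are
  definite on the discrete spaces, and each equation is identified with its abstract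
  counterpart.\<close>

lemma unique_step:
  assumes radau: "gauss_radau k xh wh" and ab: "a < b"
    and A: "\<And>v. v \<in> Vh S Th r \<Longrightarrow> A_form S Th \<gamma>a v v \<ge> 0"
    and B: "\<And>q. q \<in> Qh S Th r ch \<Longrightarrow> B_form S Th ch \<gamma> q q \<ge> 0"
    and F: "\<And>\<mu>. \<mu> \<in> {1..k+1} \<Longrightarrow> lin_on (Vh S Th r) (F_fun S Th \<gamma>a D (qnode xh a b \<mu>))"
    and G: "\<And>\<mu>. \<mu> \<in> {1..k+1} \<Longrightarrow> lin_on (Qh S Th r ch) (G_fun S Th ch \<gamma> D (qnode xh a b \<mu>))"
    and uD: "L2_on surf (GDu S) (duD D a)"
    and u0: "u0 \<in> Vh S Th r" and v0: "v0 \<in> Vh S Th r" and p0: "p0 \<in> Qh S Th r ch"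
  shows "\<exists>!(u, v, p). (u, v, p) \<in> Pk k (Vh S Th r) \<times> Pk k (Vh S Th r) \<times> Pk k (Qh S Th r ch) \<and>
    (\<forall>(\<phi>, \<eta>, \<psi>) \<in> Pk k (Vh S Th r) \<times> Pk k (Vh S Th r) \<times> Pk k (Qh S Th r ch).
       eq_displacement S (Qn k xh wh a b) a u0 u v \<phi> \<and>
       eq_velocity S Th \<gamma>a D (Qn k xh wh a b) a v0 u v p \<eta> \<and>
       eq_pressure S Th ch \<gamma> D (Qn k xh wh a b) a u0 p0 u p \<psi>)"
proof -
  have psd: "psd_on (Vh S Th r) (ip (dom S))" "psd_on (Qh S Th r ch) (ip (dom S))"
    by (intro psd_ip subspace_Vh subspace_Qh vop_Vh vop_Qh; assumption)+
  interpret dg_system k xh wh a b "Vh S Th r" "Qh S Th r ch" "ip (dom S)" "A_form S Th \<gamma>a"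
    "ip (dom S)" "B_form S Th ch \<gamma>" "C_form S Th" "rho S" "c0 S"
  proof
    show "v = 0" if "v \<in> Vh S Th r" "ip (dom S) v v = 0" for v
      using ip_definite[OF vop_Vh that] by (intro Vh_zero[OF that(1)])
    show "q = 0" if "q \<in> Qh S Th r ch" "ip (dom S) q q = 0" for q
      using ip_definite[OF vop_Qh that] by (intro Qh_zero[OF that(1)])
    show "psd_on (Vh S Th r) (A_form S Th \<gamma>a)"
      unfolding psd_on_def using bilin_A_form A_form_sym A by blast
  qed (fact radau ab findim_Vh findim_Qh psd
      bilin_B_form bilin_C_form B \<rho>_pos c0_pos)+
  define L1 where "L1 \<phi> = ip (dom S) u0 \<phi>" for \<phi>
  define L2 where "L2 \<eta> = rho S * ip (dom S) v0 \<eta>" for \<eta>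
  define L3 where "L3 \<psi> = ip (dom S) (\<lambda>x. c0 S * p0 x + alpha S * div_of u0 x) \<psi>
    - alpha S * bint S Th (GDu S) (\<lambda>F x. (duD D a x \<bullet> nrm S x) * btr Th F \<psi> x)" for \<psi>
  have eq1: "eq_displacement S Q a u0 u v \<phi> \<longleftrightarrow> lhs1 u v \<phi> = L1 (\<phi> a)"
    if "u \<in> Pk k (Vh S Th r)" "\<phi> \<in> Pk k (Vh S Th r)" for u v \<phi>
    by (simp add: eq_displacement_def lhs1_def L1_def right_lim_Pk[OF that(1)] right_lim_Pk[OF that(2)])
  have eq2: "eq_velocity S Th \<gamma>a D Q a v0 u v p \<eta> \<longleftrightarrow> lhs2 u v p \<eta> = Q (\<lambda>t. F_fun S Th \<gamma>a D t (\<eta> t)) + L2 (\<eta> a)"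
    if "v \<in> Pk k (Vh S Th r)" "\<eta> \<in> Pk k (Vh S Th r)" for u v p \<eta>
    by (simp add: eq_velocity_def lhs2_def L2_def right_lim_Pk[OF that(1)] right_lim_Pk[OF that(2)] ip_scaleR)
  have eq3: "eq_pressure S Th ch \<gamma> D Q a u0 p0 u p \<psi> \<longleftrightarrow> lhs3 u p \<psi> = Q (\<lambda>t. G_fun S Th ch \<gamma> D t (\<psi> t)) + L3 (\<psi> a)"
    if "u \<in> Pk k (Vh S Th r)" "p \<in> Pk k (Qh S Th r ch)" "\<psi> \<in> Pk k (Qh S Th r ch)" for u p \<psi>
  proof -
    note mem = Pk_mem(1)[OF that(1) subspace_Vh] Pk_mem(1)[OF that(2) subspace_Qh] Pk_mem(1)[OF that(3) subspace_Qh]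
    \<comment> \<open>Splitting the initial term requires integrability of both summands, which is
      available cell by cell. The parts in \<open>u a\<close> then combine to
      \<open>- C_form S Th (u a) (\<psi> a)\<close>.\<close>
    have "ip (dom S) (\<lambda>x. c0 S *\<^sub>R p a x + alpha S *\<^sub>R div_of (u a) x) (\<psi> a)
        = c0 S * ip (dom S) (p a) (\<psi> a) + alpha S * ip (dom S) (div_of (u a)) (\<psi> a)"
      by (intro ip_dom_lincomb vop_cext[OF vop_Qh mem(2)] vop_cext[OF vop_div mem(1)] vop_cext[OF vop_Qh mem(3)])
    moreover have "ip (dom S) (\<lambda>x. c0 S * dt p t x) (\<psi> t) = c0 S * ip (dom S) (dt p t) (\<psi> t)" for t
      using ip_scaleR[of "dom S" "c0 S" "dt p t" "\<psi> t"] by simp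
    ultimately show ?thesis
      unfolding eq_pressure_def lhs3_def L3_def right_lim_Pk[OF that(1)] right_lim_Pk[OF that(2)] right_lim_Pk[OF that(3)]
      by (simp add: C_form_def algebra_simps)
  qed
  have l1: "lin_on (Vh S Th r) L1" unfolding L1_def[abs_def] by (rule bilin_onD2[OF bil(1) u0])
  have l2: "lin_on (Vh S Th r) L2" unfolding L2_def[abs_def] by (intro lin_on_cmult bilin_onD2[OF bil(1) v0])
  have l3: "lin_on (Qh S Th r ch) L3" unfolding L3_def[abs_def] by (rule lin_initial[OF u0 p0 uD])
  have ex: "\<exists>!(u, v, p). (u, v, p) \<in> Pk k (Vh S Th r) \<times> Pk k (Vh S Th r) \<times> Pk k (Qh S Th r ch) \<and>
    (\<forall>(\<phi>, \<eta>, \<psi>) \<in> Pk k (Vh S Th r) \<times> Pk k (Vh S Th r) \<times> Pk k (Qh S Th r ch).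
      lhs1 u v \<phi> = L1 (\<phi> a) \<and> lhs2 u v p \<eta> = Q (\<lambda>t. F_fun S Th \<gamma>a D t (\<eta> t)) + L2 (\<eta> a) \<and>
      lhs3 u p \<psi> = Q (\<lambda>t. G_fun S Th ch \<gamma> D t (\<psi> t)) + L3 (\<psi> a))"
    by (rule unique_solvability[where F = "F_fun S Th \<gamma>a D" and G = "G_fun S Th ch \<gamma> D", OF _ _ l1 l2 l3])
       (erule F, erule G)
  have iff: "((u, v, p) \<in> Pk k (Vh S Th r) \<times> Pk k (Vh S Th r) \<times> Pk k (Qh S Th r ch) \<and>
    (\<forall>(\<phi>, \<eta>, \<psi>) \<in> Pk k (Vh S Th r) \<times> Pk k (Vh S Th r) \<times> Pk k (Qh S Th r ch).
       eq_displacement S Q a u0 u v \<phi> \<and> eq_velocity S Th \<gamma>a D Q a v0 u v p \<eta> \<and>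
       eq_pressure S Th ch \<gamma> D Q a u0 p0 u p \<psi>)) \<longleftrightarrow>
    ((u, v, p) \<in> Pk k (Vh S Th r) \<times> Pk k (Vh S Th r) \<times> Pk k (Qh S Th r ch) \<and>
    (\<forall>(\<phi>, \<eta>, \<psi>) \<in> Pk k (Vh S Th r) \<times> Pk k (Vh S Th r) \<times> Pk k (Qh S Th r ch).
      lhs1 u v \<phi> = L1 (\<phi> a) \<and> lhs2 u v p \<eta> = Q (\<lambda>t. F_fun S Th \<gamma>a D t (\<eta> t)) + L2 (\<eta> a) \<and>
      lhs3 u p \<psi> = Q (\<lambda>t. G_fun S Th ch \<gamma> D t (\<psi> t)) + L3 (\<psi> a)))" for u v p
  proof (intro conj_cong refl ball_cong)
    fix z assume uvp: "(u, v, p) \<in> Pk k (Vh S Th r) \<times> Pk k (Vh S Th r) \<times> Pk k (Qh S Th r ch)"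
      and "z \<in> Pk k (Vh S Th r) \<times> Pk k (Vh S Th r) \<times> Pk k (Qh S Th r ch)"
    then obtain \<phi> \<eta> \<psi> where "z = (\<phi>, \<eta>, \<psi>)" "\<phi> \<in> Pk k (Vh S Th r)" "\<eta> \<in> Pk k (Vh S Th r)" "\<psi> \<in> Pk k (Qh S Th r ch)"
      by blast
    then show "(case z of (\<phi>, \<eta>, \<psi>) \<Rightarrow> eq_displacement S Q a u0 u v \<phi> \<and> eq_velocity S Th \<gamma>a D Q a v0 u v p \<eta> \<and>
        eq_pressure S Th ch \<gamma> D Q a u0 p0 u p \<psi>) = (case z of (\<phi>, \<eta>, \<psi>) \<Rightarrow> lhs1 u v \<phi> = L1 (\<phi> a) \<and>
        lhs2 u v p \<eta> = Q (\<lambda>t. F_fun S Th \<gamma>a D t (\<eta> t)) + L2 (\<eta> a) \<and>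
        lhs3 u p \<psi> = Q (\<lambda>t. G_fun S Th ch \<gamma> D t (\<psi> t)) + L3 (\<psi> a))"
      using uvp by (simp only: mem_Times_iff fst_conv snd_conv prod.case eq1 eq2 eq3)
  qed
  show ?thesis unfolding iff by (rule ex)
qed

end

theorem lemmaB2:
  fixes S :: "('n::finite) setting" and M :: "'n mesh set" and Th :: "'n mesh"
    and r k :: nat and ch :: pressure_choice and xh wh :: "nat \<Rightarrow> real"
  assumes "CARD('n) = 2 \<or> CARD('n) = 3"
    and "valid_setting S"
    and "quasi_uniform_family S M" and "Th \<in> M"
    and "r \<ge> 2"
    and "gauss_radau k xh wh"
  shows "\<exists>\<gamma>a0 \<gamma>0. \<forall>\<gamma>a>\<gamma>a0. \<forall>\<gamma>>\<gamma>0.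
    \<forall>(N::nat) T t D. \<forall>n\<in>{1..N}.
      time_mesh N T t \<longrightarrow>
      valid_data S Th r ch T (qnode xh (t (n - 1)) (t n) ` {1..k+1}) D \<longrightarrow>
      (\<forall>u0\<in>Vh S Th r. \<forall>v0\<in>Vh S Th r. \<forall>p0\<in>Qh S Th r ch.
        \<exists>!(u, v, p). (u, v, p) \<in> Pk k (Vh S Th r) \<times> Pk k (Vh S Th r) \<times> Pk k (Qh S Th r ch) \<and>
          (\<forall>(\<phi>, \<eta>, \<psi>) \<in> Pk k (Vh S Th r) \<times> Pk k (Vh S Th r) \<times> Pk k (Qh S Th r ch).
             eq_displacement S (Qn k xh wh (t (n - 1)) (t n)) (t (n - 1)) u0 u v \<phi> \<and>
             eq_velocity S Th \<gamma>a D (Qn k xh wh (t (n - 1)) (t n)) (t (n - 1)) v0 u v p \<eta> \<and>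
             eq_pressure S Th ch \<gamma> D (Qn k xh wh (t (n - 1)) (t n)) (t (n - 1)) u0 p0 u p \<psi>))"
proof -
  interpret fe S Th
    using assms(1-4) by unfold_locales (auto simp: quasi_uniform_family_def)
  \<comment> \<open>The thresholds are fixed here, before any time mesh or data are introduced. For
    continuous pressures \<open>\<gamma>\<close> is the boundary penalty in \<open>b_form\<close>,
    for discontinuous ones the jump penalty.\<close>
  obtain \<gamma>a0 where \<gamma>a0: "\<forall>\<gamma>>\<gamma>a0. \<forall>v\<in>Vh S Th r. A_form S Th \<gamma> v v \<ge> 0" using A_form_nonneg by blast
  obtain \<gamma>0 where \<gamma>0: "\<forall>\<gamma>>\<gamma>0. \<forall>q\<in>Qh S Th r ch. B_form S Th ch \<gamma> q q \<ge> 0" using B_form_nonneg by blast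
  show ?thesis
  proof (rule exI[of _ \<gamma>a0], rule exI[of _ \<gamma>0], intro allI impI ballI)
    fix \<gamma>a \<gamma> :: real and N T t n u0 v0 p0 and D :: "'n data"
    assume \<gamma>: "\<gamma>a > \<gamma>a0" "\<gamma> > \<gamma>0" and n: "n \<in> {1..N}" and tm: "time_mesh N T t"
      and D: "valid_data S Th r ch T (qnode xh (t (n - 1)) (t n) ` {1..k+1}) D"
      and init: "u0 \<in> Vh S Th r" "v0 \<in> Vh S Th r" "p0 \<in> Qh S Th r ch"
    have "n - 1 < N" using n by auto
    then have "t (n - 1) < t (Suc (n - 1))" using tm unfolding time_mesh_def by blast
    then have ab: "t (n - 1) < t n" using n by simp
    \<comment> \<open>Keeps the nodes and the left end point in \<open>{0..T}\<close>, where the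
      Dirichlet displacement is known to be square integrable.\<close>
    have T: "0 \<le> t (n - 1)" "t n \<le> T"
      using time_mesh_mono[OF tm, of 0 "n - 1"] time_mesh_mono[OF tm, of n N] tm n by (auto simp: time_mesh_def)
    interpret radau_interval k xh wh "t (n - 1)" "t n" by standard (fact assms ab)+
    have uD: "L2_on surf (GDu S) (duD D s)" if "s \<in> {0..T}" for s
      using D that unfolding valid_data_def by blast
    have nodes: "L2_on surf (GDu S) (duD D (node \<mu>))" "L2_on surf (GDu S) (dvD D (node \<mu>))" "L2_on surf (GDp S) (dpD D (node \<mu>))"
      "linear_functional_on (Vh S Th r) (df D (node \<mu>))"
      "linear_functional_on (Vh S Th r) (\<lambda>\<eta>. dtN D (node \<mu>) (restr (GNu S) \<eta>))"
      "linear_functional_on (Qh S Th r ch) (dg D (node \<mu>))" "pN_ok S Th r ch D (node \<mu>)" if "\<mu> \<in> {1..k+1}" for \<mu>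
    proof -
      show "L2_on surf (GDu S) (duD D (node \<mu>))" using node_mem[OF that] T by (intro uD) auto
      have "node \<mu> \<in> node ` {1..k+1}" using that by (rule imageI)
      with D show "L2_on surf (GDu S) (dvD D (node \<mu>))" "L2_on surf (GDp S) (dpD D (node \<mu>))"
        "linear_functional_on (Vh S Th r) (df D (node \<mu>))"
        "linear_functional_on (Vh S Th r) (\<lambda>\<eta>. dtN D (node \<mu>) (restr (GNu S) \<eta>))"
        "linear_functional_on (Qh S Th r ch) (dg D (node \<mu>))" "pN_ok S Th r ch D (node \<mu>)"
        unfolding valid_data_def by blast+
    qed
    show "\<exists>!(u, v, p). (u, v, p) \<in> Pk k (Vh S Th r) \<times> Pk k (Vh S Th r) \<times> Pk k (Qh S Th r ch) \<and>
          (\<forall>(\<phi>, \<eta>, \<psi>) \<in> Pk k (Vh S Th r) \<times> Pk k (Vh S Th r) \<times> Pk k (Qh S Th r ch).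
             eq_displacement S (Qn k xh wh (t (n - 1)) (t n)) (t (n - 1)) u0 u v \<phi> \<and>
             eq_velocity S Th \<gamma>a D (Qn k xh wh (t (n - 1)) (t n)) (t (n - 1)) v0 u v p \<eta> \<and>
             eq_pressure S Th ch \<gamma> D (Qn k xh wh (t (n - 1)) (t n)) (t (n - 1)) u0 p0 u p \<psi>)"
    proof (rule unique_step[OF assms(6) ab _ _ _ _ _ init])
      show "A_form S Th \<gamma>a v v \<ge> 0" if "v \<in> Vh S Th r" for v using \<gamma>a0 \<gamma>(1) that by blast
      show "B_form S Th ch \<gamma> q q \<ge> 0" if "q \<in> Qh S Th r ch" for q using \<gamma>0 \<gamma>(2) that by blast
      show "lin_on (Vh S Th r) (F_fun S Th \<gamma>a D (node \<mu>))" if "\<mu> \<in> {1..k+1}" for \<mu>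
        by (rule lin_F_fun[OF nodes(4)[OF that] nodes(5)[OF that] nodes(1)[OF that]])
      show "lin_on (Qh S Th r ch) (G_fun S Th ch \<gamma> D (node \<mu>))" if "\<mu> \<in> {1..k+1}" for \<mu>
        by (rule lin_G_fun[OF nodes(6)[OF that] nodes(7)[OF that] nodes(2)[OF that] nodes(3)[OF that]])
      show "L2_on surf (GDu S) (duD D (t (n - 1)))" using T ab by (intro uD) auto
    qed
  qed
qed

end
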